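(* Let $X=(X(t))_{t\ge 0}$ be an almost surely nondecreasing and right-continuous stochastic process. Suppose that there exist functions $a,b$ and a stochastic process $W=(W(u))_{u\ge 0}$ such that - $a$ is a positive function with $\lim_{t\to\infty}a(t)=\infty$; - $b$ is a positive nondecreasing right-continuous function which varies regularly at $\infty$ of index $\alpha>0$ and satisfies $\lim_{t\to\infty}(b(t)/a(t))=\infty$; - $W$ is almost surely locally H\"older continuous, that is, for some $\gamma\in(0,1]$ and all $T>0$ there is an almost surely finite positive random variable $V_T$ such that, almost surely, $|W(x)-W(y)|\le V_T|x-y|^\gamma$ for all $x,y\in[0,T]$; - as $t\to\infty$, $$\Big(\frac{X(ut)-b(ut)}{a(t)}\Big)_{u\ge 0}\ \Rightarrow\ (W(u))_{u\ge 0}$$ weakly on $D$ with the $J_1$-topology. Let $X_j=X^{\ast(j)}$ for $j\ge 1$. Put $b_0(t)=1$ and $b_1(t)=b(t)$ for $t>0$ and, for $j\ge 2$, $b_j=b^{\ast(j)}$. Put $W_1=W$ and, for $j\ge 2$, $$W_j(u)=j\int_0^u W(u-y)\,{\rm d}y^{\alpha(j-1)},\quad u\ge 0.$$ Then, as $t\to\infty$, $$\Big(\Big(\frac{X_j(ut)-b_j(ut)}{a(t)\,b_{j-1}(t)}\Big)_{u\ge 0}\Big)_{j\ge 1}\ \Rightarrow\ \big((W_j(u))_{u\ge 0}\big)_{j\ge 1}$$ weakly in the product $J_1$-topology on $D^{\mathbb N}$.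
   Context: $D$ is the Skorokhod space of c\`adl\`ag functions defined on $[0,\infty)$, endowed with the $J_1$-topology, and $\Rightarrow$ denotes weak convergence in a function space. $D^{\mathbb N}$ carries the product topology. A positive function $f$ is regularly varying at $\infty$ of index $\alpha\in\mathbb R$ if $\lim_{t\to\infty}f(\lambda t)/f(t)=\lambda^\alpha$ for each $\lambda>0$. For a nondecreasing right-continuous function $g$ on $[0,\infty)$, the $j$-fold Lebesgue-Stieltjes convolution of $g$ with itself is defined by $g^{\ast(1)}=g$ and, for $j\ge 2$, $$g^{\ast(j)}(t)=\int_{[0,t]}g(t-y)\,{\rm d}g^{\ast(j-1)}(y)=\int_{[0,t]}g^{\ast(j-1)}(t-y)\,{\rm d}g(y),\quad t\ge 0.$$ Here integration with respect to ${\rm d}h$ is with respect to the measure on $[0,\infty)$ assigning mass $h(y)$ to $[0,y]$ for every $y\ge0$ (so there is an atom of mass $h(0)$ at $0$). For the stochastic process $X$, the convolutions are taken pathwise. The notation ${\rm d}y^{q}$ with $q>0$ means $q y^{q-1}{\rm d}y$. *)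

theory Defs
  imports "HOL-Probability.Probability"
begin

section \<open>The Skorokhod space and the J1-topology\<close>

text \<open>A path on \<open>[0, \<infinity>)\<close> is a function \<^typ>\<open>real \<Rightarrow> real\<close> that is \<^const>\<open>undefined\<close>
  at negative arguments, so that functions agreeing on \<open>[0, \<infinity>)\<close> are equal.\<close>

definition cadlag_on_nonneg :: "(real \<Rightarrow> real) \<Rightarrow> bool" where
  "cadlag_on_nonneg f \<longleftrightarrow>
     (\<forall>t\<ge>0. (f \<longlongrightarrow> f t) (at_right t)) \<and> (\<forall>t>0. \<exists>l. (f \<longlongrightarrow> l) (at_left t))"

definition skorokhod_space :: "(real \<Rightarrow> real) set" where
  "skorokhod_space = {f \<in> extensional {0..}. cadlag_on_nonneg f}"

text \<open>Increasing bijections of \<open>[0, \<infinity>)\<close>; these are automatically continuous.\<close>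

definition time_changes :: "(real \<Rightarrow> real) set" where
  "time_changes = {l. strict_mono_on {0..} l \<and> l ` {0..} = {0..}}"

definition J1_nbhd :: "(real \<Rightarrow> real) \<Rightarrow> real \<Rightarrow> real \<Rightarrow> (real \<Rightarrow> real) set" where
  "J1_nbhd f T e = {g \<in> skorokhod_space. \<exists>l\<in>time_changes. \<exists>d<e.
     (\<forall>s\<ge>0. \<bar>l s - s\<bar> \<le> d) \<and> (\<forall>s\<in>{0..T}. \<bar>g (l s) - f s\<bar> \<le> d)}"

text \<open>The topology with neighbourhood bases \<^const>\<open>J1_nbhd\<close>. Lemma \<open>limitin_skorokhod_J1\<close> below
  identifies its convergent sequences as the usual J1-convergent ones; being first countable, it
  is therefore the J1-topology.\<close>

definition skorokhod_J1 :: "(real \<Rightarrow> real) topology" where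
  "skorokhod_J1 = topology (\<lambda>S. S \<subseteq> skorokhod_space \<and> (\<forall>f\<in>S. \<exists>T e. e > 0 \<and> J1_nbhd f T e \<subseteq> S))"

lemma J1_nbhd_mono: "T' \<le> T \<Longrightarrow> e \<le> e' \<Longrightarrow> J1_nbhd f T e \<subseteq> J1_nbhd f T' e'"
proof
  fix g assume le: "T' \<le> T" "e \<le> e'" and "g \<in> J1_nbhd f T e"
  then obtain l d where g: "g \<in> skorokhod_space" "l \<in> time_changes" "d < e"
    "\<forall>s\<ge>0. \<bar>l s - s\<bar> \<le> d" "\<forall>s\<in>{0..T}. \<bar>g (l s) - f s\<bar> \<le> d" by (auto simp: J1_nbhd_def)
  have "d < e'" using g le by simp
  moreover have "\<forall>s\<in>{0..T'}. \<bar>g (l s) - f s\<bar> \<le> d" using g le by simp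
  ultimately show "g \<in> J1_nbhd f T' e'" unfolding J1_nbhd_def using g by blast
qed

lemma openin_skorokhod_J1:
  "openin skorokhod_J1 S \<longleftrightarrow>
     S \<subseteq> skorokhod_space \<and> (\<forall>f\<in>S. \<exists>T e. e > 0 \<and> J1_nbhd f T e \<subseteq> S)"
proof -
  have "istopology (\<lambda>S. S \<subseteq> skorokhod_space \<and> (\<forall>f\<in>S. \<exists>T e. e > 0 \<and> J1_nbhd f T e \<subseteq> S))"
    unfolding istopology_def
  proof (intro conjI allI impI ballI; (elim conjE)?)
    fix S S' f
    assume *: "\<forall>f\<in>S. \<exists>T e. e > 0 \<and> J1_nbhd f T e \<subseteq> S"
      "\<forall>f\<in>S'. \<exists>T e. e > 0 \<and> J1_nbhd f T e \<subseteq> S'" "f \<in> S \<inter> S'"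
    then have "f \<in> S" "f \<in> S'" by simp_all
    obtain T e where 1: "e > 0" "J1_nbhd f T e \<subseteq> S"
      using bspec[OF *(1) \<open>f \<in> S\<close>] by (elim exE conjE)
    obtain T' e' where 2: "e' > 0" "J1_nbhd f T' e' \<subseteq> S'"
      using bspec[OF *(2) \<open>f \<in> S'\<close>] by (elim exE conjE)
    have "J1_nbhd f (max T T') (min e e') \<subseteq> S \<inter> S'"
      using J1_nbhd_mono[of T "max T T'" "min e e'" e f, THEN subset_trans, OF _ _ 1(2)]
        J1_nbhd_mono[of T' "max T T'" "min e e'" e' f, THEN subset_trans, OF _ _ 2(2)] by simp
    moreover have "min e e' > 0" using 1(1) 2(1) by simp
    ultimately show "\<exists>T e. e > 0 \<and> J1_nbhd f T e \<subseteq> S \<inter> S'" by (intro exI conjI)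
  next
    fix K f
    assume K: "\<forall>S\<in>K. S \<subseteq> skorokhod_space \<and> (\<forall>f\<in>S. \<exists>T e. e > 0 \<and> J1_nbhd f T e \<subseteq> S)"
      and f: "f \<in> \<Union>K"
    then obtain S where "S \<in> K" "f \<in> S" by blast
    with K have "\<exists>T e. e > 0 \<and> J1_nbhd f T e \<subseteq> S" by simp
    then obtain T e where "e > 0" "J1_nbhd f T e \<subseteq> S" by (elim exE conjE)
    moreover have "S \<subseteq> \<Union>K" using \<open>S \<in> K\<close> by (rule Union_upper)
    ultimately show "\<exists>T e. e > 0 \<and> J1_nbhd f T e \<subseteq> \<Union>K"
      by (intro exI conjI) (assumption, rule subset_trans)
  next
    fix K
    assume "\<forall>S\<in>K. S \<subseteq> skorokhod_space \<and> (\<forall>f\<in>S. \<exists>T e. e > 0 \<and> J1_nbhd f T e \<subseteq> S)"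
    then show "\<Union>K \<subseteq> skorokhod_space" by (intro Union_least) simp
  qed (erule le_infI1)
  then show ?thesis by (simp only: skorokhod_J1_def topology_inverse')
qed

lemma topspace_skorokhod_J1 [simp]: "topspace skorokhod_J1 = skorokhod_space"
proof -
  have "J1_nbhd f 0 1 \<subseteq> skorokhod_space" for f by (auto simp: J1_nbhd_def)
  then have "openin skorokhod_J1 skorokhod_space"
    unfolding openin_skorokhod_J1 using zero_less_one by blast
  then have "skorokhod_space \<subseteq> topspace skorokhod_J1" by (rule openin_subset)
  moreover have "topspace skorokhod_J1 \<subseteq> skorokhod_space"
    using openin_topspace[of skorokhod_J1] by (simp only: openin_skorokhod_J1)
  ultimately show ?thesis by (rule subset_antisym[rotated])
qed

lemma id_time_changes: "(\<lambda>s. s) \<in> time_changes"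
  by (auto simp: time_changes_def strict_mono_on_def)

lemma comp_time_changes: "l \<in> time_changes \<Longrightarrow> m \<in> time_changes \<Longrightarrow> (\<lambda>s. m (l s)) \<in> time_changes"
proof -
  assume l: "l \<in> time_changes" and m: "m \<in> time_changes"
  then have "l s \<ge> 0" if "s \<ge> 0" for s using that by (auto simp: time_changes_def)
  moreover have "(\<lambda>s. m (l s)) ` {0..} = {0..}"
    using l m by (simp add: time_changes_def image_image[symmetric])
  ultimately show ?thesis using l m by (auto simp: time_changes_def strict_mono_on_def)
qed

lemma J1_nbhd_self: "f \<in> skorokhod_space \<Longrightarrow> e > 0 \<Longrightarrow> f \<in> J1_nbhd f T e"
  unfolding J1_nbhd_def using id_time_changes by (auto intro!: bexI[of _ "\<lambda>s. s"] exI[of _ 0])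

lemma openin_J1_nbhd: "openin skorokhod_J1 (J1_nbhd f T e)"
  unfolding openin_skorokhod_J1
proof (intro conjI ballI)
  show "J1_nbhd f T e \<subseteq> skorokhod_space" by (auto simp: J1_nbhd_def)
  fix g assume "g \<in> J1_nbhd f T e"
  then obtain l d where l: "l \<in> time_changes" "d < e" "\<And>s. s \<ge> 0 \<Longrightarrow> \<bar>l s - s\<bar> \<le> d"
    "\<And>s. s \<in> {0..T} \<Longrightarrow> \<bar>g (l s) - f s\<bar> \<le> d" by (auto simp: J1_nbhd_def)
  have "J1_nbhd g (T + e) (e - d) \<subseteq> J1_nbhd f T e"
  proof
    fix k assume "k \<in> J1_nbhd g (T + e) (e - d)"
    then obtain m c where m: "k \<in> skorokhod_space" "m \<in> time_changes" "c < e - d"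
      "\<And>s. s \<ge> 0 \<Longrightarrow> \<bar>m s - s\<bar> \<le> c" "\<And>s. s \<in> {0..T + e} \<Longrightarrow> \<bar>k (m s) - g s\<bar> \<le> c"
      by (auto simp: J1_nbhd_def)
    have l0: "l s \<ge> 0" if "s \<ge> 0" for s using that l(1) by (auto simp: time_changes_def)
    have 1: "\<bar>m (l s) - s\<bar> \<le> c + d" if "s \<ge> 0" for s
      using l(3)[OF that] m(4)[OF l0[OF that]] by linarith
    have 2: "\<bar>k (m (l s)) - f s\<bar> \<le> c + d" if "s \<in> {0..T}" for s
    proof -
      have "l s \<in> {0..T + e}" using that l(2) l(3)[of s] l0[of s] by auto
      from m(5)[OF this] l(4)[OF that] show ?thesis by linarith
    qed
    have "c + d < e" using m(3) by simp
    moreover have "(\<forall>s\<ge>0. \<bar>m (l s) - s\<bar> \<le> c + d) \<and> (\<forall>s\<in>{0..T}. \<bar>k (m (l s)) - f s\<bar> \<le> c + d)"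
      using 1 2 by simp
    ultimately have "\<exists>d<e. (\<forall>s\<ge>0. \<bar>m (l s) - s\<bar> \<le> d) \<and> (\<forall>s\<in>{0..T}. \<bar>k (m (l s)) - f s\<bar> \<le> d)"
      by (intro exI[of _ "c + d"]) simp
    with comp_time_changes[OF l(1) m(2)] m(1) show "k \<in> J1_nbhd f T e"
      unfolding J1_nbhd_def by (auto intro: bexI[rotated])
  qed
  with \<open>d < e\<close> show "\<exists>T' e'. e' > 0 \<and> J1_nbhd g T' e' \<subseteq> J1_nbhd f T e"
    by (intro exI[of _ "T + e"] exI[of _ "e - d"]) auto
qed

lemma limitin_skorokhod_J1:
  "limitin skorokhod_J1 F f sequentially \<longleftrightarrow>
     f \<in> skorokhod_space \<and> (\<forall>\<^sub>F n in sequentially. F n \<in> skorokhod_space) \<and>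
     (\<exists>l. (\<forall>n. l n \<in> time_changes) \<and> uniform_limit {0..} l (\<lambda>s. s) sequentially \<and>
        (\<forall>T. uniform_limit {0..T} (\<lambda>n s. F n (l n s)) f sequentially))"
  (is "?L \<longleftrightarrow> ?R")
proof
  assume ?L
  then have f: "f \<in> skorokhod_space" by (simp add: limitin_def)
  have ev: "\<forall>\<^sub>F n in sequentially. F n \<in> J1_nbhd f T e" if "e > 0" for T e
    using \<open>?L\<close> openin_J1_nbhd J1_nbhd_self[OF f that] by (simp add: limitin_def)
  define N where "N = (\<lambda>k::nat. J1_nbhd f (real k) (inverse (real (Suc k))))"
  define A where "A = (\<lambda>n. {k. k \<le> n \<and> F n \<in> N k})"
  define K where "K = (\<lambda>n. Max (A n))"
  have finA: "finite (A n)" for n by (simp add: A_def)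
  define P where "P = (\<lambda>n l. l \<in> time_changes \<and> (A n \<noteq> {} \<longrightarrow>
    (\<forall>s\<ge>0. \<bar>l s - s\<bar> < inverse (real (Suc (K n)))) \<and>
    (\<forall>s\<in>{0..real (K n)}. \<bar>F n (l s) - f s\<bar> < inverse (real (Suc (K n))))))"
  have "\<exists>l. P n l" for n
  proof (cases "A n = {}")
    case True then show ?thesis using id_time_changes by (auto simp: P_def)
  next
    case False
    then have "K n \<in> A n" using Max_in finA by (auto simp: K_def)
    then have "F n \<in> N (K n)" by (simp add: A_def)
    then show ?thesis by (auto simp: N_def J1_nbhd_def P_def intro: le_less_trans)
  qed
  then obtain l where l: "\<And>n. P n (l n)" by metis
  have pos: "inverse (real (Suc k)) > 0" for k by simp
  have KE: "\<forall>\<^sub>F n in sequentially. A n \<noteq> {} \<and> k \<le> K n" for k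
    using ev[of "inverse (real (Suc k))" "real k", OF pos[of k]] eventually_ge_at_top[of k]
  proof eventually_elim
    case (elim n)
    then have "k \<in> A n" by (auto simp: A_def N_def)
    then show ?case using Max_ge[OF finA] by (auto simp: K_def)
  qed
  have small: "\<exists>k. T \<le> real k \<and> inverse (real (Suc k)) \<le> e" if "e > 0" for T e :: real
  proof -
    obtain k1 where "T \<le> real k1" using real_arch_simple by blast
    moreover obtain k2 where "inverse (real (Suc k2)) < e" using reals_Archimedean[OF \<open>e > 0\<close>] by blast
    moreover have "inverse (real (Suc (max k1 k2))) \<le> inverse (real (Suc k2))"
      by (rule le_imp_inverse_le) auto
    ultimately have "T \<le> real (max k1 k2) \<and> inverse (real (Suc (max k1 k2))) \<le> e" by linarith
    then show ?thesis ..
  qed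
  have inv: "inverse (real (Suc m)) \<le> inverse (real (Suc k))" if "k \<le> m" for m k
    using that by (intro le_imp_inverse_le) auto
  have u1: "uniform_limit {0..} l (\<lambda>s. s) sequentially"
    unfolding uniform_limit_iff
  proof (intro allI impI)
    fix e :: real assume "e > 0"
    then obtain k where k: "inverse (real (Suc k)) \<le> e" using small by blast
    show "\<forall>\<^sub>F n in sequentially. \<forall>s\<in>{0..}. dist (l n s) s < e"
      using KE[of k]
    proof eventually_elim
      case (elim n)
      then have "inverse (real (Suc (K n))) \<le> e" using inv[of k "K n"] k by linarith
      moreover have "\<forall>s\<ge>0. \<bar>l n s - s\<bar> < inverse (real (Suc (K n)))"
        using elim l[of n] unfolding P_def by simp
      ultimately show ?case by (auto simp: dist_real_def intro: less_le_trans)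
    qed
  qed
  have u2: "uniform_limit {0..T} (\<lambda>n s. F n (l n s)) f sequentially" for T
    unfolding uniform_limit_iff
  proof (intro allI impI)
    fix e :: real assume "e > 0"
    then obtain k where k: "T \<le> real k" "inverse (real (Suc k)) \<le> e" using small by blast
    show "\<forall>\<^sub>F n in sequentially. \<forall>s\<in>{0..T}. dist (F n (l n s)) (f s) < e"
      using KE[of k]
    proof eventually_elim
      case (elim n)
      then have "inverse (real (Suc (K n))) \<le> e" using inv[of k "K n"] k by linarith
      moreover have "{0..T} \<subseteq> {0..real (K n)}" using elim k by auto
      moreover have "\<forall>s\<in>{0..real (K n)}. \<bar>F n (l n s) - f s\<bar> < inverse (real (Suc (K n)))"
        using elim l[of n] unfolding P_def by simp
      ultimately show ?case by (auto simp: dist_real_def subset_iff intro: less_le_trans)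
    qed
  qed
  have "\<forall>\<^sub>F n in sequentially. F n \<in> skorokhod_space"
    using ev[of 1 0] by (auto simp: J1_nbhd_def elim: eventually_mono)
  with f u1 u2 l show ?R by (auto simp: P_def)
next
  assume ?R
  then obtain l where f: "f \<in> skorokhod_space" and ev: "\<forall>\<^sub>F n in sequentially. F n \<in> skorokhod_space"
    and l: "\<And>n. l n \<in> time_changes" "uniform_limit {0..} l (\<lambda>s. s) sequentially"
    "\<And>T. uniform_limit {0..T} (\<lambda>n s. F n (l n s)) f sequentially" by blast
  show ?L unfolding limitin_def
  proof (intro conjI allI impI; (elim conjE)?)
    show "f \<in> topspace skorokhod_J1" using f by simp
    fix U assume "openin skorokhod_J1 U" "f \<in> U"
    then obtain T e where e: "e > 0" "J1_nbhd f T e \<subseteq> U" by (auto simp: openin_skorokhod_J1)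
    then have e2: "e / 2 > 0" by simp
    have "\<forall>\<^sub>F n in sequentially. F n \<in> J1_nbhd f T e"
      using ev uniform_limitD[OF l(2) e2] uniform_limitD[OF l(3)[of T] e2]
    proof eventually_elim
      case (elim n)
      have "e / 2 < e" using e by simp
      with elim l(1)[of n] show ?case
        unfolding J1_nbhd_def dist_real_def by (auto intro!: bexI[of _ "l n"] exI[of _ "e / 2"] less_imp_le)
    qed
    with e show "\<forall>\<^sub>F n in sequentially. F n \<in> U" by (auto elim: eventually_mono)
  qed
qed


section \<open>Weak convergence of random elements of a topological space\<close>

definition borel_of :: "'a topology \<Rightarrow> 'a measure" where
  "borel_of T = sigma (topspace T) {U. openin T U}"

text \<open>\<open>weakly_converges T M Y N Z F\<close>: the random elements \<open>Y t\<close> on \<open>M\<close> converge in distribution,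
  along the filter \<open>F\<close>, to the random element \<open>Z\<close> on \<open>N\<close>, in the topological space \<open>T\<close>.
  Sample-path properties hold only almost surely, so \<open>Y t \<omega>\<close> and \<open>Z \<omega>\<close> may lie outside \<open>T\<close> for
  \<open>\<omega>\<close> in a null set. The laws are hence those of Borel measurable \<open>T\<close>-valued maps \<open>Y' t\<close>, \<open>Z'\<close>
  almost surely equal to \<open>Y t\<close>, \<open>Z\<close>; they do not depend on the choice of \<open>Y'\<close>, \<open>Z'\<close>.\<close>

definition weakly_converges ::
  "'x topology \<Rightarrow> 'w measure \<Rightarrow> ('i \<Rightarrow> 'w \<Rightarrow> 'x) \<Rightarrow> 'v measure \<Rightarrow> ('v \<Rightarrow> 'x) \<Rightarrow> 'i filter \<Rightarrow> bool"
where
  "weakly_converges T M Y N Z F \<longleftrightarrow>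
     (\<exists>Y' Z'.
        (\<forall>\<^sub>F t in F. Y' t \<in> M \<rightarrow>\<^sub>M borel_of T \<and> (AE \<omega> in M. Y' t \<omega> = Y t \<omega>)) \<and>
        Z' \<in> N \<rightarrow>\<^sub>M borel_of T \<and> (AE \<omega> in N. Z' \<omega> = Z \<omega>) \<and>
        (\<forall>h. continuous_map T euclideanreal h \<and> bounded (h ` topspace T) \<longrightarrow>
           ((\<lambda>t. \<integral>\<omega>. h (Y' t \<omega>) \<partial>M) \<longlongrightarrow> (\<integral>\<omega>. h (Z' \<omega>) \<partial>N)) F))"


section \<open>Regular variation and Lebesgue-Stieltjes convolution powers\<close>

definition regularly_varying :: "(real \<Rightarrow> real) \<Rightarrow> real \<Rightarrow> bool" where
  "regularly_varying f \<alpha> \<longleftrightarrow> (\<forall>t>0. f t > 0) \<and>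
     (\<forall>c>0. ((\<lambda>t. f (c * t) / f t) \<longlongrightarrow> c powr \<alpha>) at_top)"

text \<open>The integral of \<open>f\<close> over \<open>[0, t]\<close> with respect to the measure assigning mass \<open>g y\<close> to
  \<open>[0, y]\<close>, for \<open>g\<close> nondecreasing and right-continuous on \<open>[0, \<infinity>)\<close>. The atom at \<open>0\<close> is split off
  because its mass \<open>g 0\<close> is not required to be nonnegative; when it is, see \<open>LS_integral_eq\<close>.
  Truncation at \<open>0\<close> makes the integrator monotone and right-continuous on the whole line without
  using values of \<open>g\<close> at negative arguments.\<close>

definition LS_integral :: "(real \<Rightarrow> real) \<Rightarrow> real \<Rightarrow> (real \<Rightarrow> real) \<Rightarrow> real" where
  "LS_integral g t f =
     f 0 * g 0 + (LINT y:{0<..t}|interval_measure (\<lambda>y. g (max 0 y)). f y)"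

lemma LS_integral_eq:
  assumes mono: "mono_on {0..} g" and rc: "\<And>t. t \<ge> 0 \<Longrightarrow> (g \<longlongrightarrow> g t) (at_right t)"
    and g0: "g 0 \<ge> 0" and t: "t \<ge> 0"
    and int: "set_integrable (interval_measure (\<lambda>y. if y < 0 then 0 else g y)) {0..t} f"
  shows "LS_integral g t f =
    (LINT y:{0..t}|interval_measure (\<lambda>y. if y < 0 then 0 else g y). f y)"
proof -
  define F where "F = (\<lambda>y. if y < 0 then 0 else g y)"
  define G where "G = (\<lambda>y. g (max 0 y))"
  let ?\<mu> = "interval_measure F" and ?\<nu> = "interval_measure G"
  let ?D = "density ?\<mu> (indicator {0<..})"
  have gmono: "g x \<le> g y" if "0 \<le> x" "x \<le> y" for x y
    using mono that by (auto simp: mono_on_def)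
  have monoF: "F x \<le> F y" if "x \<le> y" for x y
    using that gmono[of x y] gmono[of 0 y] g0 by (auto simp: F_def)
  have monoG: "G x \<le> G y" if "x \<le> y" for x y
    unfolding G_def using that by (intro gmono) auto
  have rcFG: "continuous (at_right x) F" "continuous (at_right x) G" for x
  proof -
    have "(F \<longlongrightarrow> F x) (at_right x) \<and> (G \<longlongrightarrow> G x) (at_right x)"
    proof (cases "x < 0")
      case True
      have "\<forall>\<^sub>F y in at_right x. y < 0"
        using True by (auto simp: eventually_at_right)
      then have "\<forall>\<^sub>F y in at_right x. F y = F x" "\<forall>\<^sub>F y in at_right x. G y = G x"
        using True by (auto simp: F_def G_def elim!: eventually_mono)
      then show ?thesis by (auto intro: tendsto_eventually)
    next
      case False
      then have "\<forall>\<^sub>F y in at_right x. g y = F y" "\<forall>\<^sub>F y in at_right x. g y = G y"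
        by (auto simp: F_def G_def intro: eventually_mono[OF eventually_at_right_less[of x]])
      then show ?thesis
        using False rc[of x] by (auto simp: F_def G_def elim: Lim_transform_eventually)
    qed
    then show "continuous (at_right x) F" "continuous (at_right x) G"
      by (auto simp: continuous_within)
  qed
  have Ioc: "emeasure ?\<nu> {x<..y} = emeasure ?D {x<..y}" if "x \<le> y" for x y
  proof -
    have eq: "{0<..} \<inter> {x<..y} = {max 0 x<..y}" by auto
    have "emeasure ?D {x<..y} = emeasure ?\<mu> {max 0 x<..y}"
      by (subst emeasure_density) (auto simp: eq[symmetric] indicator_inter_arith[symmetric])
    also have "\<dots> = ennreal (if max 0 x \<le> y then F y - F (max 0 x) else 0)"
      by (rule emeasure_interval_measure_Ioc_eq[of F, OF monoF rcFG(1)])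
    also have "\<dots> = ennreal (if x \<le> y then G y - G x else 0)"
      using that by (auto simp: F_def G_def max_def)
    also have "\<dots> = emeasure ?\<nu> {x<..y}"
      by (rule emeasure_interval_measure_Ioc_eq[of G, OF monoG rcFG(2), symmetric])
    finally show ?thesis by simp
  qed
  have \<nu>: "?\<nu> = ?D"
  proof (rule measure_eqI_generator_eq[where E = "range (\<lambda>(x, y). {x<..y})" and \<Omega> = UNIV
        and A = "\<lambda>n::nat. {- real n<..real n}"])
    show "Int_stable (range (\<lambda>(x, y). {x<..y::real}))"
      by (auto simp: Int_stable_def)
    show "emeasure ?\<nu> X = emeasure ?D X" if "X \<in> range (\<lambda>(x, y). {x<..y})" for X
    proof -
      obtain x y where X: "X = {x<..y}" using \<open>X \<in> range _\<close> by auto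
      show ?thesis using Ioc[of x y] by (cases "x \<le> y") (auto simp: X)
    qed
    show "sets ?\<nu> = sigma_sets UNIV (range (\<lambda>(x, y). {x<..y}))"
      "sets ?D = sigma_sets UNIV (range (\<lambda>(x, y). {x<..y}))"
      by (auto simp: borel_sigma_sets_Ioc)
    show "(\<Union>n::nat. {- real n<..real n}) = UNIV"
    proof (intro equalityI subsetI UN_I)
      fix x :: real
      show "x \<in> {- real (nat \<lceil>\<bar>x\<bar> + 1\<rceil>)<..real (nat \<lceil>\<bar>x\<bar> + 1\<rceil>)}" by (auto; linarith)
    qed auto
    show "emeasure ?\<nu> {- real n<..real n} \<noteq> \<infinity>" for n :: nat
      using emeasure_interval_measure_Ioc_eq[of G "- real n" "real n", OF monoG rcFG(2)] by simp
  qed auto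
  have fm: "set_integrable ?\<mu> {0..t} f" using int by (simp add: F_def)
  have i1: "set_integrable ?\<mu> {0<..t} f" and i0: "set_integrable ?\<mu> {0} f"
    using t by (auto intro: set_integrable_subset[OF fm])
  have "(LINT y:{0<..t}|?\<nu>. f y) = (LINT y:{0<..t}|?\<mu>. f y)"
  proof -
    have "(\<lambda>y. indicator {0<..t} y *\<^sub>R f y) \<in> borel_measurable ?\<mu>"
      using i1 by (auto simp: set_integrable_def)
    then have "(LINT y|density ?\<mu> (\<lambda>y. ennreal (indicator {0<..} y)). indicator {0<..t} y *\<^sub>R f y)
        = (LINT y|?\<mu>. indicator {0<..} y *\<^sub>R (indicator {0<..t} y *\<^sub>R f y))"
      by (intro integral_density) auto
    also have "\<dots> = (LINT y|?\<mu>. indicator {0<..t} y *\<^sub>R f y)"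
      by (intro Bochner_Integration.integral_cong) (auto simp: indicator_def)
    finally show ?thesis unfolding \<nu> set_lebesgue_integral_def by (simp add: ennreal_indicator)
  qed
  moreover have "(LINT y:{0}|?\<mu>. f y) = f 0 * g 0"
  proof -
    have eq: "{0::real} = (\<Inter>n. {- inverse (real (Suc n))<..0})"
    proof (intro equalityI subsetI)
      fix x assume *: "x \<in> (\<Inter>n. {- inverse (real (Suc n))<..0})"
      show "x \<in> {0}"
      proof (rule ccontr)
        assume "x \<notin> {0}"
        with * have "- x > 0" by auto
        then obtain n where "inverse (real (Suc n)) < - x" using reals_Archimedean by blast
        with * show False by (auto dest: spec[of _ n])
      qed
    qed auto
    have atom: "emeasure ?\<mu> {- inverse (real (Suc n))<..0} = ennreal (g 0)" for n
    proof -
      have "- inverse (real (Suc n)) < 0" by simp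
      then show ?thesis
        using emeasure_interval_measure_Ioc_eq[of F "- inverse (real (Suc n))" 0, OF monoF rcFG(1)]
        by (simp add: F_def del: of_nat_Suc)
    qed
    have "(\<lambda>n. emeasure ?\<mu> {- inverse (real (Suc n))<..0}) \<longlonglongrightarrow>
        emeasure ?\<mu> (\<Inter>n. {- inverse (real (Suc n))<..0})"
    proof (rule Lim_emeasure_decseq)
      show "decseq (\<lambda>n. {- inverse (real (Suc n))<..0})"
      proof (unfold decseq_def, intro allI impI)
        fix m n :: nat assume "m \<le> n"
        then have "inverse (real (Suc n)) \<le> inverse (real (Suc m))"
          by (intro le_imp_inverse_le) auto
        then show "{- inverse (real (Suc n))<..0} \<subseteq> {- inverse (real (Suc m))<..0}"
          unfolding subset_iff greaterThanAtMost_iff by (intro allI impI) linarith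
      qed
    qed (auto simp: atom simp del: of_nat_Suc)
    then have "emeasure ?\<mu> {0} = ennreal (g 0)"
      unfolding eq[symmetric] atom by (simp add: LIMSEQ_const_iff)
    then have "measure ?\<mu> {0} = g 0" using g0 by (simp add: measure_def)
    moreover have "(LINT y:{0}|?\<mu>. f y) = (LINT y:{0}|?\<mu>. f 0)"
      by (rule set_lebesgue_integral_cong) auto
    ultimately show ?thesis
      using \<open>emeasure ?\<mu> {0} = ennreal (g 0)\<close> by (simp add: set_lebesgue_integral_def)
  qed
  moreover have "(LINT y:{0..t}|?\<mu>. f y) = (LINT y:{0}|?\<mu>. f y) + (LINT y:{0<..t}|?\<mu>. f y)"
  proof -
    have "{0..t} = {0} \<union> {0<..t}" using t by auto
    then show ?thesis using set_integral_Un[OF _ i0 i1] by simp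
  qed
  ultimately show ?thesis by (simp add: LS_integral_def F_def G_def)
qed

text \<open>The zeroth power is the constant \<open>1\<close>, the distribution function of the unit mass at \<open>0\<close>.\<close>

fun conv_power :: "(real \<Rightarrow> real) \<Rightarrow> nat \<Rightarrow> real \<Rightarrow> real" where
  "conv_power g 0 = (\<lambda>t. 1)"
| "conv_power g (Suc 0) = g"
| "conv_power g (Suc (Suc n)) = (\<lambda>t. LS_integral g t (\<lambda>y. conv_power g (Suc n) (t - y)))"

text \<open>The limit process, path by path; \<open>d(y powr q)\<close> is \<open>q * y powr (q - 1) dy\<close> with \<open>q = \<alpha> (j - 1)\<close>.\<close>

definition limit_path :: "real \<Rightarrow> (real \<Rightarrow> real) \<Rightarrow> nat \<Rightarrow> real \<Rightarrow> real" where
  "limit_path \<alpha> w j u =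
     (if j = 1 then w u
      else let q = \<alpha> * (real j - 1)
           in real j * (LBINT y:{0..u}. w (u - y) * (q * y powr (q - 1))))"

end

theory Submission
  imports Defs
begin

text \<open>Write \<open>f * dg\<close> for the function whose value at \<open>u\<close> is the integral of \<open>f (u - y) dg(y)\<close> over \<open>[0, u]\<close>,
  \<open>g^j\<close> for the \<open>j\<close>-th convolution power, and \<open>p u = u powr \<alpha>\<close>. The idea is to linearize the map
  \<open>X \<mapsto> X^j\<close> at \<open>b\<close>. Since convolution is commutative,
  \<open>X^(j+1) - b^(j+1) = (X^j - b^j) * dX + (X - b) * d(b^j)\<close>.
  Rescale time by \<open>t\<close> and divide \<open>X\<close> and \<open>b\<close> by \<open>b t\<close>: both tend to \<open>p\<close> locally uniformly, \<open>b\<close> by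
  regular variation and monotonicity, and \<open>X\<close> because \<open>X - b\<close> is only of the order of \<open>a\<close>,
  which is negligible against \<open>b\<close>. Convolution is continuous for locally uniform convergence, so if \<open>(X - b) / a\<close> tends to \<open>w\<close>, the rescaled
  differences tend to functions \<open>L j\<close> with \<open>L 1 = w\<close> and \<open>L (j+1) = L j * dp + w * d(p^j)\<close>. By
  associativity \<open>L j\<close> is \<open>j\<close> times \<open>w * d(p^(j-1))\<close>. Self-similarity of \<open>p\<close> makes the value of \<open>p^k\<close> at \<open>u\<close> a
  constant multiple of \<open>u powr (\<alpha> k)\<close>, and the same constant is the limit of the value of \<open>b^k\<close> at \<open>t\<close>
  divided by the \<open>k\<close>-th power of the number \<open>b t\<close>. It cancels, which leaves the stated limit path. This
  deterministic result is \<open>scaled_conv_power_loc_uniform\<close>.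

  The facts about convolution that it uses (existence, cadlag paths, commutativity, associativity,
  scaling, continuity) all follow from one principle. A cadlag function is, uniformly on compact sets,
  a limit of linear combinations of the indicators of \<open>[s, \<infinity>)\<close>, convolution with such an indicator
  merely shifts \<open>g\<close> by \<open>s\<close>, and \<open>f * dg\<close> is bounded by the supremum of \<open>f\<close> times the variation of \<open>g\<close>.

  The paths of \<open>W\<close> are Hoelder, hence continuous, and J1-convergence to a continuous path is locally
  uniform convergence. Therefore the normalizing maps, which change with \<open>t\<close>, take paths that
  converge to a path of \<open>W\<close> to convergent sequences, and \<open>extended_continuous_mapping\<close> transfers the weak
  convergence. There the varying functions are dominated by Lipschitz envelopes on the (metrizable)
  Skorokhod space, to which the hypothesis applies. What remains is Borel measurability
  in the product J1-topology. A cadlag path is the J1-limit of its step approximations on a grid, and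
  these are continuous images of countably many coordinates of the path, so coordinatewise measurability
  suffices (\<open>measurable_product_J1\<close>); for the coordinates of the convolutions, Riemann sums give it.\<close>

section \<open>Step functions and cadlag functions\<close>

text \<open>The span of the indicators of \<open>[s, \<infinity>)\<close>, \<open>s \<ge> 0\<close>. Half-lines rather than bounded intervals, because
  convolution with the indicator of a half-line is a translation.\<close>

inductive_set steps :: "(real \<Rightarrow> real) set" where
  zero: "(\<lambda>x. 0) \<in> steps"
| add: "\<phi> \<in> steps \<Longrightarrow> 0 \<le> s \<Longrightarrow> (\<lambda>x. \<phi> x + c * indicat_real {s..} x) \<in> steps"

lemma steps_single: "0 \<le> s \<Longrightarrow> (\<lambda>x. c * indicat_real {s..} x) \<in> steps"
  using steps.add[OF steps.zero, of s c] by simp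

lemma steps_add: "\<phi> \<in> steps \<Longrightarrow> \<psi> \<in> steps \<Longrightarrow> (\<lambda>x. \<phi> x + \<psi> x) \<in> steps"
proof (induction rule: steps.induct)
  case (add \<phi> s c)
  from steps.add[OF add.IH[OF add.prems] add.hyps(2), of c] show ?case by (simp add: algebra_simps)
qed simp

lemma steps_scale: "\<phi> \<in> steps \<Longrightarrow> (\<lambda>x. r * \<phi> x) \<in> steps"
proof (induction rule: steps.induct)
  case (add \<phi> s c)
  from steps.add[OF add.IH add.hyps(2), of "r * c"] show ?case by (simp add: algebra_simps)
qed (simp add: steps.zero)

lemma steps_cut: "\<phi> \<in> steps \<Longrightarrow> 0 \<le> b \<Longrightarrow> (\<lambda>x. \<phi> x * indicat_real {b..} x) \<in> steps"
proof (induction rule: steps.induct)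
  case (add \<phi> s c)
  have "(\<lambda>x. (\<phi> x + c * indicat_real {s..} x) * indicat_real {b..} x)
    = (\<lambda>x. \<phi> x * indicat_real {b..} x + c * indicat_real {max s b..} x)"
    by (auto simp: indicator_def algebra_simps)
  then show ?case using steps.add[OF add.IH[OF add.prems], of "max s b" c] add.prems by simp
qed (simp add: steps.zero)

lemma steps_locally_constant:
  assumes "\<phi> \<in> steps"
  shows "\<exists>S. finite S \<and> (\<forall>x y. x \<le> y \<and> S \<inter> {x<..y} = {} \<longrightarrow> \<phi> x = \<phi> y)"
  using assms
proof (induction rule: steps.induct)
  case (add \<phi> s c)
  then obtain S where S: "finite S" "\<And>x y. x \<le> y \<Longrightarrow> S \<inter> {x<..y} = {} \<Longrightarrow> \<phi> x = \<phi> y" by blast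
  have "\<phi> x + c * indicat_real {s..} x = \<phi> y + c * indicat_real {s..} y"
    if "x \<le> y" "insert s S \<inter> {x<..y} = {}" for x y
    using S(2)[of x y] that by (auto simp: indicator_def)
  then show ?case using S(1) by (intro exI[of _ "insert s S"]) auto
qed auto

text \<open>Near a point the value there and the left limit give a two-valued step function. Approximations on
  \<open>[a, b)\<close> and \<open>[b, c)\<close> are joined by switching at \<open>b\<close>, so bisection reduces the claim to this
  local one.\<close>

lemma cadlag_step_approx:
  assumes f: "cadlag_on_nonneg f" and e: "e > 0"
  shows "\<exists>\<phi>\<in>steps. \<forall>x\<in>{0..T}. \<bar>f x - \<phi> x\<bar> \<le> e"
proof (cases "T \<ge> 0")
  case True
  define P where "P a b \<longleftrightarrow> (\<exists>\<phi>\<in>steps. \<forall>x. 0 \<le> x \<and> a \<le> x \<and> x < b \<longrightarrow> \<bar>f x - \<phi> x\<bar> \<le> e)" for a b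
  have PI: "P a b" if "\<phi> \<in> steps" "\<And>x. 0 \<le> x \<Longrightarrow> a \<le> x \<Longrightarrow> x < b \<Longrightarrow> \<bar>f x - \<phi> x\<bar> \<le> e" for a b \<phi>
    unfolding P_def using that by blast
  have "P 0 (T + 1)"
  proof (rule Bolzano)
    show "0 \<le> T + 1" using True by simp
  next
    fix a b c assume P: "P a b" "P b c" and le: "a \<le> b" "b \<le> c"
    obtain \<phi> \<psi> where 1: "\<phi> \<in> steps" "\<And>x. 0 \<le> x \<Longrightarrow> a \<le> x \<Longrightarrow> x < b \<Longrightarrow> \<bar>f x - \<phi> x\<bar> \<le> e"
      and 2: "\<psi> \<in> steps" "\<And>x. 0 \<le> x \<Longrightarrow> b \<le> x \<Longrightarrow> x < c \<Longrightarrow> \<bar>f x - \<psi> x\<bar> \<le> e"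
      using P unfolding P_def by blast
    let ?H = "indicat_real {max 0 b..}"
    have "(\<lambda>x. \<phi> x + (\<psi> x + (-1) * \<phi> x) * ?H x) \<in> steps"
      by (intro steps_add steps_cut steps_scale 1 2) auto
    moreover have "\<bar>f x - (\<phi> x + (\<psi> x + (-1) * \<phi> x) * ?H x)\<bar> \<le> e" if "0 \<le> x" "a \<le> x" "x < c" for x
    proof (cases "x < b")
      case True
      then have "?H x = 0" by simp
      with 1(2)[of x] that True show ?thesis by (simp only: mult_zero_right add_0_right)
    next
      case False
      then have "?H x = 1" using that by simp
      moreover have "\<phi> x + (\<psi> x + (-1) * \<phi> x) * 1 = \<psi> x" by simp
      ultimately show ?thesis using 2(2)[of x] that False by simp
    qed
    ultimately show "P a c" by (rule PI)
  next
    fix x assume x: "0 \<le> x" "x \<le> T + 1"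
    have "eventually (\<lambda>y. dist (f y) (f x) < e) (at_right x)"
      using f x e unfolding cadlag_on_nonneg_def by (auto intro: tendstoD)
    then obtain b where b: "b > x" "\<And>y. x < y \<Longrightarrow> y < b \<Longrightarrow> \<bar>f y - f x\<bar> < e"
      unfolding eventually_at_right_field dist_real_def by blast
    obtain l a where a: "a < x" "\<And>y. 0 \<le> y \<Longrightarrow> a < y \<Longrightarrow> y < x \<Longrightarrow> \<bar>f y - l\<bar> < e"
    proof (cases "x = 0")
      case True then show ?thesis using that[of "-1"] by auto
    next
      case False
      with x have "x > 0" by simp
      with f obtain l where l: "(f \<longlongrightarrow> l) (at_left x)" unfolding cadlag_on_nonneg_def by blast
      obtain a where "a < x" "\<And>y. a < y \<Longrightarrow> y < x \<Longrightarrow> \<bar>f y - l\<bar> < e"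
        using tendstoD[OF l e] unfolding eventually_at_left_field dist_real_def by blast
      then show ?thesis using that[of a l] by auto
    qed
    define d where "d = min (b - x) (x - a)"
    have "P a' b'" if "a' \<le> x" "x \<le> b'" "b' - a' < d" for a' b'
    proof -
      have "(\<lambda>y. l * indicat_real {0..} y + (f x - l) * indicat_real {x..} y) \<in> steps"
        by (intro steps.add steps_single x) auto
      moreover have "\<bar>f y - (l * indicat_real {0..} y + (f x - l) * indicat_real {x..} y)\<bar> \<le> e"
        if y: "0 \<le> y" "a' \<le> y" "y < b'" for y
      proof -
        have "a < y" "y < b" using that \<open>a' \<le> x\<close> \<open>x \<le> b'\<close> \<open>b' - a' < d\<close> by (auto simp: d_def)
        then show ?thesis using a(2)[of y] b(2)[of y] e y(1) by (cases y x rule: linorder_cases) (auto simp: indicator_def)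
      qed
      ultimately show ?thesis by (rule PI)
    qed
    moreover have "d > 0" using a b by (simp add: d_def)
    ultimately show "\<exists>d>0. \<forall>a b. a \<le> x \<and> x \<le> b \<and> b - a < d \<longrightarrow> P a b" by blast
  qed
  then show ?thesis unfolding P_def by force
qed (use steps.zero in auto)

lemma cadlag_add:
  assumes "cadlag_on_nonneg f" "cadlag_on_nonneg g"
  shows "cadlag_on_nonneg (\<lambda>x. f x + g x)"
  unfolding cadlag_on_nonneg_def
proof (intro conjI allI impI)
  fix t :: real
  show "((\<lambda>x. f x + g x) \<longlongrightarrow> f t + g t) (at_right t)" if "t \<ge> 0"
    using assms that by (intro tendsto_add) (auto simp: cadlag_on_nonneg_def)
  show "\<exists>l. ((\<lambda>x. f x + g x) \<longlongrightarrow> l) (at_left t)" if "t > 0"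
    using assms that unfolding cadlag_on_nonneg_def by (blast intro: tendsto_add)
qed

lemma cadlag_cmult:
  assumes "cadlag_on_nonneg f"
  shows "cadlag_on_nonneg (\<lambda>x. c * f x)"
  unfolding cadlag_on_nonneg_def
proof (intro conjI allI impI)
  fix t :: real
  show "((\<lambda>x. c * f x) \<longlongrightarrow> c * f t) (at_right t)" if "t \<ge> 0"
    using assms that by (intro tendsto_mult_left) (auto simp: cadlag_on_nonneg_def)
  show "\<exists>l. ((\<lambda>x. c * f x) \<longlongrightarrow> l) (at_left t)" if "t > 0"
    using assms that unfolding cadlag_on_nonneg_def by (blast intro: tendsto_mult_left)
qed

lemma cadlag_diff:
  assumes "cadlag_on_nonneg f" "cadlag_on_nonneg g"
  shows "cadlag_on_nonneg (\<lambda>x. f x - g x)"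
  using cadlag_add[OF assms(1) cadlag_cmult[OF assms(2), of "-1"]] by simp

lemma cadlag_const: "cadlag_on_nonneg (\<lambda>x. c)"
  by (auto simp: cadlag_on_nonneg_def)

lemma steps_cadlag: "\<phi> \<in> steps \<Longrightarrow> cadlag_on_nonneg \<phi>"
proof (induction rule: steps.induct)
  case zero show ?case by (simp add: cadlag_const)
next
  case (add \<phi> s c)
  have "(indicat_real {s..} \<longlongrightarrow> indicat_real {s..} t) (at_right t)" for t
  proof (rule tendsto_eventually)
    show "\<forall>\<^sub>F x in at_right t. indicat_real {s..} x = indicat_real {s..} t"
      unfolding eventually_at_right_field
      by (rule exI[of _ "if t < s then s else t + 1"]) (auto simp: indicator_def)
  qed
  moreover have "(indicat_real {s..} \<longlongrightarrow> indicat_real {s<..} t) (at_left t)" for t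
  proof (rule tendsto_eventually)
    show "\<forall>\<^sub>F x in at_left t. indicat_real {s..} x = indicat_real {s<..} t"
      unfolding eventually_at_left_field
      by (rule exI[of _ "if s < t then s else t - 1"]) (auto simp: indicator_def)
  qed
  ultimately have "cadlag_on_nonneg (\<lambda>x. c * indicat_real {s..} x)"
    unfolding cadlag_on_nonneg_def by (blast intro: tendsto_mult_left)
  with add.IH show ?case by (rule cadlag_add)
qed

text \<open>Together with \<open>cadlag_step_approx\<close> this characterizes cadlag functions. It is used to show that a
  construction preserves them: only its effect on step functions has to be understood.\<close>

lemma cadlag_if_step_approx:
  assumes "\<And>T e. e > 0 \<Longrightarrow> \<exists>\<phi>\<in>steps. \<forall>x\<in>{0..T}. \<bar>f x - \<phi> x\<bar> \<le> e"
  shows "cadlag_on_nonneg f"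
  unfolding cadlag_on_nonneg_def
proof (intro conjI allI impI)
  have "\<exists>\<phi>. \<phi> \<in> steps \<and> (\<forall>x\<in>{0..T}. \<bar>f x - \<phi> x\<bar> \<le> inverse (Suc n))" for T and n :: nat
    using assms[of "inverse (Suc n)" T] by auto
  then obtain \<Phi> where \<Phi>: "\<And>T n. \<Phi> T n \<in> steps" 
      "\<And>T n x. x \<in> {0..T} \<Longrightarrow> \<bar>f x - \<Phi> T n x\<bar> \<le> inverse (Suc n)" by metis
  have u: "uniform_limit {0..T} (\<Phi> T) f sequentially" for T
  proof (rule uniform_limitI)
    fix e :: real assume "e > 0"
    then have "\<forall>\<^sub>F n in sequentially. inverse (real (Suc n)) < e"
      using LIMSEQ_inverse_real_of_nat order_tendstoD(2) by blast
    then show "\<forall>\<^sub>F n in sequentially. \<forall>x\<in>{0..T}. dist (\<Phi> T n x) (f x) < e"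
    proof eventually_elim
      case (elim n) then show ?case using \<Phi>(2)[of _ T n] by (fastforce simp: dist_real_def abs_minus_commute)
    qed
  qed
  fix t :: real
  {
    assume t: "t \<ge> 0"
    show "(f \<longlongrightarrow> f t) (at_right t)"
    proof (rule swap_uniform_limit'[OF _ _ u[of "t + 1"]])
      show "\<forall>\<^sub>F n in sequentially. (\<Phi> (t + 1) n \<longlongrightarrow> \<Phi> (t + 1) n t) (at_right t)"
        using steps_cadlag[OF \<Phi>(1)] t by (auto simp: cadlag_on_nonneg_def)
      show "(\<lambda>n. \<Phi> (t + 1) n t) \<longlonglongrightarrow> f t"
        using tendsto_uniform_limitI[OF u[of "t + 1"], of t] t by simp
      show "\<forall>\<^sub>F x in at_right t. x \<in> {0..t + 1}"
        unfolding eventually_at_right_field using t by (intro exI[of _ "t + 1"]) auto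
    qed simp
  }
  {
    assume t: "t > 0"
    have ev: "\<forall>\<^sub>F x in at_left t. x \<in> {0..t}"
      unfolding eventually_at_left_field using t by (intro exI[of _ 0]) auto
    have "\<forall>n. \<exists>l. (\<Phi> t n \<longlongrightarrow> l) (at_left t)"
      using steps_cadlag[OF \<Phi>(1)] t by (auto simp: cadlag_on_nonneg_def)
    then obtain L where L: "\<And>n. (\<Phi> t n \<longlongrightarrow> L n) (at_left t)" by metis
    have L_close: "\<bar>L m - L n\<bar> \<le> inverse (Suc m) + inverse (Suc n)" for m n
    proof (rule tendsto_upperbound)
      show "((\<lambda>x. \<bar>\<Phi> t m x - \<Phi> t n x\<bar>) \<longlongrightarrow> \<bar>L m - L n\<bar>) (at_left t)"
        by (intro tendsto_intros L)
      show "\<forall>\<^sub>F x in at_left t. \<bar>\<Phi> t m x - \<Phi> t n x\<bar> \<le> inverse (Suc m) + inverse (Suc n)"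
        using ev
      proof eventually_elim
        case (elim x) then show ?case using \<Phi>(2)[of x t m] \<Phi>(2)[of x t n] by linarith
      qed
    qed simp
    have "Cauchy L"
    proof (rule metric_CauchyI)
      fix e :: real assume "e > 0"
      then obtain k where k: "inverse (real (Suc k)) < e / 2" using reals_Archimedean[of "e / 2"] by auto
      have "dist (L m) (L n) < e" if "m \<ge> k" "n \<ge> k" for m n
      proof -
        have "inverse (real (Suc m)) \<le> inverse (real (Suc k))" "inverse (real (Suc n)) \<le> inverse (real (Suc k))"
          using that by (auto intro!: le_imp_inverse_le)
        then show ?thesis using L_close[of m n] k unfolding dist_real_def by linarith
      qed
      then show "\<exists>k. \<forall>m\<ge>k. \<forall>n\<ge>k. dist (L m) (L n) < e" by blast
    qed
    then obtain l where l: "L \<longlonglongrightarrow> l" using convergent_eq_Cauchy by blast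
    have "(f \<longlongrightarrow> l) (at_left t)"
      by (rule swap_uniform_limit'[OF _ l u[of t] ev]) (use L in auto)
    then show "\<exists>l. (f \<longlongrightarrow> l) (at_left t)" ..
  }
qed

lemma step_approxI:
  assumes "\<phi> \<in> steps" "\<And>x. x \<in> {0..T} \<Longrightarrow> \<bar>f x - \<phi> x\<bar> \<le> e"
  shows "\<exists>\<phi>\<in>steps. \<forall>x\<in>{0..T}. \<bar>f x - \<phi> x\<bar> \<le> e"
  using assms by blast

lemma steps_bounded: "\<phi> \<in> steps \<Longrightarrow> \<exists>B. \<forall>x. \<bar>\<phi> x\<bar> \<le> B"
proof (induction rule: steps.induct)
  case (add \<phi> s c)
  then obtain B where "\<And>x. \<bar>\<phi> x\<bar> \<le> B" by blast
  then have "\<bar>\<phi> x + c * indicat_real {s..} x\<bar> \<le> B + \<bar>c\<bar>" for x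
    by (intro order_trans[OF abs_triangle_ineq] add_mono) (auto simp: indicator_def)
  then show ?case by blast
qed auto

lemma cadlag_bounded:
  assumes "cadlag_on_nonneg f"
  obtains B where "B > 0" "\<And>x. x \<in> {0..T} \<Longrightarrow> \<bar>f x\<bar> \<le> B"
proof -
  obtain \<phi> where \<phi>: "\<phi> \<in> steps" "\<And>x. x \<in> {0..T} \<Longrightarrow> \<bar>f x - \<phi> x\<bar> \<le> 1"
    using cadlag_step_approx[OF assms, of 1 T] by auto
  obtain B where "\<And>x. \<bar>\<phi> x\<bar> \<le> B" using steps_bounded[OF \<phi>(1)] by blast
  then have "\<bar>f x\<bar> \<le> max 1 (B + 1)" if "x \<in> {0..T}" for x
    using \<phi>(2)[OF that] \<open>\<bar>\<phi> x\<bar> \<le> B\<close> by linarith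
  then show thesis by (intro that[of "max 1 (B + 1)"]) auto
qed

lemma steps_borel: "\<phi> \<in> steps \<Longrightarrow> \<phi> \<in> borel_measurable borel"
proof (induction rule: steps.induct)
  case zero show ?case by (rule borel_measurable_const)
next
  case (add \<phi> s c)
  show ?case
    by (rule borel_measurable_add[OF add.IH borel_measurable_times[OF borel_measurable_const
          borel_measurable_indicator]]) (rule borel_closed[OF closed_atLeast])
qed

lemma cadlag_borel:
  assumes "cadlag_on_nonneg f"
  shows "(\<lambda>x. indicat_real {0..T} x * f x) \<in> borel_measurable borel"
proof -
  have "\<exists>\<phi>. \<phi> \<in> steps \<and> (\<forall>x\<in>{0..T}. \<bar>f x - \<phi> x\<bar> \<le> inverse (Suc n))" for n :: nat
  proof -
    have "inverse (real (Suc n)) > 0" by simp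
    from cadlag_step_approx[OF assms this, of T] show ?thesis by blast
  qed
  then obtain \<Phi> where \<Phi>: "\<And>n. \<Phi> n \<in> steps" 
      "\<And>n x. x \<in> {0..T} \<Longrightarrow> \<bar>f x - \<Phi> n x\<bar> \<le> inverse (Suc n)" by metis
  show ?thesis
  proof (rule borel_measurable_LIMSEQ_real)
    show "(\<lambda>x. indicat_real {0..T} x * \<Phi> n x) \<in> borel_measurable borel" for n
      by (intro borel_measurable_times borel_measurable_indicator steps_borel \<Phi>(1)) simp
    show "(\<lambda>n. indicat_real {0..T} x * \<Phi> n x) \<longlonglongrightarrow> indicat_real {0..T} x * f x" for x
    proof (cases "x \<in> {0..T}")
      case True
      have "(\<lambda>n. \<Phi> n x - f x) \<longlonglongrightarrow> 0"
        by (rule Lim_null_comparison[OF _ LIMSEQ_inverse_real_of_nat])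
          (use \<Phi>(2)[OF True] in \<open>simp add: abs_minus_commute\<close>)
      then have "(\<lambda>n. \<Phi> n x) \<longlonglongrightarrow> f x" by (rule LIM_zero_cancel)
      then show ?thesis by (rule tendsto_mult_left)
    qed simp
  qed
qed

lemma cadlag_continuous:
  assumes "continuous_on {0..} f" shows "cadlag_on_nonneg f"
proof -
  have *: "(f \<longlongrightarrow> f t) (at t within {0..})" if "t \<ge> 0" for t
    using assms that by (simp add: continuous_on_def)
  have "(f \<longlongrightarrow> f t) (at_right t)" if "t \<ge> 0" for t
    by (rule tendsto_within_subset[OF *[OF that]]) (use that in auto)
  moreover have "(f \<longlongrightarrow> f t) (at_left t)" if "t > 0" for t
    using *[of t] at_within_interior[of t "{0..}"] that by (simp add: filterlim_at_split)
  ultimately show ?thesis unfolding cadlag_on_nonneg_def by blast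
qed

lemma cadlag_cong: 
  assumes "\<And>x. x \<ge> 0 \<Longrightarrow> f x = g x"
  shows "cadlag_on_nonneg f \<longleftrightarrow> cadlag_on_nonneg g"
proof -
  have "cadlag_on_nonneg g" if "\<And>x. x \<ge> 0 \<Longrightarrow> f x = g x" "cadlag_on_nonneg f" for f g
    by (rule cadlag_if_step_approx) (use cadlag_step_approx[OF that(2)] that(1) in fastforce)
  from this[of f g] this[of g f] assms show ?thesis by metis
qed

section \<open>Convolution of a cadlag function with a Stieltjes measure\<close>

text \<open>The value \<open>g 0\<close> is the mass at \<open>0\<close>. It may be negative, as for a process \<open>X\<close> that starts below \<open>0\<close>;
  lemmas that need a positive measure assume \<open>0 \<le> g 0\<close> in addition.\<close>

definition stieltjes :: "(real \<Rightarrow> real) \<Rightarrow> bool" where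
  "stieltjes g \<longleftrightarrow> mono_on {0..} g \<and> (\<forall>t\<ge>0. (g \<longlongrightarrow> g t) (at_right t))"

definition ls_conv :: "(real \<Rightarrow> real) \<Rightarrow> (real \<Rightarrow> real) \<Rightarrow> real \<Rightarrow> real" where
  "ls_conv f g u = LS_integral g u (\<lambda>y. f (u - y))"

abbreviation ls_measure :: "(real \<Rightarrow> real) \<Rightarrow> real measure" where
  "ls_measure g \<equiv> interval_measure (\<lambda>y. g (max 0 y))"

lemma stieltjes_mono: "stieltjes g \<Longrightarrow> 0 \<le> x \<Longrightarrow> x \<le> y \<Longrightarrow> g x \<le> g y"
  by (auto simp: stieltjes_def mono_on_def)

lemma stieltjes_cadlag: 
  assumes "stieltjes g"
  shows "cadlag_on_nonneg g"
  unfolding cadlag_on_nonneg_def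
proof (intro conjI allI impI)
  fix t :: real assume t: "t > 0"
  have "(g \<longlongrightarrow> Sup (g ` ({..<t} \<inter> {0..}))) (at t within ({..<t} \<inter> {0..}))"
    by (rule Lim_left_bound[where K = "g t"]) (use stieltjes_mono[OF assms] t in auto)
  moreover have "at t within ({..<t} \<inter> {0..}) = at_left t"
    by (rule at_within_nhd[of _ "{0<..}"]) (use t in auto)
  ultimately show "\<exists>l. (g \<longlongrightarrow> l) (at_left t)" by auto
qed (use assms in \<open>auto simp: stieltjes_def\<close>)

lemma emeasure_ls_measure:
  assumes g: "stieltjes g" and "0 \<le> x" "x \<le> y"
  shows "emeasure (ls_measure g) {x<..y} = ennreal (g y - g x)"
proof -
  have "continuous (at_right a) (\<lambda>y. g (max 0 y))" for a
  proof (cases "a < 0")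
    case True
    then have "\<forall>\<^sub>F y in at_right a. g 0 = g (max 0 y)"
      unfolding eventually_at_right_field by (intro exI[of _ 0]) auto
    then show ?thesis using True unfolding continuous_within
      by (intro Lim_transform_eventually[OF tendsto_const]) (auto simp: max_def)
  next
    case False
    then have "\<forall>\<^sub>F y in at_right a. g y = g (max 0 y)"
      by (auto intro: eventually_mono[OF eventually_at_right_less[of a]])
    moreover have "(g \<longlongrightarrow> g (max 0 a)) (at_right a)" using False g by (simp add: stieltjes_def)
    ultimately show ?thesis unfolding continuous_within by (rule Lim_transform_eventually[rotated])
  qed
  then show ?thesis using assms stieltjes_mono[OF g]
    by (subst emeasure_interval_measure_Ioc) auto
qed

lemma measure_ls_measure:
  assumes g: "stieltjes g" and "0 \<le> x" "x \<le> y"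
  shows "measure (ls_measure g) {x<..y} = g y - g x"
  using emeasure_ls_measure[OF assms] stieltjes_mono[OF assms] by (simp add: measure_def)

lemma ls_conv_integrable:
  assumes f: "cadlag_on_nonneg f" and g: "stieltjes g" and u: "0 \<le> u"
  shows "set_integrable (ls_measure g) {0<..u} (\<lambda>y. f (u - y))"
proof -
  obtain B where B: "\<And>x. x \<in> {0..u} \<Longrightarrow> \<bar>f x\<bar> \<le> B" using cadlag_bounded[OF f] by metis
  have "(\<lambda>y. indicat_real {0..u} (u - y) * f (u - y)) \<in> borel_measurable (ls_measure g)"
    by (rule measurable_compose[of "\<lambda>y. u - y" _ borel, OF _ cadlag_borel[OF f]]) auto
  then have "integrable (ls_measure g)
      (\<lambda>y. indicat_real {0<..u} y *\<^sub>R (indicat_real {0..u} (u - y) * f (u - y)))"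
    by (rule integrableI_bounded_set_indicator[rotated, where B = B])
       (use B u emeasure_ls_measure[OF g _ u] in \<open>auto simp: indicator_def\<close>)
  also have "(\<lambda>y. indicat_real {0<..u} y *\<^sub>R (indicat_real {0..u} (u - y) * f (u - y)))
     = (\<lambda>y. indicat_real {0<..u} y *\<^sub>R f (u - y))"
    by (auto simp: indicator_def)
  finally show ?thesis unfolding set_integrable_def .
qed

lemma ls_conv_add:
  assumes "cadlag_on_nonneg f" "cadlag_on_nonneg f'" "stieltjes g" "0 \<le> u"
  shows "ls_conv (\<lambda>x. f x + f' x) g u = ls_conv f g u + ls_conv f' g u"
  using assms by (simp add: ls_conv_def LS_integral_def ls_conv_integrable algebra_simps)

lemma ls_conv_cmult: "ls_conv (\<lambda>x. c * f x) g u = c * ls_conv f g u"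
  by (simp add: ls_conv_def LS_integral_def algebra_simps)

lemma ls_conv_diff:
  assumes "cadlag_on_nonneg f" "cadlag_on_nonneg f'" "stieltjes g" "0 \<le> u"
  shows "ls_conv (\<lambda>x. f x - f' x) g u = ls_conv f g u - ls_conv f' g u"
  using assms by (simp add: ls_conv_def LS_integral_def ls_conv_integrable algebra_simps)

lemma LS_integral_cong:
  assumes "\<And>x. x \<ge> 0 \<Longrightarrow> g x = g' x" "\<And>y. y \<in> {0..u} \<Longrightarrow> f y = f' y" "0 \<le> u"
  shows "LS_integral g u f = LS_integral g' u f'"
proof -
  have "(\<lambda>y. g (max 0 y)) = (\<lambda>y. g' (max 0 y))" using assms(1) by auto
  moreover have "(LINT y:{0<..u}|M. f y) = (LINT y:{0<..u}|M. f' y)" for M :: "real measure"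
    unfolding set_lebesgue_integral_def using assms(2)
    by (intro Bochner_Integration.integral_cong) (auto simp: indicator_def)
  ultimately show ?thesis using assms by (simp add: LS_integral_def)
qed

lemma ls_conv_cong:
  assumes "\<And>x. x \<ge> 0 \<Longrightarrow> f x = f' x" "\<And>x. x \<ge> 0 \<Longrightarrow> g x = g' x" "0 \<le> u"
  shows "ls_conv f g u = ls_conv f' g' u"
  unfolding ls_conv_def by (rule LS_integral_cong) (use assms in auto)

lemma ls_conv_mono:
  assumes "cadlag_on_nonneg f" "cadlag_on_nonneg f'" "stieltjes g" "0 \<le> u" "0 \<le> g 0"
    and "\<And>x. x \<in> {0..u} \<Longrightarrow> f x \<le> f' x"
  shows "ls_conv f g u \<le> ls_conv f' g u"
  unfolding ls_conv_def LS_integral_def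
  by (intro add_mono mult_right_mono set_integral_mono ls_conv_integrable assms) (use assms in auto)

text \<open>The total variation on \<open>[0, T]\<close> is that of the increasing part plus the atom at \<open>0\<close>. Taking it at \<open>T\<close>
  rather than at \<open>u\<close> makes the bound uniform in \<open>u \<le> T\<close>.\<close>

lemma ls_conv_bound:
  assumes f: "cadlag_on_nonneg f" and g: "stieltjes g" and u: "0 \<le> u" "u \<le> T"
    and B: "\<And>x. x \<in> {0..u} \<Longrightarrow> \<bar>f x\<bar> \<le> B"
  shows "\<bar>ls_conv f g u\<bar> \<le> B * (\<bar>g 0\<bar> + (g T - g 0))"
proof -
  have B0: "B \<ge> 0" using B[of 0] u by simp
  have "\<bar>LINT y:{0<..u}|ls_measure g. f (u - y)\<bar> \<le> (LINT y:{0<..u}|ls_measure g. \<bar>f (u - y)\<bar>)"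
    using set_integral_norm_bound[OF ls_conv_integrable[OF f g u(1)]] by simp
  also have "\<dots> \<le> (LINT y:{0<..u}|ls_measure g. B)"
    by (intro set_integral_mono set_integrable_abs ls_conv_integrable[OF f g u(1)] B)
      (use emeasure_ls_measure[OF g _ u(1)] in \<open>auto simp: set_integrable_def\<close>)
  also have "\<dots> = B * (g u - g 0)"
    using u emeasure_ls_measure[OF g _ u(1)] measure_ls_measure[OF g _ u(1)]
    by (simp add: set_lebesgue_integral_def)
  also have "\<dots> \<le> B * (g T - g 0)"
    using stieltjes_mono[OF g u] B0 by (intro mult_left_mono) auto
  finally have 1: "\<bar>LINT y:{0<..u}|ls_measure g. f (u - y)\<bar> \<le> B * (g T - g 0)" .
  have "\<bar>f u * g 0\<bar> \<le> B * \<bar>g 0\<bar>" using B[of u] u by (simp add: abs_mult mult_right_mono)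
  with 1 show ?thesis unfolding ls_conv_def LS_integral_def by (simp add: algebra_simps)
qed

lemma ls_conv_indicator:
  assumes g: "stieltjes g" and u: "0 \<le> u" and s: "0 \<le> s"
  shows "ls_conv (indicat_real {s..}) g u = indicat_real {s..} u * g (u - s)"
proof -
  have "(LINT y:{0<..u}|ls_measure g. indicat_real {s..} (u - y)) = (LINT y|ls_measure g. indicat_real {0<..u - s} y)"
    unfolding set_lebesgue_integral_def using s
    by (intro Bochner_Integration.integral_cong) (auto simp: indicator_def)
  also have "\<dots> = indicat_real {s..} u * (g (u - s) - g 0)"
    using measure_ls_measure[OF g, of 0 "u - s"] by (cases "s \<le> u") auto
  finally show ?thesis by (simp add: ls_conv_def LS_integral_def indicator_def)
qed

lemma ls_conv_add_indicator:
  assumes "\<phi> \<in> steps" "0 \<le> s" "stieltjes g" "0 \<le> u"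
  shows "ls_conv (\<lambda>x. \<phi> x + c * indicat_real {s..} x) g u
    = ls_conv \<phi> g u + c * (indicat_real {s..} u * g (u - s))"
  using assms ls_conv_indicator[OF assms(3,4,2)]
  by (subst ls_conv_add) (auto intro: steps_cadlag steps_single simp: ls_conv_cmult)

text \<open>Proves a relation between a step function and its convolution with \<open>g\<close>, using that each indicator
  contributes a translate of \<open>g\<close>.\<close>

lemma steps_conv_induct [consumes 3, case_names zero add]:
  assumes \<phi>: "\<phi> \<in> steps" and g: "stieltjes g" and u: "0 \<le> u"
    and zero: "P (\<lambda>x. 0) 0"
    and add: "\<And>\<phi> s c v. \<phi> \<in> steps \<Longrightarrow> 0 \<le> s \<Longrightarrow> P \<phi> v \<Longrightarrow>
       P (\<lambda>x. \<phi> x + c * indicat_real {s..} x) (v + c * (indicat_real {s..} u * g (u - s)))"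
  shows "P \<phi> (ls_conv \<phi> g u)"
  using \<phi>
proof (induction rule: steps.induct)
  case zero
  then show ?case using \<open>P (\<lambda>x. 0) 0\<close> by (simp add: ls_conv_def LS_integral_def)
next
  case (add \<phi> s c)
  show ?case
    unfolding ls_conv_add_indicator[OF add.hyps g u] by (rule assms(5)[OF add.hyps add.IH])
qed

lemma ls_conv_close:
  assumes "cadlag_on_nonneg f" "cadlag_on_nonneg \<phi>" "stieltjes g" "0 \<le> u" "u \<le> T"
    and "\<And>x. x \<in> {0..u} \<Longrightarrow> \<bar>f x - \<phi> x\<bar> \<le> e"
  shows "\<bar>ls_conv f g u - ls_conv \<phi> g u\<bar> \<le> e * (\<bar>g 0\<bar> + (g T - g 0))"
  using ls_conv_bound[OF cadlag_diff[OF assms(1,2)] assms(3-6)] ls_conv_diff[OF assms(1-4)] by simp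

lemma indicator_shift_cadlag:
  assumes g: "cadlag_on_nonneg g" and s: "0 \<le> s"
  shows "cadlag_on_nonneg (\<lambda>u. indicat_real {s..} u * g (u - s))"
proof (rule cadlag_if_step_approx)
  fix T e :: real assume "e > 0"
  then obtain \<phi> where \<phi>: "\<phi> \<in> steps" "\<And>x. x \<in> {0..T} \<Longrightarrow> \<bar>g x - \<phi> x\<bar> \<le> e"
    using cadlag_step_approx[OF g] by blast
  have "(\<lambda>u. indicat_real {s..} u * \<phi> (u - s)) \<in> steps" using \<phi>(1)
  proof (induction rule: steps.induct)
    case (add \<phi> s' c)
    have "(\<lambda>u. indicat_real {s..} u * (\<phi> (u - s) + c * indicat_real {s'..} (u - s)))
      = (\<lambda>u. indicat_real {s..} u * \<phi> (u - s) + c * indicat_real {s + s'..} u)"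
      using add.hyps s by (auto simp: indicator_def algebra_simps)
    with steps.add[OF add.IH, of "s + s'" c] add.hyps s show ?case by simp
  qed (simp add: steps.zero)
  moreover have "\<bar>indicat_real {s..} u * g (u - s) - indicat_real {s..} u * \<phi> (u - s)\<bar> \<le> e" if "u \<in> {0..T}" for u
    using \<phi>(2)[of "u - s"] that s \<open>e > 0\<close> by (auto simp: indicator_def)
  ultimately show "\<exists>\<phi>\<in>steps. \<forall>x\<in>{0..T}. \<bar>indicat_real {s..} x * g (x - s) - \<phi> x\<bar> \<le> e"
    by (rule step_approxI)
qed

lemma ls_conv_steps_cadlag:
  assumes g: "stieltjes g" and "\<phi> \<in> steps"
  shows "cadlag_on_nonneg (ls_conv \<phi> g)"
  using assms(2)
proof (induction rule: steps.induct)
  case zero show ?case by (simp add: ls_conv_def LS_integral_def cadlag_const)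
next
  case (add \<phi> s c)
  show ?case
    by (subst cadlag_cong[OF ls_conv_add_indicator[OF add.hyps g]])
      (assumption, intro cadlag_add cadlag_cmult add.IH indicator_shift_cadlag stieltjes_cadlag g add.hyps)
qed

lemma ls_conv_cadlag:
  assumes f: "cadlag_on_nonneg f" and g: "stieltjes g"
  shows "cadlag_on_nonneg (ls_conv f g)"
proof (rule cadlag_if_step_approx)
  fix T e :: real assume e: "e > 0"
  show "\<exists>\<phi>\<in>steps. \<forall>x\<in>{0..T}. \<bar>ls_conv f g x - \<phi> x\<bar> \<le> e"
  proof (cases "T \<ge> 0")
    case True
    define K where "K = \<bar>g 0\<bar> + (g T - g 0) + 1"
    have K: "K \<ge> 1" using stieltjes_mono[OF g, of 0 T] True by (simp add: K_def)
    obtain \<phi> where \<phi>: "\<phi> \<in> steps" "\<And>x. x \<in> {0..T} \<Longrightarrow> \<bar>f x - \<phi> x\<bar> \<le> e / 2 / K"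
      using cadlag_step_approx[OF f, of "e / 2 / K" T] K e by auto
    obtain \<psi> where \<psi>: "\<psi> \<in> steps" "\<And>x. x \<in> {0..T} \<Longrightarrow> \<bar>ls_conv \<phi> g x - \<psi> x\<bar> \<le> e / 2"
      using cadlag_step_approx[OF ls_conv_steps_cadlag[OF g \<phi>(1)], of "e / 2" T] e by auto
    have "\<bar>ls_conv f g u - \<psi> u\<bar> \<le> e" if u: "u \<in> {0..T}" for u
    proof -
      have "\<bar>ls_conv f g u - ls_conv \<phi> g u\<bar> \<le> e / 2 / K * (\<bar>g 0\<bar> + (g T - g 0))"
        using u \<phi> by (intro ls_conv_close f g steps_cadlag) auto
      also have "\<dots> \<le> e / 2 / K * K" using e K by (intro mult_left_mono) (auto simp: K_def)
      also have "e / 2 / K * K = e / 2" using K by simp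
      finally show ?thesis using \<psi>(2)[OF u] by linarith
    qed
    with \<psi>(1) show ?thesis by blast
  qed (use steps.zero in auto)
qed

section \<open>Riemann sums and the algebra of convolutions\<close>

text \<open>The sample point of \<open>f\<close> on the cell \<open>(u k / n, u (k + 1) / n]\<close> is the left end point, so that its
  reflection at \<open>u\<close> approaches \<open>u - y\<close> from the right, where \<open>f\<close> is continuous. This choice also makes
  the sum symmetric in \<open>f\<close> and \<open>g\<close>.\<close>

definition riemann_conv :: "(real \<Rightarrow> real) \<Rightarrow> (real \<Rightarrow> real) \<Rightarrow> real \<Rightarrow> nat \<Rightarrow> real" where
  "riemann_conv f g u n = f u * g 0 +
     (\<Sum>k<n. f (u - u * real k / real n) * (g (u * real (Suc k) / real n) - g (u * real k / real n)))"

lemma riemann_conv_add: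
  "riemann_conv (\<lambda>x. f x + c * f' x) g u n = riemann_conv f g u n + c * riemann_conv f' g u n"
  unfolding riemann_conv_def distrib_right sum.distrib mult.assoc sum_distrib_left[symmetric]
  by (simp add: distrib_left)

lemma riemann_grid_mono:
  assumes "0 \<le> (u::real)" shows "0 \<le> u * real k / real n" "u * real k / real n \<le> u * real (Suc k) / real n"
  using assms by (auto intro!: divide_right_mono mult_left_mono)

lemma riemann_grid_le:
  assumes "0 \<le> (u::real)" "k \<le> n" shows "u * real k / real n \<le> u"
proof (cases "n = 0")
  case False
  then have "u * real k \<le> u * real n" using assms by (intro mult_left_mono) auto
  then show ?thesis using False by (simp add: field_simps)
qed (use assms in auto)

lemma riemann_conv_bound:
  assumes g: "stieltjes g" and u: "0 \<le> u" and n: "n > 0" and B: "\<And>x. x \<in> {0..u} \<Longrightarrow> \<bar>f x\<bar> \<le> B"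
  shows "\<bar>riemann_conv f g u n\<bar> \<le> B * (\<bar>g 0\<bar> + (g u - g 0))"
proof -
  have "\<bar>\<Sum>k<n. f (u - u * real k / real n) * (g (u * real (Suc k) / real n) - g (u * real k / real n))\<bar>
      \<le> (\<Sum>k<n. B * (g (u * real (Suc k) / real n) - g (u * real k / real n)))"
  proof (rule order_trans[OF sum_abs sum_mono])
    fix k assume "k \<in> {..<n}"
    then have "u - u * real k / real n \<in> {0..u}" using riemann_grid_le[OF u, of k n] riemann_grid_mono[OF u, of k n] by auto
    moreover have "g (u * real k / real n) \<le> g (u * real (Suc k) / real n)"
      by (rule stieltjes_mono[OF g riemann_grid_mono[OF u]])
    ultimately show "\<bar>f (u - u * real k / real n) * (g (u * real (Suc k) / real n) - g (u * real k / real n))\<bar>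
        \<le> B * (g (u * real (Suc k) / real n) - g (u * real k / real n))"
      unfolding abs_mult using B by (simp add: mult_right_mono)
  qed
  also have "\<dots> = B * (g u - g 0)"
    unfolding sum_distrib_left[symmetric] using sum_lessThan_telescope[of "\<lambda>k. g (u * real k / real n)" n] n by simp
  finally have 1: "\<bar>\<Sum>k<n. f (u - u * real k / real n) * (g (u * real (Suc k) / real n) - g (u * real k / real n))\<bar> \<le> B * (g u - g 0)" .
  have "\<bar>f u * g 0\<bar> \<le> B * \<bar>g 0\<bar>" using B[of u] u by (simp add: abs_mult mult_right_mono)
  with 1 show ?thesis unfolding riemann_conv_def by (simp add: distrib_left)
qed

text \<open>Only the cells that start in \<open>[0, u - s]\<close> count, so up to the last of them the sum telescopes. It lies
  between the values of \<open>g\<close> at \<open>u - s\<close> and one mesh width later, and \<open>g\<close> is right-continuous.\<close>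

lemma riemann_conv_indicator:
  assumes g: "stieltjes g" and u: "0 \<le> u" and s: "0 \<le> s"
  shows "(\<lambda>n. riemann_conv (indicat_real {s..}) g u n) \<longlonglongrightarrow> indicat_real {s..} u * g (u - s)"
proof (cases "s \<le> u")
  case False
  then have "indicat_real {s..} (u - u * real k / real n) = 0" for k n :: nat
    using riemann_grid_mono(1)[OF u, of k n] by simp
  then show ?thesis using False by (simp add: riemann_conv_def)
next
  case True
  define v where "v = u - s"
  have v: "0 \<le> v" "v \<le> u" using True s by (auto simp: v_def)
  define R where "R n = riemann_conv (indicat_real {s..}) g u n" for n
  have R: "R n = g 0 + (\<Sum>k<n. if u * real k / real n \<le> v then g (u * real (Suc k) / real n) - g (u * real k / real n) else 0)" for n
  proof -
    have "indicat_real {s..} (u - z) = (if z \<le> v then 1 else 0)" for z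
      by (auto simp: v_def indicator_def)
    then show ?thesis using True unfolding R_def riemann_conv_def by (auto intro!: sum.cong)
  qed
  \<comment> \<open>both bounds telescope a copy of \<open>g\<close> that is frozen after \<open>v\<close> or after \<open>v + u / n\<close>\<close>
  have lower: "g v \<le> R n" if n: "n > 0" for n
  proof -
    have "g (min v (u * real (Suc k) / real n)) - g (min v (u * real k / real n))
      \<le> (if u * real k / real n \<le> v then g (u * real (Suc k) / real n) - g (u * real k / real n) else 0)" for k
      using stieltjes_mono[OF g, of "min v (u * real (Suc k) / real n)" "u * real (Suc k) / real n"] riemann_grid_mono[OF u, of k n] v by (auto simp: min_def)
    then have "(\<Sum>k<n. g (min v (u * real (Suc k) / real n)) - g (min v (u * real k / real n))) \<le> R n - g 0"
      unfolding R by (simp add: sum_mono)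
    then show ?thesis using sum_lessThan_telescope[of "\<lambda>k. g (min v (u * real k / real n))" n] n v by simp
  qed
  have upper: "R n \<le> g (v + u / real n)" if n: "n > 0" for n
  proof -
    let ?w = "v + u / real n"
    have w: "0 \<le> ?w" using v u by simp
    have "(if u * real k / real n \<le> v then g (u * real (Suc k) / real n) - g (u * real k / real n) else 0)
      \<le> g (min ?w (u * real (Suc k) / real n)) - g (min ?w (u * real k / real n))" for k
    proof (cases "u * real k / real n \<le> v")
      case True
      moreover have "u * real (Suc k) / real n = u * real k / real n + u / real n" by (simp add: field_simps add_divide_distrib)
      ultimately have "min ?w (u * real (Suc k) / real n) = u * real (Suc k) / real n" "min ?w (u * real k / real n) = u * real k / real n"
        using divide_nonneg_nonneg[OF u, of n] by (auto simp: min_def)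
      then show ?thesis using True by simp
    next
      case False
      have "g (min ?w (u * real k / real n)) \<le> g (min ?w (u * real (Suc k) / real n))"
        using w riemann_grid_mono[OF u, of k n] by (intro stieltjes_mono[OF g]) auto
      then show ?thesis using False by simp
    qed
    then have "R n - g 0 \<le> (\<Sum>k<n. g (min ?w (u * real (Suc k) / real n)) - g (min ?w (u * real k / real n)))"
      unfolding R by (simp add: sum_mono)
    also have "\<dots> = g (min ?w u) - g 0"
      using sum_lessThan_telescope[of "\<lambda>k. g (min ?w (u * real k / real n))" n] n w by simp
    also have "\<dots> \<le> g ?w - g 0" using stieltjes_mono[OF g, of "min ?w u" ?w] w u by simp
    finally show ?thesis by simp
  qed
  have "(\<lambda>n. g (v + u / real n)) \<longlonglongrightarrow> g v"
  proof (cases "u = 0")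
    case False
    then have "u > 0" using u by simp
    have "filterlim (\<lambda>n. v + u / real n) (at_right v) sequentially"
      unfolding filterlim_at
    proof
      show "\<forall>\<^sub>F n in sequentially. v + u / real n \<in> {v<..} \<and> v + u / real n \<noteq> v"
        using eventually_gt_at_top[of 0] by eventually_elim (use \<open>u > 0\<close> in auto)
      have "(\<lambda>n. v + u / real n) \<longlonglongrightarrow> v + 0"
        by (intro tendsto_intros lim_const_over_n)
      then show "(\<lambda>n. v + u / real n) \<longlonglongrightarrow> v" by simp
    qed
    moreover have "(g \<longlongrightarrow> g v) (at_right v)" using g v by (simp add: stieltjes_def)
    ultimately show ?thesis by (rule filterlim_compose[rotated])
  qed simp
  then have "R \<longlonglongrightarrow> g v"
  proof (rule tendsto_sandwich[rotated 3, OF _ _ ])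
    show "(\<lambda>n. g v) \<longlonglongrightarrow> g v" by simp
    show "\<forall>\<^sub>F n in sequentially. g v \<le> R n" using eventually_gt_at_top[of 0] lower by (rule eventually_mono)
    show "\<forall>\<^sub>F n in sequentially. R n \<le> g (v + u / real n)" using eventually_gt_at_top[of 0] upper by (rule eventually_mono)
  qed
  then show ?thesis using True by (simp add: R_def[abs_def] v_def)
qed

lemma riemann_conv_tendsto:
  assumes f: "cadlag_on_nonneg f" and g: "stieltjes g" and u: "0 \<le> u"
  shows "(\<lambda>n. riemann_conv f g u n) \<longlonglongrightarrow> ls_conv f g u"
proof (rule LIMSEQ_I)
  fix e :: real assume e: "e > 0"
  define K where "K = \<bar>g 0\<bar> + (g u - g 0) + 1"
  have K: "K \<ge> 1" using stieltjes_mono[OF g, of 0 u] u by (simp add: K_def)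
  define d where "d = e / (4 * K)"
  have d: "d > 0" "d * K = e / 4" using e K by (auto simp: d_def)
  obtain \<phi> where \<phi>: "\<phi> \<in> steps" "\<And>x. x \<in> {0..u} \<Longrightarrow> \<bar>f x - \<phi> x\<bar> \<le> d"
    using cadlag_step_approx[OF f d(1), of u] by blast
  have dK: "d * (\<bar>g 0\<bar> + (g u - g 0)) \<le> e / 4"
    unfolding d(2)[symmetric] using d(1) by (intro mult_left_mono) (auto simp: K_def)
  have 1: "\<bar>ls_conv f g u - ls_conv \<phi> g u\<bar> \<le> e / 4"
    using ls_conv_close[OF f steps_cadlag[OF \<phi>(1)] g u order_refl \<phi>(2)] dK by linarith
  have 2: "\<bar>riemann_conv f g u n - riemann_conv \<phi> g u n\<bar> \<le> e / 4" if "n > 0" for n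
    using riemann_conv_bound[OF g u that, of "\<lambda>x. f x + (-1) * \<phi> x" d] \<phi>(2) dK
    unfolding riemann_conv_add by simp
  have "(\<lambda>n. riemann_conv \<phi> g u n) \<longlonglongrightarrow> ls_conv \<phi> g u"
    using \<phi>(1) g u
  proof (induction rule: steps_conv_induct)
    case zero then show ?case by (simp add: riemann_conv_def)
  next
    case (add \<phi> s c v)
    show ?case unfolding riemann_conv_add
      by (intro tendsto_add tendsto_mult_left add riemann_conv_indicator g u)
  qed
  then have "\<forall>\<^sub>F n in sequentially. \<bar>riemann_conv \<phi> g u n - ls_conv \<phi> g u\<bar> < e / 4"
    using e by (auto dest!: tendstoD[where e = "e / 4"] simp: dist_real_def)
  then have "\<forall>\<^sub>F n in sequentially. norm (riemann_conv f g u n - ls_conv f g u) < e"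
    using eventually_gt_at_top[of 0]
  proof eventually_elim
    case (elim n)
    show ?case using elim(1) 2[OF elim(2)] 1 e unfolding real_norm_def by linarith
  qed
  then show "\<exists>no. \<forall>n\<ge>no. norm (riemann_conv f g u n - ls_conv f g u) < e"
    by (simp add: eventually_sequentially)
qed

text \<open>Both sides equal \<open>F n * G 0 + G n * F 0 + A - S\<close>, where the sums \<open>A\<close> of \<open>F (n - k) * G (k + 1)\<close> over
  \<open>k < n\<close> and \<open>S\<close> of \<open>F (n - k) * G k\<close> over \<open>k \<le> n\<close> are symmetric under reversal of the summation.\<close>

lemma discrete_summation_by_parts:
  fixes F G :: "nat \<Rightarrow> real"
  shows "F n * G 0 + (\<Sum>k<n. F (n - k) * (G (Suc k) - G k))
       = G n * F 0 + (\<Sum>k<n. G (n - k) * (F (Suc k) - F k))"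
proof -
  have *: "F n * G 0 + (\<Sum>k<n. F (n - k) * (G (Suc k) - G k))
     = F n * G 0 + G n * F 0 + (\<Sum>k<n. F (n - k) * G (Suc k)) - (\<Sum>k\<le>n. F (n - k) * G k)"
    for F G :: "nat \<Rightarrow> real"
    by (simp add: right_diff_distrib sum_subtractf lessThan_Suc_atMost[symmetric])
  have "(\<Sum>k<n. F (n - k) * G (Suc k)) = (\<Sum>k<n. G (n - k) * F (Suc k))"
    by (subst sum.nat_diff_reindex[symmetric]) (auto intro!: sum.cong simp: Suc_diff_Suc mult.commute)
  moreover have "(\<Sum>k\<le>n. F (n - k) * G k) = (\<Sum>k\<le>n. G (n - k) * F k)"
    by (subst sum.nat_diff_reindex[of _ "Suc n", unfolded lessThan_Suc_atMost, symmetric])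
      (auto intro!: sum.cong simp: mult.commute)
  ultimately show ?thesis unfolding *[of F G] *[of G F] by simp
qed

lemma riemann_conv_commute: "n > 0 \<Longrightarrow> riemann_conv f g u n = riemann_conv g f u n"
proof -
  assume n: "n > 0"
  have *: "riemann_conv f g u n = (\<lambda>i. f (u * real i / real n)) n * (\<lambda>i. g (u * real i / real n)) 0 + (\<Sum>k<n. (\<lambda>i. f (u * real i / real n)) (n - k)
      * ((\<lambda>i. g (u * real i / real n)) (Suc k) - (\<lambda>i. g (u * real i / real n)) k))" for f g
    unfolding riemann_conv_def
  proof (intro arg_cong2[of _ _ _ _ "(+)"] sum.cong refl)
    fix k assume "k \<in> {..<n}"
    then have "u - u * real k / real n = u * real (n - k) / real n" using n by (simp add: field_simps of_nat_diff)
    then show "f (u - u * real k / real n) * (g (u * real (Suc k) / real n) - g (u * real k / real n)) = f (u * real (n - k) / real n) * (g (u * real (Suc k) / real n) - g (u * real k / real n))"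
      by simp
  qed (use n in auto)
  show ?thesis unfolding *[of f g] *[of g f] by (rule discrete_summation_by_parts)
qed

text \<open>The Riemann sums of both sides coincide.\<close>

lemma ls_conv_commute:
  assumes "stieltjes f" "stieltjes g" "0 \<le> u"
  shows "ls_conv f g u = ls_conv g f u"
proof (rule LIMSEQ_unique)
  show "riemann_conv f g u \<longlonglongrightarrow> ls_conv f g u"
    by (intro riemann_conv_tendsto stieltjes_cadlag assms)
  have "riemann_conv g f u \<longlonglongrightarrow> ls_conv g f u"
    by (intro riemann_conv_tendsto stieltjes_cadlag assms)
  moreover have "\<forall>\<^sub>F n in sequentially. riemann_conv g f u n = riemann_conv f g u n"
    using eventually_gt_at_top[of 0] by eventually_elim (rule riemann_conv_commute)
  ultimately show "riemann_conv f g u \<longlonglongrightarrow> ls_conv g f u" by (rule Lim_transform_eventually)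
qed

lemma stieltjes_affine_image:
  assumes g: "stieltjes g" and c: "0 \<le> c" and t: "0 < t"
  shows "stieltjes (\<lambda>s. c * g (s * t))"
  unfolding stieltjes_def
proof (intro conjI mono_onI allI impI)
  show "c * g (x * t) \<le> c * g (y * t)" if "x \<in> {0..}" "x \<le> y" for x y
    using that c t by (intro mult_left_mono stieltjes_mono[OF g]) auto
  fix x :: real assume x: "0 \<le> x"
  have "filterlim (\<lambda>s. s * t) (at_right (x * t)) (at_right x)"
    unfolding filterlim_at using t by (auto intro!: tendsto_intros eventually_mono[OF eventually_at_right_less[of x]])
  moreover have "(g \<longlongrightarrow> g (x * t)) (at_right (x * t))" using g x t by (simp add: stieltjes_def)
  ultimately have "((\<lambda>s. g (s * t)) \<longlongrightarrow> g (x * t)) (at_right x)" by (rule filterlim_compose[rotated])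
  then show "((\<lambda>s. c * g (s * t)) \<longlongrightarrow> c * g (x * t)) (at_right x)" by (rule tendsto_mult_left)
qed

lemma cadlag_time_scale:
  assumes f: "cadlag_on_nonneg f" and t: "0 < t"
  shows "cadlag_on_nonneg (\<lambda>s. f (s * t))"
proof (rule cadlag_if_step_approx)
  fix T e :: real assume "e > 0"
  then obtain \<phi> where \<phi>: "\<phi> \<in> steps" "\<And>x. x \<in> {0..T * t} \<Longrightarrow> \<bar>f x - \<phi> x\<bar> \<le> e"
    using cadlag_step_approx[OF f, of e "T * t"] by blast
  have "(\<lambda>x. \<phi> (x * t)) \<in> steps" using \<phi>(1)
  proof (induction rule: steps.induct)
    case (add \<phi> s c)
    have "(\<lambda>x. \<phi> (x * t) + c * indicat_real {s..} (x * t)) = (\<lambda>x. \<phi> (x * t) + c * indicat_real {s / t..} x)"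
      using t by (auto simp: indicator_def field_simps)
    with steps.add[OF add.IH, of "s / t" c] add.hyps t show ?case by simp
  qed (simp add: steps.zero)
  moreover have "\<bar>f (x * t) - \<phi> (x * t)\<bar> \<le> e" if "x \<in> {0..T}" for x
    by (rule \<phi>(2)) (use that t in auto)
  ultimately show "\<exists>\<phi>\<in>steps. \<forall>x\<in>{0..T}. \<bar>f (x * t) - \<phi> x\<bar> \<le> e" by (rule step_approxI)
qed

lemma ls_conv_scale:
  assumes f: "cadlag_on_nonneg f" and g: "stieltjes g" and u: "0 \<le> u" and c: "0 \<le> c" and t: "0 < t"
  shows "ls_conv (\<lambda>s. f (s * t)) (\<lambda>s. c * g (s * t)) u = c * ls_conv f g (u * t)"
proof (rule LIMSEQ_unique)
  show "riemann_conv (\<lambda>s. f (s * t)) (\<lambda>s. c * g (s * t)) u \<longlonglongrightarrow> ls_conv (\<lambda>s. f (s * t)) (\<lambda>s. c * g (s * t)) u"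
    by (intro riemann_conv_tendsto stieltjes_affine_image cadlag_time_scale f g u c t)
  have "riemann_conv (\<lambda>s. f (s * t)) (\<lambda>s. c * g (s * t)) u = (\<lambda>n. c * riemann_conv f g (u * t) n)"
    unfolding riemann_conv_def by (intro ext) (simp add: sum_distrib_left algebra_simps)
  moreover have "(\<lambda>n. c * riemann_conv f g (u * t) n) \<longlonglongrightarrow> c * ls_conv f g (u * t)"
    using u t by (intro tendsto_mult_left riemann_conv_tendsto f g) auto
  ultimately show "riemann_conv (\<lambda>s. f (s * t)) (\<lambda>s. c * g (s * t)) u \<longlonglongrightarrow> c * ls_conv f g (u * t)" by simp
qed

lemma ls_conv_one_right:
  assumes "cadlag_on_nonneg f" "0 \<le> u"
  shows "ls_conv f (\<lambda>x. 1) u = f u"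
proof -
  have "stieltjes (\<lambda>x. 1)" by (auto simp: stieltjes_def mono_on_def)
  from riemann_conv_tendsto[OF assms(1) this assms(2)] have "(\<lambda>n::nat. f u) \<longlonglongrightarrow> ls_conv f (\<lambda>x. 1) u"
    by (simp add: riemann_conv_def)
  then show ?thesis by (simp add: LIMSEQ_const_iff)
qed

lemma ls_conv_shift:
  assumes u: "0 \<le> u" and s: "0 \<le> s"
  shows "ls_conv (\<lambda>x. indicat_real {s..} x * f (x - s)) g u = indicat_real {s..} u * ls_conv f g (u - s)"
proof -
  have "(LINT y:{0<..u}|ls_measure g. indicat_real {s..} (u - y) * f (u - y - s))
      = (LINT y|ls_measure g. indicat_real {0<..u - s} y *\<^sub>R f (u - s - y))"
    unfolding set_lebesgue_integral_def using s
    by (intro Bochner_Integration.integral_cong) (auto simp: indicator_def algebra_simps)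
  then show ?thesis using s
    by (cases "s \<le> u") (auto simp: ls_conv_def LS_integral_def set_lebesgue_integral_def algebra_simps)
qed

lemma ls_conv_at_0: "ls_conv f g 0 = f 0 * g 0"
  by (simp add: ls_conv_def LS_integral_def set_lebesgue_integral_def)

text \<open>Monotonicity: the value at \<open>x < y\<close> is the value at \<open>y\<close> of the convolution of \<open>f\<close> delayed by \<open>y - x\<close>,
  and the delayed function is below \<open>f\<close> because \<open>f\<close> is nonnegative and nondecreasing.\<close>

lemma ls_conv_stieltjes:
  assumes f: "stieltjes f" "0 \<le> f 0" and g: "stieltjes g" "0 \<le> g 0"
  shows "stieltjes (ls_conv f g)"
  unfolding stieltjes_def
proof (intro conjI mono_onI allI impI)
  fix x y :: real assume xy: "x \<in> {0..}" "x \<le> y"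
  define s where "s = y - x"
  have s: "0 \<le> s" "s \<le> y" "y - s = x" using xy by (auto simp: s_def)
  have "ls_conv f g x = ls_conv (\<lambda>z. indicat_real {s..} z * f (z - s)) g y"
    using ls_conv_shift[of y s f g] s xy by simp
  also have "\<dots> \<le> ls_conv f g y"
  proof (rule ls_conv_mono)
    show "indicat_real {s..} z * f (z - s) \<le> f z" if "z \<in> {0..y}" for z
      using stieltjes_mono[OF f(1), of "z - s" z] stieltjes_mono[OF f(1), of 0 z] f(2) s(1) that
      by (auto simp: indicator_def)
  qed (use xy s in \<open>simp_all add: indicator_shift_cadlag stieltjes_cadlag f g\<close>)
  finally show "ls_conv f g x \<le> ls_conv f g y" .
next
  show "(ls_conv f g \<longlongrightarrow> ls_conv f g t) (at_right t)" if "0 \<le> t" for t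
    using ls_conv_cadlag[OF stieltjes_cadlag[OF f(1)] g(1)] that by (simp add: cadlag_on_nonneg_def)
qed

text \<open>For an indicator both sides are the same translate of \<open>g * dh\<close>. Both sides are continuous in \<open>f\<close> for the
  supremum norm on \<open>[0, u]\<close>.\<close>

lemma ls_conv_assoc:
  assumes f: "cadlag_on_nonneg f" and g: "stieltjes g" "0 \<le> g 0" and h: "stieltjes h" "0 \<le> h 0" and u: "0 \<le> u"
  shows "ls_conv (ls_conv f g) h u = ls_conv f (ls_conv g h) u"
proof -
  note gh = ls_conv_stieltjes[OF g h]
  have steps: "ls_conv (ls_conv \<phi> g) h u = ls_conv \<phi> (ls_conv g h) u" if "\<phi> \<in> steps" for \<phi>
    using that gh u
  proof (induction rule: steps_conv_induct)
    case zero show ?case by (simp add: ls_conv_def LS_integral_def)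
  next
    case (add \<phi> s c v)
    have "ls_conv (ls_conv (\<lambda>x. \<phi> x + c * indicat_real {s..} x) g) h u
       = ls_conv (\<lambda>x. ls_conv \<phi> g x + c * (indicat_real {s..} x * g (x - s))) h u"
      by (rule ls_conv_cong[OF ls_conv_add_indicator[OF add(1,2) g(1)] refl u])
    also have "\<dots> = ls_conv (ls_conv \<phi> g) h u + c * (indicat_real {s..} u * ls_conv g h (u - s))"
      using add(1,2) u
      by (subst ls_conv_add) (simp_all add: ls_conv_cadlag cadlag_cmult indicator_shift_cadlag
          stieltjes_cadlag steps_cadlag g h ls_conv_cmult ls_conv_shift)
    finally show ?case using add(3) by simp
  qed
  define A H C where "A = \<bar>g 0\<bar> + (g u - g 0)" and "H = \<bar>h 0\<bar> + (h u - h 0)"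
    and "C = \<bar>ls_conv g h 0\<bar> + (ls_conv g h u - ls_conv g h 0)"
  \<comment> \<open>bounds, added up, for the norms of the two sides as linear functionals of \<open>f\<close>\<close>
  define K where "K = A * H + C"
  have K: "0 \<le> K"
    using stieltjes_mono[OF g(1) order_refl u] stieltjes_mono[OF h(1) order_refl u]
      stieltjes_mono[OF gh order_refl u]
    unfolding K_def A_def H_def C_def by (intro add_nonneg_nonneg mult_nonneg_nonneg) auto
  have "\<bar>ls_conv (ls_conv f g) h u - ls_conv f (ls_conv g h) u\<bar> \<le> e" if e: "e > 0" for e
  proof -
    define d where "d = e / (K + 1)"
    have d: "d > 0" "d * K \<le> e" using e K by (auto simp: d_def field_simps)
    obtain \<phi> where \<phi>: "\<phi> \<in> steps" "\<And>x. x \<in> {0..u} \<Longrightarrow> \<bar>f x - \<phi> x\<bar> \<le> d"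
      using cadlag_step_approx[OF f d(1), of u] by blast
    note c\<phi> = steps_cadlag[OF \<phi>(1)]
    have "\<bar>ls_conv f g x - ls_conv \<phi> g x\<bar> \<le> d * A" if "x \<in> {0..u}" for x
      unfolding A_def using that \<phi> by (intro ls_conv_close f c\<phi> g) auto
    then have "\<bar>ls_conv (ls_conv f g) h u - ls_conv (ls_conv \<phi> g) h u\<bar> \<le> d * A * H"
      unfolding H_def by (rule ls_conv_close[OF ls_conv_cadlag[OF f g(1)] ls_conv_cadlag[OF c\<phi> g(1)] h(1) u order_refl])
    moreover have "\<bar>ls_conv f (ls_conv g h) u - ls_conv \<phi> (ls_conv g h) u\<bar> \<le> d * C"
      unfolding C_def by (intro ls_conv_close f c\<phi> gh u \<phi>) auto
    ultimately have "\<bar>ls_conv (ls_conv f g) h u - ls_conv f (ls_conv g h) u\<bar> \<le> d * K"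
      unfolding K_def steps[OF \<phi>(1)] by (simp add: distrib_left)
    with d show ?thesis by linarith
  qed
  then have "\<bar>ls_conv (ls_conv f g) h u - ls_conv f (ls_conv g h) u\<bar> \<le> 0"
    by (rule field_le_epsilon) simp
  then show ?thesis by simp
qed

section \<open>Convolution powers\<close>

text \<open>Unlike the defining equations, this includes the step from the zeroth to the first power, for which the
  constant \<open>1\<close> acts as the unit mass at \<open>0\<close>.\<close>

lemma conv_power_Suc:
  assumes "stieltjes g" "0 \<le> u"
  shows "conv_power g (Suc j) u = ls_conv (conv_power g j) g u"
proof (cases j)
  case 0
  have "ls_conv (\<lambda>x. 1) g u = ls_conv (indicat_real {0..}) g u"
    by (rule ls_conv_cong) (use assms in auto)
  then show ?thesis using 0 ls_conv_indicator[OF assms, of 0] assms by simp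
qed (simp add: ls_conv_def)

lemma conv_power_cadlag:
  assumes "stieltjes g"
  shows "cadlag_on_nonneg (conv_power g j)"
proof (induction j)
  case (Suc j)
  show ?case
    by (rule iffD2[OF cadlag_cong ls_conv_cadlag[OF Suc assms]]) (rule conv_power_Suc[OF assms])
qed (simp add: cadlag_const)

lemma conv_power_at_0: "stieltjes g \<Longrightarrow> conv_power g j 0 = g 0 ^ j"
  by (induction j) (simp_all add: conv_power_Suc ls_conv_at_0 del: conv_power.simps(2,3))

lemma stieltjes_cong:
  assumes "\<And>x. x \<ge> 0 \<Longrightarrow> f x = g x"
  shows "stieltjes f \<longleftrightarrow> stieltjes g"
proof -
  have "stieltjes g" if "\<And>x. x \<ge> 0 \<Longrightarrow> f x = g x" "stieltjes f" for f g
  proof -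
    have "cadlag_on_nonneg g" using cadlag_cong[of f g] stieltjes_cadlag that by blast
    then show ?thesis using that by (auto simp: stieltjes_def cadlag_on_nonneg_def mono_on_def)
  qed
  from this[of f g] this[of g f] assms show ?thesis by metis
qed

lemma stieltjes_const: "stieltjes (\<lambda>x. c)"
  by (simp add: stieltjes_def mono_on_def)

lemma conv_power_at_0_nonneg:
  assumes "stieltjes g" "0 \<le> g 0"
  shows "0 \<le> conv_power g j 0"
  unfolding conv_power_at_0[OF assms(1)] using assms(2) by (rule zero_le_power)

lemma stieltjes_conv_power_Suc:
  assumes "stieltjes g" "stieltjes (ls_conv (conv_power g j) g)"
  shows "stieltjes (conv_power g (Suc j))"
proof -
  have "conv_power g (Suc j) x = ls_conv (conv_power g j) g x" if "x \<ge> 0" for x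
    using conv_power_Suc[OF assms(1) that] .
  from stieltjes_cong[OF this] assms(2) show ?thesis by (rule iffD2)
qed

lemma stieltjes_conv_power:
  assumes g: "stieltjes g" "0 \<le> g 0"
  shows "stieltjes (conv_power g j)"
proof (induction j)
  case 0
  have "stieltjes (\<lambda>x. 1)" by (rule stieltjes_const)
  then show ?case by simp
next
  case (Suc j)
  from ls_conv_stieltjes[OF Suc conv_power_at_0_nonneg[OF g] g] show ?case
    by (rule stieltjes_conv_power_Suc[OF g(1)])
qed

lemma conv_power_cong:
  assumes "stieltjes g" "\<And>x. x \<ge> 0 \<Longrightarrow> g x = g' x" "0 \<le> u"
  shows "conv_power g j u = conv_power g' j u"
  using assms(3)
proof (induction j arbitrary: u)
  case (Suc j)
  from stieltjes_cong[OF assms(2)] assms(1) have g': "stieltjes g'" by (rule iffD1)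
  show ?case unfolding conv_power_Suc[OF assms(1) Suc.prems] conv_power_Suc[OF g' Suc.prems]
    by (rule ls_conv_cong[OF Suc.IH assms(2) Suc.prems])
qed simp

text \<open>Change of the time scale and of the unit of mass. It reduces the asymptotics of \<open>conv_power b j (u * t)\<close>
  to the limit of one family of functions, and makes the convolution powers of \<open>y powr \<alpha>\<close>
  self-similar.\<close>

lemma conv_power_scale:
  assumes g: "stieltjes g" and "0 \<le> u" and c: "0 \<le> c" and t: "0 < t"
  shows "conv_power (\<lambda>s. c * g (s * t)) j u = c ^ j * conv_power g j (u * t)"
  using assms(2)
proof (induction j arbitrary: u)
  case (Suc j)
  note G = stieltjes_affine_image[OF g c t]
  have "conv_power (\<lambda>s. c * g (s * t)) (Suc j) u = ls_conv (\<lambda>s. c ^ j * conv_power g j (s * t)) (\<lambda>s. c * g (s * t)) u"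
    unfolding conv_power_Suc[OF G Suc.prems] by (rule ls_conv_cong[OF Suc.IH refl Suc.prems])
  also have "\<dots> = c ^ j * (c * ls_conv (conv_power g j) g (u * t))"
    unfolding ls_conv_cmult ls_conv_scale[OF conv_power_cadlag[OF g] g Suc.prems c t] ..
  also have "\<dots> = c ^ Suc j * conv_power g (Suc j) (u * t)"
    using conv_power_Suc[OF g, of "u * t" j] Suc.prems t by simp
  finally show ?case .
qed simp

section \<open>Power functions\<close>

lemma stieltjes_powr: "0 < q \<Longrightarrow> stieltjes (\<lambda>y. y powr q)"
  unfolding stieltjes_def
proof (intro conjI allI impI)
  assume q: "0 < q"
  show "mono_on {0..} (\<lambda>y. y powr q)" using q by (auto simp: mono_on_def intro: powr_mono2)
  have "continuous_on {0..} (\<lambda>y. y powr q)" using q by (intro continuous_intros continuous_on_powr') auto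
  from cadlag_continuous[OF this] show "((\<lambda>y. y powr q) \<longlongrightarrow> t powr q) (at_right t)" if "0 \<le> t" for t
    using that by (simp add: cadlag_on_nonneg_def)
qed

lemma power_density_integral:
  assumes q: "0 < (q::real)" and c: "0 \<le> c"
  shows "set_integrable lborel {0..c} (\<lambda>y. q * y powr (q - 1))"
    and "(LBINT y:{0..c}. q * y powr (q - 1)) = c powr q"
proof -
  have "((\<lambda>x. q * x powr (q - 1)) has_integral (q * (c powr (q - 1 + 1) / (q - 1 + 1)))) {0..c}"
    by (intro has_integral_mult_right has_integral_powr_from_0) (use assms in auto)
  then have hi: "((\<lambda>x. q * x powr (q - 1)) has_integral (c powr q)) {0..c}" using q by simp
  have ai: "(\<lambda>x. q * x powr (q - 1)) absolutely_integrable_on {0..c}"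
    by (rule nonnegative_absolutely_integrable_1) (use hi q in auto)
  have m: "(\<lambda>y. indicat_real {0..c} y *\<^sub>R (q * y powr (q - 1))) \<in> borel_measurable lborel" by measurable
  show "set_integrable lborel {0..c} (\<lambda>y. q * y powr (q - 1))"
    using ai m unfolding set_integrable_def by (simp add: integrable_completion)
  have "(LBINT y:{0..c}. q * y powr (q - 1)) = (LINT y:{0..c}|lebesgue. q * y powr (q - 1))"
    unfolding set_lebesgue_integral_def using m by (rule integral_completion[symmetric])
  also have "\<dots> = c powr q" using has_integral_unique[OF has_integral_set_lebesgue[OF ai] hi] .
  finally show "(LBINT y:{0..c}. q * y powr (q - 1)) = c powr q" .
qed

lemma power_density_conv:
  assumes f: "cadlag_on_nonneg f" and q: "0 < (q::real)" and u: "0 \<le> u"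
  shows "set_integrable lborel {0..u} (\<lambda>y. f (u - y) * (q * y powr (q - 1)))"
    and "(\<And>x. x \<in> {0..u} \<Longrightarrow> \<bar>f x\<bar> \<le> B) \<Longrightarrow> \<bar>LBINT y:{0..u}. f (u - y) * (q * y powr (q - 1))\<bar> \<le> B * u powr q"
proof -
  have meas: "set_borel_measurable lborel {0..u} (\<lambda>y. f (u - y) * (q * y powr (q - 1)))"
  proof -
    have "(\<lambda>y. indicat_real {0..u} (u - y) * f (u - y)) \<in> borel_measurable borel"
      by (rule measurable_compose[of "\<lambda>y. u - y" _ borel, OF _ cadlag_borel[OF f]]) auto
    then have "(\<lambda>y. (indicat_real {0..u} (u - y) * f (u - y)) * (q * y powr (q - 1))) \<in> borel_measurable borel"
      by (rule borel_measurable_times) measurable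
    also have "(\<lambda>y. (indicat_real {0..u} (u - y) * f (u - y)) * (q * y powr (q - 1)))
        = (\<lambda>y. indicat_real {0..u} y *\<^sub>R (f (u - y) * (q * y powr (q - 1))))"
      by (auto simp: indicator_def)
    finally show ?thesis unfolding set_borel_measurable_def by simp
  qed
  have int: "set_integrable lborel {0..u} (\<lambda>y. B * (q * y powr (q - 1)))" for B
    using power_density_integral(1)[OF q u] by simp
  have bd: "\<bar>f (u - y) * (q * y powr (q - 1))\<bar> \<le> B * (q * y powr (q - 1))"
    if "\<And>x. x \<in> {0..u} \<Longrightarrow> \<bar>f x\<bar> \<le> B" "y \<in> {0..u}" for y B
    using that(1)[of "u - y"] that(2) q by (simp add: abs_mult mult_right_mono)
  obtain B0 where B0: "\<And>x. x \<in> {0..u} \<Longrightarrow> \<bar>f x\<bar> \<le> B0" "B0 > 0" using cadlag_bounded[OF f] by metis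
  show si: "set_integrable lborel {0..u} (\<lambda>y. f (u - y) * (q * y powr (q - 1)))"
    by (rule set_integrable_bound[OF int[of B0] meas]) (use bd[OF B0(1)] in \<open>auto intro: order_trans[OF _ abs_ge_self]\<close>)
  assume B: "\<And>x. x \<in> {0..u} \<Longrightarrow> \<bar>f x\<bar> \<le> B"
  have "\<bar>LBINT y:{0..u}. f (u - y) * (q * y powr (q - 1))\<bar> \<le> (LBINT y:{0..u}. \<bar>f (u - y) * (q * y powr (q - 1))\<bar>)"
    using set_integral_norm_bound[OF si] by simp
  also have "\<dots> \<le> (LBINT y:{0..u}. B * (q * y powr (q - 1)))"
    by (intro set_integral_mono set_integrable_abs si int bd B)
  also have "\<dots> = B * u powr q" using power_density_integral(2)[OF q u] by simp
  finally show "\<bar>LBINT y:{0..u}. f (u - y) * (q * y powr (q - 1))\<bar> \<le> B * u powr q" .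
qed

text \<open>For indicators this is the fundamental theorem of calculus, \<open>(u - s) powr q\<close> being the integral of its
  derivative, which is integrable at \<open>0\<close> also for \<open>q < 1\<close>.\<close>

lemma ls_conv_powr:
  assumes f: "cadlag_on_nonneg f" and q: "0 < (q::real)" and u: "0 \<le> u"
  shows "ls_conv f (\<lambda>y. y powr q) u = (LBINT y:{0..u}. f (u - y) * (q * y powr (q - 1)))"
proof -
  let ?p = "\<lambda>y. y powr q" and ?I = "\<lambda>f. LBINT y:{0..u}. f (u - y) * (q * y powr (q - 1))"
  note p = stieltjes_powr[OF q]
  have diff: "?I (\<lambda>x. f x - c * \<phi> x) = ?I f - c * ?I \<phi>" if "cadlag_on_nonneg f" "cadlag_on_nonneg \<phi>" for f \<phi> c
  proof -
    have "?I (\<lambda>x. f x - c * \<phi> x) = (LBINT y:{0..u}. f (u - y) * (q * y powr (q - 1)) - c * (\<phi> (u - y) * (q * y powr (q - 1))))"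
      by (simp add: algebra_simps)
    then show ?thesis using power_density_conv(1)[OF _ q u] that by simp
  qed
  have steps: "ls_conv \<phi> ?p u = ?I \<phi>" if "\<phi> \<in> steps" for \<phi>
    using that p u
  proof (induction rule: steps_conv_induct)
    case (add \<phi> s c v)
    have "?I (indicat_real {s..}) = indicat_real {s..} u * (u - s) powr q"
    proof (cases "s \<le> u")
      case True
      have "?I (indicat_real {s..}) = (LBINT y:{0..u - s}. q * y powr (q - 1))"
        unfolding set_lebesgue_integral_def using add(2)
        by (intro Bochner_Integration.integral_cong) (auto simp: indicator_def)
      then show ?thesis using power_density_integral(2)[OF q, of "u - s"] True by simp
    next
      case False
      then have "?I (indicat_real {s..}) = (LBINT y:{0..u}. 0)"
        unfolding set_lebesgue_integral_def
        by (intro Bochner_Integration.integral_cong) (auto simp: indicator_def)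
      then show ?thesis using False by simp
    qed
    then show ?case
      using diff[of \<phi> "indicat_real {s..}" "-c"] steps_cadlag add steps_cadlag[OF steps_single[of s 1]] by simp
  qed simp
  have "\<bar>ls_conv f ?p u - ?I f\<bar> \<le> e" if e: "e > 0" for e
  proof -
    define d where "d = e / (2 * u powr q + 1)"
    have pos: "2 * u powr q + 1 > 0" by (simp add: add_nonneg_pos)
    have d: "d > 0" using e pos by (simp add: d_def)
    have "d * (2 * u powr q) \<le> d * (2 * u powr q + 1)" using d by (intro mult_left_mono) auto
    also have "\<dots> = e" using pos by (simp add: d_def)
    finally have de: "d * (2 * u powr q) \<le> e" .
    obtain \<phi> where \<phi>: "\<phi> \<in> steps" "\<And>x. x \<in> {0..u} \<Longrightarrow> \<bar>f x - \<phi> x\<bar> \<le> d"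
      using cadlag_step_approx[OF f d(1), of u] by blast
    have 1: "\<bar>ls_conv f ?p u - ls_conv \<phi> ?p u\<bar> \<le> d * u powr q"
      using ls_conv_close[OF f steps_cadlag[OF \<phi>(1)] p u order_refl \<phi>(2)] q by simp
    have 2: "\<bar>?I f - ?I \<phi>\<bar> \<le> d * u powr q"
      using power_density_conv(2)[OF cadlag_diff[OF f steps_cadlag[OF \<phi>(1)]] q u \<phi>(2)] diff[OF f steps_cadlag[OF \<phi>(1)], of 1]
      by simp
    show ?thesis using 1 2 de unfolding steps[OF \<phi>(1)] by linarith
  qed
  then have "\<bar>ls_conv f ?p u - ?I f\<bar> \<le> 0" by (rule field_le_epsilon) simp
  then show ?thesis by simp
qed

text \<open>For \<open>y \<le> u / 2\<close> the integrand is at least the value of the preceding power at \<open>u / 2\<close>, and the interval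
  \<open>[0, u / 2]\<close> has positive mass.\<close>

lemma conv_power_powr_pos:
  assumes "0 < \<alpha>" "0 < u"
  shows "0 < conv_power (\<lambda>y. y powr \<alpha>) j u"
  using assms(2)
proof (induction j arbitrary: u)
  case (Suc j)
  let ?p = "\<lambda>y. y powr \<alpha>"
  note p = stieltjes_powr[OF assms(1)]
  define c where "c = conv_power ?p j (u / 2)"
  have c: "c > 0" unfolding c_def using Suc by simp
  have pj: "stieltjes (conv_power ?p j)" by (intro stieltjes_conv_power p) simp
  have "0 \<le> conv_power ?p j 0" by (intro conv_power_at_0_nonneg p) simp
  then have nonneg: "0 \<le> conv_power ?p j x" if "0 \<le> x" for x
    using stieltjes_mono[OF pj order_refl that] by linarith
  have "0 < c * (u - u / 2) powr \<alpha>" using c Suc.prems by simp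
  also have "\<dots> = ls_conv (\<lambda>x. c * indicat_real {u / 2..} x) ?p u"
    using ls_conv_indicator[OF p, of u "u / 2"] Suc.prems by (simp add: ls_conv_cmult)
  also have "\<dots> \<le> ls_conv (conv_power ?p j) ?p u"
  proof (rule ls_conv_mono)
    show "c * indicat_real {u / 2..} x \<le> conv_power ?p j x" if "x \<in> {0..u}" for x
      using nonneg[of x] stieltjes_mono[OF pj, of "u / 2" x] that Suc.prems
      by (auto simp: c_def indicator_def)
  qed (use Suc.prems in \<open>simp_all add: steps_cadlag steps_single stieltjes_cadlag pj p\<close>)
  finally show ?case using Suc.prems by (simp add: conv_power_Suc[OF p] del: conv_power.simps(2,3))
qed simp

text \<open>The function \<open>y powr \<alpha>\<close> is self-similar, hence so are its convolution powers.\<close>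

lemma conv_power_powr:
  assumes "0 < \<alpha>" "0 \<le> u"
  shows "conv_power (\<lambda>y. y powr \<alpha>) (Suc j) u = conv_power (\<lambda>y. y powr \<alpha>) (Suc j) 1 * u powr (\<alpha> * Suc j)"
proof (cases "u = 0")
  case True
  then show ?thesis using conv_power_at_0[OF stieltjes_powr[OF assms(1)], of "Suc j"] by simp
next
  case False
  let ?p = "\<lambda>y. y powr \<alpha>"
  note p = stieltjes_powr[OF assms(1)]
  have u: "u > 0" using False assms by simp
  have "conv_power ?p (Suc j) u = conv_power (\<lambda>s. 1 * ?p (s * u)) (Suc j) 1"
    using conv_power_scale[OF p, of 1 1 u "Suc j"] u by (simp del: conv_power.simps(2,3))
  also have "\<dots> = conv_power (\<lambda>s. u powr \<alpha> * ?p (s * 1)) (Suc j) 1"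
    using u by (intro conv_power_cong stieltjes_affine_image p) (auto simp: powr_mult)
  also have "\<dots> = (u powr \<alpha>) ^ Suc j * conv_power ?p (Suc j) 1"
    using conv_power_scale[OF p, of 1 "u powr \<alpha>" 1 "Suc j"] by (simp del: conv_power.simps(2,3))
  also have "(u powr \<alpha>) ^ Suc j = u powr (\<alpha> * Suc j)"
    using u by (simp add: powr_realpow[symmetric] powr_powr del: power_Suc)
  finally show ?thesis by simp
qed

section \<open>Locally uniform convergence of convolutions\<close>

definition loc_uniform :: "(nat \<Rightarrow> real \<Rightarrow> real) \<Rightarrow> (real \<Rightarrow> real) \<Rightarrow> bool" where
  "loc_uniform F f \<longleftrightarrow> (\<forall>T. uniform_limit {0..T} F f sequentially)"

lemma loc_uniform_cong:
  assumes "\<And>n u. u \<ge> 0 \<Longrightarrow> F n u = F' n u" "\<And>u. u \<ge> 0 \<Longrightarrow> f u = f' u"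
  shows "loc_uniform F f \<longleftrightarrow> loc_uniform F' f'"
proof -
  have "uniform_limit {0..T} F f sequentially \<longleftrightarrow> uniform_limit {0..T} F' f' sequentially" for T
    by (rule uniform_limit_cong') (use assms in auto)
  then show ?thesis by (simp add: loc_uniform_def)
qed

lemma loc_uniform_add: "loc_uniform F f \<Longrightarrow> loc_uniform G g \<Longrightarrow> loc_uniform (\<lambda>n u. F n u + G n u) (\<lambda>u. f u + g u)"
  unfolding loc_uniform_def by (auto intro: uniform_limit_add)

lemma loc_uniform_pointwise: "loc_uniform F f \<Longrightarrow> 0 \<le> u \<Longrightarrow> (\<lambda>n. F n u) \<longlonglongrightarrow> f u"
  unfolding loc_uniform_def by (rule tendsto_uniform_limitI, erule spec[of _ u]) simp

lemma loc_uniform_mult_seq: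
  assumes F: "loc_uniform F f" and c: "c \<longlonglongrightarrow> l" and f: "cadlag_on_nonneg f"
  shows "loc_uniform (\<lambda>n u. c n * F n u) (\<lambda>u. l * f u)"
  unfolding loc_uniform_def
proof
  fix T
  obtain B where "\<And>x. x \<in> {0..T} \<Longrightarrow> \<bar>f x\<bar> \<le> B" using cadlag_bounded[OF f] by metis
  then have "bounded (f ` {0..T})" by (intro boundedI[of _ B]) auto
  moreover have "uniform_limit {0..T} (\<lambda>n u. c n) (\<lambda>u. l) sequentially"
  proof (rule uniform_limitI)
    fix e :: real assume "e > 0"
    from tendstoD[OF c this] show "\<forall>\<^sub>F n in sequentially. \<forall>u\<in>{0..T}. dist (c n) l < e"
      by eventually_elim blast
  qed
  moreover have "bounded ((\<lambda>u. l) ` {0..T})" by (rule finite_imp_bounded) (auto simp: image_def)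
  ultimately show "uniform_limit {0..T} (\<lambda>n u. c n * F n u) (\<lambda>u. l * f u) sequentially"
    using F unfolding loc_uniform_def by (intro uniform_lim_mult) blast+
qed

text \<open>Convolving with a step function only translates \<open>g\<close>, which preserves locally uniform limits.\<close>

lemma ls_conv_steps_loc_uniform:
  assumes g: "\<And>n. stieltjes (g n)" "stieltjes g'" and lim: "loc_uniform g g'" and "\<phi> \<in> steps"
  shows "loc_uniform (\<lambda>n. ls_conv \<phi> (g n)) (ls_conv \<phi> g')"
  using assms(4)
proof (induction rule: steps.induct)
  case zero show ?case by (simp add: loc_uniform_def ls_conv_def LS_integral_def uniform_limit_iff)
next
  case (add \<phi> s c)
  have "loc_uniform (\<lambda>n u. c * (indicat_real {s..} u * g n (u - s))) (\<lambda>u. c * (indicat_real {s..} u * g' (u - s)))"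
    unfolding loc_uniform_def
  proof (intro allI uniform_limitI)
    fix T e :: real assume e: "e > 0"
    have "\<forall>\<^sub>F n in sequentially. \<forall>x\<in>{0..T}. dist (g n x) (g' x) < e / (\<bar>c\<bar> + 1)"
      using lim e by (intro uniform_limitD) (auto simp: loc_uniform_def intro!: divide_pos_pos)
    then show "\<forall>\<^sub>F n in sequentially. \<forall>u\<in>{0..T}. dist (c * (indicat_real {s..} u * g n (u - s))) (c * (indicat_real {s..} u * g' (u - s))) < e"
      (is "\<forall>\<^sub>F n in _. \<forall>u\<in>_. ?close n u")
    proof eventually_elim
      case (elim n)
      show ?case
      proof
        fix u assume u: "u \<in> {0..T}"
        show "?close n u"
        proof (cases "s \<le> u")
          case True
          then have "\<bar>g n (u - s) - g' (u - s)\<bar> < e / (\<bar>c\<bar> + 1)" using elim u add(2) by (auto simp: dist_real_def)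
          then have "(\<bar>c\<bar> + 1) * \<bar>g n (u - s) - g' (u - s)\<bar> < e" by (simp add: field_simps)
          moreover have "\<bar>c\<bar> * \<bar>g n (u - s) - g' (u - s)\<bar> \<le> (\<bar>c\<bar> + 1) * \<bar>g n (u - s) - g' (u - s)\<bar>"
            by (intro mult_right_mono) auto
          ultimately show ?thesis using True by (simp add: dist_real_def right_diff_distrib[symmetric] abs_mult)
        qed (use e in simp)
      qed
    qed
  qed
  from loc_uniform_add[OF add.IH this] show ?case
    by (subst loc_uniform_cong[OF ls_conv_add_indicator[OF add(1,2) g(1)] ls_conv_add_indicator[OF add(1,2) g(2)]])
qed

text \<open>Replace \<open>f'\<close> by a step function. The error is controlled for all \<open>n\<close> at once because the variations of
  the \<open>g n\<close> on \<open>[0, T]\<close> are bounded.\<close>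

lemma ls_conv_loc_uniform:
  assumes f: "\<And>n. cadlag_on_nonneg (f n)" "cadlag_on_nonneg f'"
    and g: "\<And>n. stieltjes (g n)" "stieltjes g'" and lim: "loc_uniform f f'" "loc_uniform g g'"
  shows "loc_uniform (\<lambda>n. ls_conv (f n) (g n)) (ls_conv f' g')"
  unfolding loc_uniform_def
proof (intro allI uniform_limitI)
  fix T e :: real assume e: "e > 0"
  show "\<forall>\<^sub>F n in sequentially. \<forall>u\<in>{0..T}. dist (ls_conv (f n) (g n) u) (ls_conv f' g' u) < e"
  proof (cases "T \<ge> 0")
    case True
    \<comment> \<open>as soon as \<open>g n\<close> is within \<open>1\<close> of \<open>g'\<close> on \<open>[0, T]\<close>, its variation there is at most \<open>K\<close>\<close>
    define K where "K = \<bar>g' 0\<bar> + (g' T - g' 0) + 3"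
    have K: "K > 0" using stieltjes_mono[OF g(2) order_refl True] by (simp add: K_def)
    define d where "d = e / (5 * K)"
    have d: "d > 0" "d * K = e / 5" using e K by (auto simp: d_def)
    obtain \<phi> where \<phi>: "\<phi> \<in> steps" "\<And>x. x \<in> {0..T} \<Longrightarrow> \<bar>f' x - \<phi> x\<bar> \<le> d"
      using cadlag_step_approx[OF f(2) d(1), of T] by blast
    note c\<phi> = steps_cadlag[OF \<phi>(1)]
    have "d * (\<bar>g' 0\<bar> + (g' T - g' 0)) \<le> d * K"
      using d(1) by (intro mult_left_mono) (auto simp: K_def)
    then have dK: "d * (\<bar>g' 0\<bar> + (g' T - g' 0)) \<le> e / 5" unfolding d(2) .
    have 1: "\<bar>ls_conv f' g' u - ls_conv \<phi> g' u\<bar> \<le> e / 5" if "u \<in> {0..T}" for u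
    proof (rule order_trans[OF ls_conv_close[OF f(2) c\<phi> g(2)] dK])
      show "\<bar>f' x - \<phi> x\<bar> \<le> d" if "x \<in> {0..u}" for x
        by (rule \<phi>(2)) (use that \<open>u \<in> {0..T}\<close> in auto)
    qed (use that in auto)
    have "\<forall>\<^sub>F n in sequentially. \<forall>x\<in>{0..T}. dist (f n x) (f' x) < d"
      using lim(1) d(1) by (intro uniform_limitD) (auto simp: loc_uniform_def)
    moreover have "\<forall>\<^sub>F n in sequentially. \<forall>x\<in>{0..T}. dist (g n x) (g' x) < 1"
      using lim(2) by (intro uniform_limitD) (auto simp: loc_uniform_def)
    moreover have "\<forall>\<^sub>F n in sequentially. \<forall>u\<in>{0..T}. dist (ls_conv \<phi> (g n) u) (ls_conv \<phi> g' u) < e / 5"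
      using ls_conv_steps_loc_uniform[OF g lim(2) \<phi>(1)] e by (intro uniform_limitD) (auto simp: loc_uniform_def)
    ultimately show ?thesis
    proof eventually_elim
      case (elim n)
      have "\<bar>g n 0 - g' 0\<bar> < 1" "\<bar>g n T - g' T\<bar> < 1" using elim(2) True by (auto simp: dist_real_def)
      then have "2 * d * (\<bar>g n 0\<bar> + (g n T - g n 0)) \<le> 2 * d * K"
        using d(1) by (intro mult_left_mono) (auto simp: K_def)
      then have gn: "2 * d * (\<bar>g n 0\<bar> + (g n T - g n 0)) \<le> 2 * (e / 5)" using d(2) by simp
      show ?case
      proof
        fix u assume u: "u \<in> {0..T}"
        have 2: "\<bar>ls_conv (f n) (g n) u - ls_conv \<phi> (g n) u\<bar> \<le> 2 * (e / 5)"
        proof (rule order_trans[OF ls_conv_close[OF f(1) c\<phi> g(1)] gn])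
          fix x assume x: "x \<in> {0..u}"
          then have "x \<in> {0..T}" using u by auto
          then show "\<bar>f n x - \<phi> x\<bar> \<le> 2 * d"
            using bspec[OF elim(1), of x] \<phi>(2)[of x] unfolding dist_real_def by linarith
        qed (use u in auto)
        show "dist (ls_conv (f n) (g n) u) (ls_conv f' g' u) < e"
          using 1[OF u] 2 elim(3)[rule_format, OF u] e unfolding dist_real_def by linarith
      qed
    qed
  qed simp
qed

lemma conv_power_loc_uniform:
  assumes g: "\<And>n. stieltjes (g n)" "stieltjes g'" and lim: "loc_uniform g g'"
  shows "loc_uniform (\<lambda>n. conv_power (g n) j) (conv_power g' j)"
proof (induction j)
  case 0 show ?case by (simp add: loc_uniform_def uniform_limit_iff)
next
  case (Suc j)
  have "loc_uniform (\<lambda>n. ls_conv (conv_power (g n) j) (g n)) (ls_conv (conv_power g' j) g')"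
    by (intro ls_conv_loc_uniform conv_power_cadlag g Suc lim)
  then show ?case by (subst loc_uniform_cong[OF conv_power_Suc[OF g(1)] conv_power_Suc[OF g(2)]])
qed

text \<open>The derivative of the \<open>(j + 1)\<close>-st convolution power at \<open>p\<close> in the direction \<open>w\<close>. The product rule is
  applied in the form \<open>\<xi>^(k+1) - \<beta>^(k+1) = (\<xi>^k - \<beta>^k) * d\<xi> + (\<xi> - \<beta>) * d(\<beta>^k)\<close> with \<open>k = j + 1\<close>, in which
  every integrator is nondecreasing; the differences, which are not monotone, appear only as
  integrands.\<close>

lemma conv_power_difference_loc_uniform:
  assumes x: "\<And>n. stieltjes (\<xi> n)" and y: "\<And>n. stieltjes (\<beta> n)" "\<And>n. 0 \<le> \<beta> n 0"
    and p: "stieltjes p" "0 \<le> p 0" and w: "cadlag_on_nonneg w"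
    and lim: "loc_uniform \<xi> p" "loc_uniform \<beta> p" "loc_uniform (\<lambda>n u. r n * (\<xi> n u - \<beta> n u)) w"
  shows "loc_uniform (\<lambda>n u. r n * (conv_power (\<xi> n) (Suc j) u - conv_power (\<beta> n) (Suc j) u))
           (\<lambda>u. real (Suc j) * ls_conv w (conv_power p j) u)"
proof (induction j)
  case 0
  have "real (Suc 0) * ls_conv w (conv_power p 0) u = w u" if "0 \<le> u" for u
    using ls_conv_one_right[OF w that] by simp
  then show ?case using lim(3) by (subst loc_uniform_cong[where f' = w]) simp_all
next
  case (Suc j)
  let ?x = "\<lambda>n. conv_power (\<xi> n) (Suc j)" and ?b = "\<lambda>n. conv_power (\<beta> n) (Suc j)"
  let ?D = "\<lambda>n u. r n * (?x n u - ?b n u)" and ?y = "\<lambda>n u. r n * (\<xi> n u - \<beta> n u)"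
  let ?L = "\<lambda>u. real (Suc j) * ls_conv w (conv_power p j) u"
  note cx = conv_power_cadlag[OF x, of _ "Suc j"] and cb = conv_power_cadlag[OF y(1), of _ "Suc j"]
  note sb = stieltjes_conv_power[OF y, of _ "Suc j"] and sp = stieltjes_conv_power[OF p]
  have pre: "r n * (conv_power (\<xi> n) (Suc (Suc j)) u - conv_power (\<beta> n) (Suc (Suc j)) u)
      = ls_conv (?D n) (\<xi> n) u + ls_conv (?y n) (?b n) u" if u: "0 \<le> u" for n u
  proof -
    have "ls_conv (?D n) (\<xi> n) u = r n * (ls_conv (?x n) (\<xi> n) u - ls_conv (?b n) (\<xi> n) u)"
      by (simp only: ls_conv_cmult ls_conv_diff[OF cx cb x u])
    moreover have "ls_conv (?y n) (?b n) u = r n * (ls_conv (\<xi> n) (?b n) u - ls_conv (\<beta> n) (?b n) u)"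
      by (simp only: ls_conv_cmult ls_conv_diff[OF stieltjes_cadlag[OF x] stieltjes_cadlag[OF y(1)] sb u])
    ultimately show ?thesis
      unfolding conv_power_Suc[OF x u, of _ "Suc j"] conv_power_Suc[OF y(1) u, of _ "Suc j"]
        ls_conv_commute[OF x sb u] ls_conv_commute[OF y(1) sb u]
      by (simp add: algebra_simps)
  qed
  have post: "real (Suc (Suc j)) * ls_conv w (conv_power p (Suc j)) u
      = ls_conv ?L p u + ls_conv w (conv_power p (Suc j)) u" if u: "0 \<le> u" for u
  proof -
    have "ls_conv ?L p u = real (Suc j) * ls_conv w (ls_conv (conv_power p j) p) u"
      unfolding ls_conv_cmult using conv_power_at_0[OF p(1), of j] p(2)
      by (subst ls_conv_assoc[OF w sp _ p u]) auto
    also have "ls_conv w (ls_conv (conv_power p j) p) u = ls_conv w (conv_power p (Suc j)) u"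
      by (rule ls_conv_cong[OF refl _ u]) (simp add: conv_power_Suc[OF p(1)] del: conv_power.simps(2,3))
    finally show ?thesis by (simp add: algebra_simps)
  qed
  have "loc_uniform (\<lambda>n u. ls_conv (?D n) (\<xi> n) u + ls_conv (?y n) (?b n) u)
     (\<lambda>u. ls_conv ?L p u + ls_conv w (conv_power p (Suc j)) u)"
    by (intro loc_uniform_add ls_conv_loc_uniform Suc lim x p sb sp w cadlag_cmult cadlag_diff cx cb
        ls_conv_cadlag stieltjes_cadlag[OF x] stieltjes_cadlag[OF y(1)] conv_power_loc_uniform y)
  then show ?case by (subst loc_uniform_cong[OF pre post])
qed

text \<open>Polya's observation: for monotone functions with a continuous limit, convergence on a fine enough finite
  grid controls everything in between.\<close>

lemma monotone_loc_uniform: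
  assumes mono: "\<And>n. mono_on {0..} (g n)" and p: "continuous_on {0..} p" "mono_on {0..} p"
    and lim: "\<And>s. 0 \<le> s \<Longrightarrow> (\<lambda>n. g n s) \<longlonglongrightarrow> p s"
  shows "loc_uniform g p"
  unfolding loc_uniform_def
proof (intro allI uniform_limitI)
  fix T e :: real assume e: "e > 0"
  show "\<forall>\<^sub>F n in sequentially. \<forall>u\<in>{0..T}. dist (g n u) (p u) < e"
  proof (cases "T > 0")
    case True
    have "uniformly_continuous_on {0..T} p"
      by (intro compact_uniformly_continuous continuous_on_subset[OF p(1)]) auto
    then obtain d where d: "d > 0" "\<And>x y. x \<in> {0..T} \<Longrightarrow> y \<in> {0..T} \<Longrightarrow> dist y x < d \<Longrightarrow> dist (p y) (p x) < e / 2"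
      unfolding uniformly_continuous_on_def using e by (metis half_gt_zero)
    obtain N :: nat where N: "T / d < real N" using reals_Archimedean2 by blast
    then have N0: "N > 0" using True d(1) by (cases N) (auto simp: field_simps)
    define x where "x k = T * real k / real N" for k
    have x: "x k \<in> {0..T}" if "k \<le> N" for k
    proof -
      have "T * real k \<le> T * real N" using that True by (intro mult_left_mono) auto
      then show ?thesis using N0 True by (simp add: x_def field_simps)
    qed
    have "\<forall>\<^sub>F n in sequentially. \<forall>k\<in>{..N}. dist (g n (x k)) (p (x k)) < e / 2"
    proof (intro eventually_ball_finite ballI)
      show "\<forall>\<^sub>F n in sequentially. dist (g n (x k)) (p (x k)) < e / 2" if "k \<in> {..N}" for k
        by (rule tendstoD[OF lim]) (use x[of k] that e in auto)
    qed simp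
    then show ?thesis
    proof eventually_elim
      case (elim n)
      show ?case
      proof
        fix u assume u: "u \<in> {0..T}"
        obtain k where k: "Suc k \<le> N" "x k \<le> u" "u \<le> x (Suc k)"
        proof (cases "u = T")
          case True
          show ?thesis
            by (rule that[of "N - 1"]) (use N0 x[of "N - 1"] True in \<open>auto simp: x_def\<close>)
        next
          case False
          define k where "k = nat \<lfloor>u * N / T\<rfloor>"
          have "0 \<le> u * N / T" "u * N / T < N" using u False True N0 by (auto simp: field_simps)
          then have "real k \<le> u * N / T" "u * N / T < real (Suc k)" "k < N"
            unfolding k_def by (auto simp: le_nat_floor nat_less_iff floor_less_iff) linarith+
          then show ?thesis using True N0 by (intro that[of k]) (auto simp: x_def field_simps)
        qed
        have "x (Suc k) - x k = T / real N" by (simp add: x_def field_simps add_divide_distrib)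
        also have "\<dots> < d" using N d(1) N0 by (simp add: field_simps)
        finally have "dist (p (x (Suc k))) (p (x k)) < e / 2"
          using k x[of k] x[of "Suc k"] by (intro d(2)) (auto simp: dist_real_def)
        moreover have "p (x k) \<le> p u" "p u \<le> p (x (Suc k))" "g n (x k) \<le> g n u" "g n u \<le> g n (x (Suc k))"
          using k x[of k] x[of "Suc k"] u by (auto intro!: mono_onD[OF p(2)] mono_onD[OF mono])
        moreover have "dist (g n (x k)) (p (x k)) < e / 2" "dist (g n (x (Suc k))) (p (x (Suc k))) < e / 2"
          using elim k(1) by auto
        ultimately show "dist (g n u) (p u) < e" unfolding dist_real_def by linarith
      qed
    qed
  next
    case False
    have "\<forall>\<^sub>F n in sequentially. dist (g n 0) (p 0) < e" using lim[of 0] e by (auto intro: tendstoD)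
    then show ?thesis
    proof eventually_elim
      case (elim n)
      have "u = 0" if "u \<in> {0..T}" for u using that False by auto
      with elim show ?case by blast
    qed
  qed
qed

text \<open>The deterministic core. In the units \<open>t n\<close> of time and \<open>b (t n)\<close> of mass, \<open>\<xi>\<close> and \<open>\<beta>\<close> are the
  rescaled \<open>x\<close> and \<open>b\<close>, and \<open>r\<close> is the factor that magnifies their difference to the scale of \<open>w\<close>. The
  normalization \<open>conv_power b (j - 1) (t n)\<close> is \<open>conv_power (\<beta> n) (j - 1) 1\<close> in these units, and it
  converges to \<open>c\<close>.\<close>

theorem scaled_conv_power_loc_uniform:
  fixes t :: "nat \<Rightarrow> real" and x :: "nat \<Rightarrow> real \<Rightarrow> real"
  assumes t: "filterlim t at_top sequentially" "\<And>n. t n > 0"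
    and b: "stieltjes b" and a_pos: "\<And>t. t > 0 \<Longrightarrow> a t > 0" and a_lim: "filterlim a at_top at_top"
    and b_rv: "regularly_varying b \<alpha>" and \<alpha>: "\<alpha> > 0"
    and b_over_a: "filterlim (\<lambda>t. b t / a t) at_top at_top"
    and x: "\<And>n. stieltjes (x n)" and w: "cadlag_on_nonneg w"
    and lim: "loc_uniform (\<lambda>n u. (x n (u * t n) - b (u * t n)) / a (t n)) w" and j: "j \<ge> 1"
  shows "loc_uniform (\<lambda>n u. (conv_power (x n) j (u * t n) - conv_power b j (u * t n)) / (a (t n) * conv_power b (j - 1) (t n)))
           (limit_path \<alpha> w j)"
proof -
  obtain i where i: "j = Suc i" using j by (cases j) auto
  define p where "p = (\<lambda>y::real. y powr \<alpha>)"
  define \<xi> where "\<xi> n s = inverse (b (t n)) * x n (s * t n)" for n s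
  define \<beta> where "\<beta> n s = inverse (b (t n)) * b (s * t n)" for n s
  define r where "r n = b (t n) / a (t n)" for n
  have bpos: "b s > 0" if "s > 0" for s using b_rv that by (simp add: regularly_varying_def)
  have b0: "b 0 \<ge> 0"
  proof (rule tendsto_lowerbound)
    show "(b \<longlongrightarrow> b 0) (at_right 0)" using b by (simp add: stieltjes_def)
    show "\<forall>\<^sub>F s in at_right 0. 0 \<le> b s"
      using eventually_at_right_less[of "0::real"] by eventually_elim (use bpos in \<open>auto intro: less_imp_le\<close>)
  qed simp
  have bt: "b (t n) > 0" and at: "a (t n) > 0" for n using bpos t(2) a_pos by auto
  have b_lim: "filterlim b at_top at_top"
  proof (rule filterlim_cong[THEN iffD1, OF refl refl _ filterlim_at_top_mult_at_top[OF b_over_a a_lim]])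
    show "\<forall>\<^sub>F s in at_top. b s / a s * a s = b s"
      using eventually_gt_at_top[of 0] by eventually_elim (use a_pos in force)
  qed
  have p: "stieltjes p" "0 \<le> p 0" unfolding p_def using stieltjes_powr[OF \<alpha>] by auto
  have s\<xi>: "stieltjes (\<xi> n)" and s\<beta>: "stieltjes (\<beta> n)" for n
    unfolding \<xi>_def[abs_def] \<beta>_def[abs_def] using bt[of n] t(2)[of n] by (auto intro!: stieltjes_affine_image x b)
  have \<beta>0: "0 \<le> \<beta> n 0" for n using bt[of n] b0 by (simp add: \<beta>_def)
  have "loc_uniform \<beta> p"
  proof (rule monotone_loc_uniform)
    show "mono_on {0..} (\<beta> n)" for n using s\<beta>[of n] by (simp add: stieltjes_def)
    show "mono_on {0..} p" using p by (simp add: stieltjes_def)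
    show "continuous_on {0..} p" unfolding p_def using \<alpha> by (intro continuous_intros continuous_on_powr') auto
    fix s :: real assume s: "0 \<le> s"
    show "(\<lambda>n. \<beta> n s) \<longlonglongrightarrow> p s"
    proof (cases "s = 0")
      case True
      have "(\<lambda>n. inverse (b (t n))) \<longlonglongrightarrow> 0"
        by (rule filterlim_compose[OF tendsto_inverse_0_at_top[OF b_lim] t(1)])
      then have "(\<lambda>n. inverse (b (t n)) * b 0) \<longlonglongrightarrow> 0 * b 0" by (intro tendsto_intros)
      then show ?thesis using True \<alpha> by (simp add: \<beta>_def p_def)
    next
      case False
      then have "((\<lambda>t. b (s * t) / b t) \<longlongrightarrow> s powr \<alpha>) at_top" using b_rv s by (simp add: regularly_varying_def)
      from filterlim_compose[OF this t(1)] show ?thesis by (simp add: \<beta>_def p_def divide_inverse mult.commute)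
    qed
  qed
  have y: "loc_uniform (\<lambda>n u. r n * (\<xi> n u - \<beta> n u)) w"
  proof -
    have "r n * (\<xi> n u - \<beta> n u) = (x n (u * t n) - b (u * t n)) / a (t n)" for n u
      using bt[of n] at[of n] by (simp add: r_def \<xi>_def \<beta>_def field_simps)
    then show ?thesis using lim by simp
  qed
  have r0: "(\<lambda>n. inverse (r n)) \<longlonglongrightarrow> 0"
    unfolding r_def by (rule filterlim_compose[OF tendsto_inverse_0_at_top[OF b_over_a] t(1)])
  have "loc_uniform \<xi> p"
  proof -
    have "loc_uniform (\<lambda>n u. \<beta> n u + inverse (r n) * (r n * (\<xi> n u - \<beta> n u))) (\<lambda>u. p u + 0 * w u)"
      by (intro loc_uniform_add loc_uniform_mult_seq \<open>loc_uniform \<beta> p\<close> y w r0)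
    moreover have "\<beta> n u + inverse (r n) * (r n * (\<xi> n u - \<beta> n u)) = \<xi> n u" for n u
      using bt[of n] at[of n] by (simp add: r_def)
    ultimately show ?thesis by simp
  qed
  have D: "loc_uniform (\<lambda>n u. r n * (conv_power (\<xi> n) (Suc i) u - conv_power (\<beta> n) (Suc i) u))
           (\<lambda>u. real (Suc i) * ls_conv w (conv_power p i) u)"
    by (rule conv_power_difference_loc_uniform) fact+
  define c where "c = conv_power p i 1"
  have c: "c > 0" unfolding c_def p_def by (rule conv_power_powr_pos[OF \<alpha>]) simp
  have "(\<lambda>n. conv_power (\<beta> n) i 1) \<longlonglongrightarrow> c"
    unfolding c_def by (rule loc_uniform_pointwise[OF conv_power_loc_uniform[OF s\<beta> p(1) \<open>loc_uniform \<beta> p\<close>]]) simp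
  then have "(\<lambda>n. inverse (conv_power (\<beta> n) i 1)) \<longlonglongrightarrow> inverse c" using c by (intro tendsto_inverse) auto
  then have main: "loc_uniform (\<lambda>n u. inverse (conv_power (\<beta> n) i 1) * (r n * (conv_power (\<xi> n) (Suc i) u - conv_power (\<beta> n) (Suc i) u)))
           (\<lambda>u. inverse c * (real (Suc i) * ls_conv w (conv_power p i) u))"
    by (intro loc_uniform_mult_seq D cadlag_cmult ls_conv_cadlag w stieltjes_conv_power p)
  show ?thesis
  proof (rule loc_uniform_cong[THEN iffD1, OF _ _ main])
    fix n and u :: real assume u: "0 \<le> u"
    define B where "B = b (t n)"
    have B: "B > 0" using bt by (simp add: B_def)
    have 1: "conv_power (\<xi> n) (Suc i) u = inverse B ^ Suc i * conv_power (x n) (Suc i) (u * t n)"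
      unfolding \<xi>_def[abs_def] B_def using B by (intro conv_power_scale x u t(2)) (simp add: B_def)
    have 2: "conv_power (\<beta> n) k v = inverse B ^ k * conv_power b k (v * t n)" if "0 \<le> v" for k v
      unfolding \<beta>_def[abs_def] B_def using B by (intro conv_power_scale b that t(2)) (simp add: B_def)
    have "inverse (inverse B ^ i * z) * (B / A * (inverse B ^ Suc i * X - inverse B ^ Suc i * Y)) = (X - Y) / (A * z)"
      for A X Y z
    proof -
      define P where "P = B ^ i"
      have P: "P \<noteq> 0" using B by (simp add: P_def)
      have "inverse (inverse P * z) * (B / A * (inverse (B * P) * X - inverse (B * P) * Y)) = (B * P * (X - Y)) / (B * P * (A * z))"
        using P B by (cases "A = 0 \<or> z = 0") (auto simp: field_simps)
      also have "\<dots> = (X - Y) / (A * z)" using P B by simp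
      finally show ?thesis by (simp add: P_def power_inverse)
    qed
    then show "inverse (conv_power (\<beta> n) i 1) * (r n * (conv_power (\<xi> n) (Suc i) u - conv_power (\<beta> n) (Suc i) u))
       = (conv_power (x n) j (u * t n) - conv_power b j (u * t n)) / (a (t n) * conv_power b (j - 1) (t n))"
      unfolding 1 2[OF u] 2[OF zero_le_one] r_def B_def[symmetric] i by simp
  next
    fix u :: real assume u: "0 \<le> u"
    show "inverse c * (real (Suc i) * ls_conv w (conv_power p i) u) = limit_path \<alpha> w j u"
    proof (cases i)
      case 0
      then show ?thesis using ls_conv_one_right[OF w u] by (simp add: c_def limit_path_def i)
    next
      case (Suc k)
      define q where "q = \<alpha> * real i"
      have q: "q > 0" using \<alpha> Suc by (simp add: q_def)
      have cp: "conv_power p i y = c * (y * 1) powr q" if "0 \<le> y" for y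
        using conv_power_powr[OF \<alpha> that, of k] by (simp only: c_def p_def q_def Suc mult_1_right)
      have "ls_conv w (conv_power p i) u = ls_conv w (\<lambda>y. c * (y * 1) powr q) u"
        by (rule ls_conv_cong[OF refl cp u])
      also have "\<dots> = c * ls_conv w (\<lambda>y. y powr q) (u * 1)"
        using ls_conv_scale[OF w stieltjes_powr[OF q] u less_imp_le[OF c] zero_less_one] by simp
      also have "ls_conv w (\<lambda>y. y powr q) (u * 1) = (LBINT y:{0..u}. w (u - y) * (q * y powr (q - 1)))"
        using ls_conv_powr[OF w q u] by simp
      finally have "ls_conv w (conv_power p i) u = c * (LBINT y:{0..u}. w (u - y) * (q * y powr (q - 1)))" .
      moreover have "\<alpha> * (real j - 1) = q" "j \<noteq> 1" using Suc by (simp_all add: i q_def)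
      ultimately show ?thesis using c by (simp add: limit_path_def i)
    qed
  qed
qed

section \<open>Metrizability of the J1-topology\<close>

lemma time_change_inverse:
  assumes "l \<in> time_changes"
  obtains m where "m \<in> time_changes" "\<And>s. 0 \<le> s \<Longrightarrow> m (l s) = s" "\<And>s. 0 \<le> s \<Longrightarrow> l (m s) = s"
    "\<And>s. 0 \<le> s \<Longrightarrow> 0 \<le> m s"
proof -
  have l: "strict_mono_on {0..} l" "l ` {0..} = {0..}" using assms by (auto simp: time_changes_def)
  then have inj: "inj_on l {0..}" by (simp add: strict_mono_on_imp_inj_on)
  define m where "m = inv_into {0..} l"
  have bij: "bij_betw l {0..} {0..}" using inj l(2) by (simp add: bij_betw_def)
  have ml: "m (l s) = s" if "0 \<le> s" for s unfolding m_def using inv_into_f_f[OF inj] that by simp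
  have lm: "l (m s) = s" if "0 \<le> s" for s unfolding m_def using l(2) that by (intro f_inv_into_f) simp
  have m: "m ` {0..} = {0..}" using bij_betw_inv_into[OF bij] by (simp add: m_def bij_betw_def)
  then have m0: "0 \<le> m s" if "0 \<le> s" for s using that by (metis atLeast_iff image_eqI)
  have "strict_mono_on {0..} m"
  proof (rule strict_mono_onI)
    fix x y :: real assume xy: "x \<in> {0..}" "y \<in> {0..}" "x < y"
    show "m x < m y"
    proof (rule ccontr)
      assume "\<not> m x < m y"
      then have "l (m y) \<le> l (m x)"
        using strict_mono_on_leD[OF l(1), of "m y" "m x"] m0 xy by simp
      then show False using lm xy by simp
    qed
  qed
  then show thesis using that[of m] m ml lm m0 by (simp add: time_changes_def)
qed

lemma J1_nbhdI:
  assumes "g \<in> skorokhod_space" "l \<in> time_changes" "d < e"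
    "\<And>s. 0 \<le> s \<Longrightarrow> \<bar>l s - s\<bar> \<le> d" "\<And>s. 0 \<le> s \<Longrightarrow> s \<le> T \<Longrightarrow> \<bar>g (l s) - f s\<bar> \<le> d"
  shows "g \<in> J1_nbhd f T e"
  unfolding J1_nbhd_def mem_Collect_eq
proof (intro conjI bexI[OF _ assms(2)] exI[of _ d] assms(1) allI ballI impI)
  show "\<bar>g (l s) - f s\<bar> \<le> d" if "s \<in> {0..T}" for s using assms(5) that by simp
qed (fact assms)+

lemma J1_nbhdE:
  assumes "g \<in> J1_nbhd f T e"
  obtains l d where "g \<in> skorokhod_space" "l \<in> time_changes" "d < e"
    "\<And>s. 0 \<le> s \<Longrightarrow> \<bar>l s - s\<bar> \<le> d" "\<And>s. 0 \<le> s \<Longrightarrow> s \<le> T \<Longrightarrow> \<bar>g (l s) - f s\<bar> \<le> d"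
  using assms unfolding J1_nbhd_def by auto

text \<open>The inverse time change works; it may leave \<open>[0, T]\<close>, whence the shorter interval.\<close>

lemma J1_nbhd_sym:
  assumes "g \<in> J1_nbhd f T e" "f \<in> skorokhod_space"
  shows "f \<in> J1_nbhd g (T - e) e"
  using assms(1)
proof (rule J1_nbhdE)
  fix l d assume l: "l \<in> time_changes" "d < e"
    "\<And>s. 0 \<le> s \<Longrightarrow> \<bar>l s - s\<bar> \<le> d" "\<And>s. 0 \<le> s \<Longrightarrow> s \<le> T \<Longrightarrow> \<bar>g (l s) - f s\<bar> \<le> d"
  obtain m where m: "m \<in> time_changes" "\<And>s. 0 \<le> s \<Longrightarrow> l (m s) = s" "\<And>s. 0 \<le> s \<Longrightarrow> 0 \<le> m s"
    using time_change_inverse[OF l(1)] by metis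
  have close: "\<bar>m s - s\<bar> \<le> d" if "0 \<le> s" for s
    using l(3)[OF m(3)[OF that]] m(2)[OF that] by simp
  show ?thesis
  proof (rule J1_nbhdI[OF assms(2) m(1) l(2) close])
    fix s assume s: "0 \<le> s" "s \<le> T - e"
    then have "m s \<le> T" using close[of s] l(2) by linarith
    from l(4)[OF m(3)[OF s(1)] this] show "\<bar>f (m s) - g s\<bar> \<le> d" using m(2)[OF s(1)] by simp
  qed
qed

text \<open>The first time change moves \<open>[0, 1 / (e + e')]\<close> by less than \<open>e\<close>, hence not beyond \<open>1 / e'\<close>. This is where
  \<open>e + e' \<le> 1\<close> is used.\<close>

lemma J1_nbhd_triangle:
  assumes "g \<in> J1_nbhd f (1 / e) e" "k \<in> J1_nbhd g (1 / e') e'" "0 < e" "0 < e'" "e + e' \<le> 1"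
  shows "k \<in> J1_nbhd f (1 / (e + e')) (e + e')"
  using assms(1)
proof (rule J1_nbhdE)
  fix l d assume l: "l \<in> time_changes" "d < e"
    "\<And>s. 0 \<le> s \<Longrightarrow> \<bar>l s - s\<bar> \<le> d" "\<And>s. 0 \<le> s \<Longrightarrow> s \<le> 1 / e \<Longrightarrow> \<bar>g (l s) - f s\<bar> \<le> d"
  from assms(2) show ?thesis
  proof (rule J1_nbhdE)
    fix m d' assume m: "k \<in> skorokhod_space" "m \<in> time_changes" "d' < e'"
      "\<And>s. 0 \<le> s \<Longrightarrow> \<bar>m s - s\<bar> \<le> d'" "\<And>s. 0 \<le> s \<Longrightarrow> s \<le> 1 / e' \<Longrightarrow> \<bar>k (m s) - g s\<bar> \<le> d'"
    have l0: "0 \<le> l s" if "0 \<le> s" for s using that l(1) by (auto simp: time_changes_def)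
    show ?thesis
    proof (rule J1_nbhdI[OF m(1) comp_time_changes[OF l(1) m(2)]])
      show "d + d' < e + e'" using l(2) m(3) by simp
      fix s :: real assume s: "0 \<le> s"
      show "\<bar>m (l s) - s\<bar> \<le> d + d'" using l(3)[OF s] m(4)[OF l0[OF s]] by linarith
      assume sT: "s \<le> 1 / (e + e')"
      have "1 / (e + e') \<le> 1 / e" using assms by (intro divide_left_mono) auto
      then have 1: "\<bar>g (l s) - f s\<bar> \<le> d" using l(4)[OF s] sT by linarith
      have "e' * (e + e') \<le> 1 * 1" using assms by (intro mult_mono) auto
      then have "e * (e' * (e + e')) \<le> e * 1" using assms by (intro mult_left_mono) auto
      then have "e \<le> e / (e' * (e + e'))" using assms by (simp add: pos_le_divide_eq)
      also have "\<dots> = 1 / e' - 1 / (e + e')" using assms by (simp add: field_simps)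
      finally have "l s \<le> 1 / e'" using sT l(2) l(3)[OF s] by linarith
      from m(5)[OF l0[OF s] this] 1 show "\<bar>k (m (l s)) - f s\<bar> \<le> d + d'" by linarith
    qed
  qed
qed

text \<open>Just to the right of \<open>s\<close> both functions are close to their values at \<open>s\<close>, and at a point there a small
  time change compares the two.\<close>

lemma J1_nbhd_separation:
  assumes f: "f \<in> skorokhod_space" and g: "g \<in> skorokhod_space"
    and near: "\<And>e. 0 < e \<Longrightarrow> e \<le> 1 \<Longrightarrow> g \<in> J1_nbhd f (1 / e) e"
  shows "f = g"
proof
  fix s
  show "f s = g s"
  proof (cases "s \<ge> 0")
    case False
    then show ?thesis using f g by (auto simp: skorokhod_space_def extensional_def)
  next
    case True
    have fr: "(f \<longlongrightarrow> f s) (at_right s)" and gr: "(g \<longlongrightarrow> g s) (at_right s)"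
      using f g True by (auto simp: skorokhod_space_def cadlag_on_nonneg_def)
    have "\<bar>f s - g s\<bar> \<le> e" if "e > 0" for e
    proof -
      have e3: "e / 3 > 0" using that by simp
      obtain b where b: "b > s" "\<And>y. s < y \<Longrightarrow> y < b \<Longrightarrow> dist (g y) (g s) < e / 3"
        using tendstoD[OF gr e3] unfolding eventually_at_right_field by blast
      obtain c where c: "c > s" "\<And>y. s < y \<Longrightarrow> y < c \<Longrightarrow> dist (f y) (f s) < e / 3"
        using tendstoD[OF fr e3] unfolding eventually_at_right_field by blast
      define y where "y = (s + min b c) / 2"
      have y: "s < y" "y < b" "y < c" using b(1) c(1) by (auto simp: y_def)
      define R where "R = {1, e / 3, y - s, b - y, 1 / (y + 1)}"
      define r where "r = Min R"
      have "r \<le> z" if "z \<in> R" for z unfolding r_def by (rule Min_le) (use that in \<open>auto simp: R_def\<close>)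
      from this[of 1] this[of "e / 3"] this[of "y - s"] this[of "b - y"] this[of "1 / (y + 1)"]
      have r: "r \<le> 1" "r \<le> e / 3" "r \<le> y - s" "r \<le> b - y" "r \<le> 1 / (y + 1)"
        unfolding R_def by blast+
      have "0 < r" using y True that by (auto simp: r_def R_def)
      note r = this r
      have "r * (y + 1) \<le> 1" using r(6) y True by (simp add: field_simps)
      then have yr: "y \<le> 1 / r" using r(1) by (simp add: field_simps)
      from near[OF r(1,2)] show ?thesis
      proof (rule J1_nbhdE)
        fix l d assume l: "d < r" "\<And>s. 0 \<le> s \<Longrightarrow> \<bar>l s - s\<bar> \<le> d"
          "\<And>s. 0 \<le> s \<Longrightarrow> s \<le> 1 / r \<Longrightarrow> \<bar>g (l s) - f s\<bar> \<le> d"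
        have "0 \<le> y" using y True by simp
        have "s < l y" "l y < b" using l(2)[OF \<open>0 \<le> y\<close>] l(1) r by auto
        from b(2)[OF this] c(2)[OF y(1,3)] l(3)[OF \<open>0 \<le> y\<close> yr] l(1) r(3)
        show ?thesis unfolding dist_real_def by linarith
      qed
    qed
    then have "\<bar>f s - g s\<bar> \<le> 0" by (rule field_le_epsilon) simp
    then show ?thesis by simp
  qed
qed

text \<open>One number \<open>e\<close> measures both the tolerance and, through \<open>1 / e\<close>, the length of the interval. The cap at \<open>1\<close>
  makes the triangle inequality trivial where \<open>J1_nbhd_triangle\<close> does not apply.\<close>

definition J1_dist :: "(real \<Rightarrow> real) \<Rightarrow> (real \<Rightarrow> real) \<Rightarrow> real" where
  "J1_dist f g = Inf (insert 1 {e. 0 < e \<and> g \<in> J1_nbhd f (1 / e) e \<and> f \<in> J1_nbhd g (1 / e) e})"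

lemma J1_dist_le:
  assumes "0 < e" "g \<in> J1_nbhd f (1 / e) e" "f \<in> J1_nbhd g (1 / e) e"
  shows "J1_dist f g \<le> e"
  unfolding J1_dist_def by (rule cInf_lower) (use assms in \<open>auto intro!: bdd_belowI[of _ 0]\<close>)

lemma J1_dist_le_1: "J1_dist f g \<le> 1"
  unfolding J1_dist_def by (rule cInf_lower) (auto intro!: bdd_belowI[of _ 0])

lemma J1_dist_nonneg: "0 \<le> J1_dist f g"
  unfolding J1_dist_def by (rule cInf_greatest) auto

lemma J1_dist_lessD:
  assumes "J1_dist f g < e" "e \<le> 1"
  shows "g \<in> J1_nbhd f (1 / e) e" "f \<in> J1_nbhd g (1 / e) e"
proof -
  obtain e' where e': "0 < e'" "e' < e" "g \<in> J1_nbhd f (1 / e') e'" "f \<in> J1_nbhd g (1 / e') e'"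
    using cInf_lessD[OF _ assms(1)[unfolded J1_dist_def]] assms(2) by auto
  have le: "1 / e \<le> 1 / e'" using e' by (intro divide_left_mono) auto
  show "g \<in> J1_nbhd f (1 / e) e"
    using J1_nbhd_mono[OF le less_imp_le[OF e'(2)], of f] e'(3) by (rule subsetD)
  show "f \<in> J1_nbhd g (1 / e) e"
    using J1_nbhd_mono[OF le less_imp_le[OF e'(2)], of g] e'(4) by (rule subsetD)
qed

lemma J1_dist_commute: "J1_dist f g = J1_dist g f"
  unfolding J1_dist_def by (rule arg_cong[where f = Inf]) auto

interpretation J1: Metric_space skorokhod_space J1_dist
proof
  fix f g
  show "0 \<le> J1_dist f g" by (rule J1_dist_nonneg)
  show "J1_dist f g = J1_dist g f" by (rule J1_dist_commute)
next
  fix f g assume fg: "f \<in> skorokhod_space" "g \<in> skorokhod_space"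
  show "J1_dist f g = 0 \<longleftrightarrow> f = g"
  proof
    assume 0: "J1_dist f g = 0"
    show "f = g"
      by (rule J1_nbhd_separation[OF fg]) (use J1_dist_lessD(1)[of f g] 0 in simp)
  next
    assume "f = g"
    have "J1_dist f g \<le> 0 + e" if "0 < e" for e
      using J1_dist_le[OF that] J1_nbhd_self[OF fg(2) that] \<open>f = g\<close> by simp
    then have "J1_dist f g \<le> 0" by (rule field_le_epsilon)
    then show "J1_dist f g = 0" using J1_dist_nonneg[of f g] by simp
  qed
next
  fix f g k
  assume "f \<in> skorokhod_space" "g \<in> skorokhod_space" "k \<in> skorokhod_space"
  show "J1_dist f k \<le> J1_dist f g + J1_dist g k"
  proof (rule field_le_epsilon)
    fix e :: real assume e: "e > 0"
    define a b where "a = J1_dist f g + e / 2" and "b = J1_dist g k + e / 2"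
    have ab: "J1_dist f g < a" "J1_dist g k < b" "0 < a" "0 < b"
      using e J1_dist_nonneg[of f g] J1_dist_nonneg[of g k] by (auto simp: a_def b_def)
    have "J1_dist f k \<le> a + b"
    proof (cases "a + b \<le> 1")
      case True
      then have "a \<le> 1" "b \<le> 1" using ab by auto
      note 1 = J1_dist_lessD[OF ab(1) \<open>a \<le> 1\<close>] and 2 = J1_dist_lessD[OF ab(2) \<open>b \<le> 1\<close>]
      show ?thesis
        using J1_nbhd_triangle[OF 1(1) 2(1)] J1_nbhd_triangle[OF 2(2) 1(2)] ab True
        by (intro J1_dist_le) (auto simp: add.commute)
    next
      case False
      then show ?thesis using J1_dist_le_1[of f k] by linarith
    qed
    then show "J1_dist f k \<le> J1_dist f g + J1_dist g k + e" by (simp add: a_def b_def)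
  qed
qed

lemma J1_mtopology: "J1.mtopology = skorokhod_J1"
proof (rule topology_eq[THEN iffD2], intro allI)
  fix U
  have "(\<exists>r>0. J1.mball f r \<subseteq> U) \<longleftrightarrow> (\<exists>T e. e > 0 \<and> J1_nbhd f T e \<subseteq> U)"
    if f: "f \<in> skorokhod_space" for f
  proof
    assume "\<exists>r>0. J1.mball f r \<subseteq> U"
    then obtain r where r: "r > 0" "J1.mball f r \<subseteq> U" by blast
    define e where "e = min r 1 / 2"
    have e: "0 < e" "e < r" using r(1) by (auto simp: e_def)
    have "J1_nbhd f (1 / e + e) e \<subseteq> U"
    proof
      fix g assume g: "g \<in> J1_nbhd f (1 / e + e) e"
      have "g \<in> J1_nbhd f (1 / e) e"
        using J1_nbhd_mono[of "1 / e" "1 / e + e" e e f] g e(1) by auto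
      moreover have "f \<in> J1_nbhd g (1 / e) e" using J1_nbhd_sym[OF g f] by simp
      ultimately have "J1_dist f g \<le> e" by (rule J1_dist_le[OF e(1)])
      moreover have "g \<in> skorokhod_space" using g by (auto simp: J1_nbhd_def)
      ultimately show "g \<in> U" using r(2) f e(2) by auto
    qed
    with e(1) show "\<exists>T e. e > 0 \<and> J1_nbhd f T e \<subseteq> U" by blast
  next
    assume "\<exists>T e. e > 0 \<and> J1_nbhd f T e \<subseteq> U"
    then obtain T e where e: "e > 0" "J1_nbhd f T e \<subseteq> U" by blast
    define r where "r = min e (1 / (\<bar>T\<bar> + 1))"
    have r: "0 < r" "r \<le> e" "r \<le> 1 / (\<bar>T\<bar> + 1)" using e(1) by (auto simp: r_def)
    have r1: "r \<le> 1" using r(3) by (rule order_trans) simp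
    have "r * (\<bar>T\<bar> + 1) \<le> 1" using r(3) by (simp add: pos_le_divide_eq)
    then have "\<bar>T\<bar> + 1 \<le> 1 / r" using r(1) by (simp add: pos_le_divide_eq mult.commute)
    then have "T \<le> 1 / r" by linarith
    have "J1.mball f r \<subseteq> U"
    proof
      fix g assume "g \<in> J1.mball f r"
      then have "J1_dist f g < r" by simp
      from J1_dist_lessD(1)[OF this r1] have "g \<in> J1_nbhd f T e"
        using J1_nbhd_mono[OF \<open>T \<le> 1 / r\<close> r(2)] by blast
      with e(2) show "g \<in> U" by blast
    qed
    with r(1) show "\<exists>r>0. J1.mball f r \<subseteq> U" by blast
  qed
  then show "openin J1.mtopology U \<longleftrightarrow> openin skorokhod_J1 U"
    unfolding J1.openin_mtopology openin_skorokhod_J1 by blast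
qed

lemma metrizable_skorokhod_J1: "metrizable_space skorokhod_J1"
  using J1.metrizable_space_mtopology unfolding J1_mtopology .

section \<open>J1-convergence and locally uniform convergence\<close>

text \<open>Undo the time change: it is close to the identity, and the limit is uniformly continuous on compact
  intervals.\<close>

lemma loc_uniform_if_limitin_J1:
  assumes lim: "limitin skorokhod_J1 F w sequentially" and w: "continuous_on {0..} w"
  shows "loc_uniform F w"
proof -
  obtain l where l: "\<And>n. l n \<in> time_changes" "uniform_limit {0..} l (\<lambda>s. s) sequentially"
    "\<And>T. uniform_limit {0..T} (\<lambda>n s. F n (l n s)) w sequentially"
    using lim unfolding limitin_skorokhod_J1 by blast
  show ?thesis unfolding loc_uniform_def
  proof (intro allI uniform_limitI)
    fix T e :: real assume e: "e > 0"
    have "uniformly_continuous_on {0..T + 1} w"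
      by (intro compact_uniformly_continuous continuous_on_subset[OF w]) auto
    then obtain d where d: "d > 0" "\<And>x y. x \<in> {0..T + 1} \<Longrightarrow> y \<in> {0..T + 1} \<Longrightarrow> dist y x < d \<Longrightarrow> dist (w y) (w x) < e / 2"
      unfolding uniformly_continuous_on_def using e by (metis half_gt_zero)
    have "min d 1 > 0" "e / 2 > 0" using d(1) e by auto
    from uniform_limitD[OF l(2) this(1)] uniform_limitD[OF l(3)[of "T + 1"] this(2)]
    show "\<forall>\<^sub>F n in sequentially. \<forall>u\<in>{0..T}. dist (F n u) (w u) < e"
    proof eventually_elim
      case (elim n)
      obtain m where m: "\<And>s. 0 \<le> s \<Longrightarrow> l n (m s) = s" "\<And>s. 0 \<le> s \<Longrightarrow> 0 \<le> m s"
        using time_change_inverse[OF l(1)[of n]] by metis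
      show ?case
      proof
        fix u assume u: "u \<in> {0..T}"
        have mu: "dist u (m u) < min d 1" "0 \<le> m u" using bspec[OF elim(1), of "m u"] m u by auto
        then have "m u \<in> {0..T + 1}" using u by (auto simp: dist_real_def)
        moreover have "dist (F n u) (w (m u)) < e / 2" using bspec[OF elim(2) calculation] m(1)[of u] u by simp
        moreover have "dist (w u) (w (m u)) < e / 2"
          by (rule d(2)) (use calculation u mu in auto)
        ultimately show "dist (F n u) (w u) < e" unfolding dist_real_def by linarith
      qed
    qed
  qed
qed

lemma limitin_J1_if_loc_uniform:
  assumes "loc_uniform F f" "f \<in> skorokhod_space" "\<And>n. F n \<in> skorokhod_space"
  shows "limitin skorokhod_J1 F f sequentially"
  unfolding limitin_skorokhod_J1
proof (intro conjI exI[of _ "\<lambda>n s. s"] allI)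
  show "uniform_limit {0..T} (\<lambda>n s. F n s) f sequentially" for T using assms(1) by (simp add: loc_uniform_def)
  show "uniform_limit {0..} (\<lambda>n s. s) (\<lambda>s. s) sequentially" by (simp add: uniform_limit_iff)
qed (use assms id_time_changes in auto)

section \<open>Grid approximations of a cadlag path\<close>

text \<open>The grid has mesh \<open>1 / (m + 1)\<close>, so that \<open>m = 0\<close> is no exception.\<close>

definition grid_path :: "nat \<Rightarrow> (nat \<Rightarrow> real) \<Rightarrow> real \<Rightarrow> real" where
  "grid_path m r = (\<lambda>u\<in>{0..}. r (nat \<lfloor>u * real (Suc m)\<rfloor>))"

lemma grid_path_skorokhod: "grid_path m r \<in> skorokhod_space"
proof -
  define c where "c = real (Suc m)"
  have c: "c > 0" by (simp add: c_def)
  have "((\<lambda>u. r (nat \<lfloor>u * c\<rfloor>)) \<longlongrightarrow> r (nat \<lfloor>t * c\<rfloor>)) (at_right t)" for t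
  proof (rule tendsto_eventually)
    show "\<forall>\<^sub>F u in at_right t. r (nat \<lfloor>u * c\<rfloor>) = r (nat \<lfloor>t * c\<rfloor>)"
      unfolding eventually_at_right_field
    proof (intro exI[of _ "(\<lfloor>t * c\<rfloor> + 1) / c"] conjI allI impI)
      show "t < (\<lfloor>t * c\<rfloor> + 1) / c" using c floor_correct[of "t * c"] by (simp add: pos_less_divide_eq)
      fix u assume u: "t < u" "u < (\<lfloor>t * c\<rfloor> + 1) / c"
      have "t * c < u * c" "u * c < of_int \<lfloor>t * c\<rfloor> + 1" using u c by (auto simp: pos_less_divide_eq)
      then have "\<lfloor>u * c\<rfloor> = \<lfloor>t * c\<rfloor>" using floor_correct[of "t * c"] by (intro floor_unique) linarith+
      then show "r (nat \<lfloor>u * c\<rfloor>) = r (nat \<lfloor>t * c\<rfloor>)" by simp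
    qed
  qed
  moreover have "((\<lambda>u. r (nat \<lfloor>u * c\<rfloor>)) \<longlongrightarrow> r (nat (\<lceil>t * c\<rceil> - 1))) (at_left t)" for t
  proof (rule tendsto_eventually)
    show "\<forall>\<^sub>F u in at_left t. r (nat \<lfloor>u * c\<rfloor>) = r (nat (\<lceil>t * c\<rceil> - 1))"
      unfolding eventually_at_left_field
    proof (intro exI[of _ "(\<lceil>t * c\<rceil> - 1) / c"] conjI allI impI)
      show "(\<lceil>t * c\<rceil> - 1) / c < t" using c ceiling_correct[of "t * c"] by (simp add: pos_divide_less_eq)
      fix u assume u: "(\<lceil>t * c\<rceil> - 1) / c < u" "u < t"
      have "u * c < t * c" "of_int \<lceil>t * c\<rceil> - 1 < u * c" using u c by (auto simp: pos_divide_less_eq)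
      then have "\<lfloor>u * c\<rfloor> = \<lceil>t * c\<rceil> - 1" using ceiling_correct[of "t * c"] by (intro floor_unique) (simp_all, linarith+)
      then show "r (nat \<lfloor>u * c\<rfloor>) = r (nat (\<lceil>t * c\<rceil> - 1))" by simp
    qed
  qed
  ultimately have "cadlag_on_nonneg (\<lambda>u. r (nat \<lfloor>u * c\<rfloor>))" unfolding cadlag_on_nonneg_def by blast
  moreover have "cadlag_on_nonneg (grid_path m r) \<longleftrightarrow> cadlag_on_nonneg (\<lambda>u. r (nat \<lfloor>u * c\<rfloor>))"
    by (rule cadlag_cong) (simp add: grid_path_def c_def)
  ultimately show ?thesis by (simp add: skorokhod_space_def grid_path_def)
qed

text \<open>Finitely many points can be moved to prescribed nearby places by adding to the identity a sum of tent
  functions that vanish at all other points of \<open>S\<close>. If the tents are low compared to their width,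
  the perturbation has Lipschitz constant at most \<open>1 / 2\<close> and the sum stays increasing.\<close>

lemma time_change_interpolation:
  fixes S :: "real set"
  assumes S: "finite S" "\<And>s. s \<in> S \<Longrightarrow> 0 < s"
  obtains \<delta> where "\<delta> > 0"
    "\<And>h r. 0 < h \<Longrightarrow> h \<le> \<delta> \<Longrightarrow> (\<And>s. s \<in> S \<Longrightarrow> s \<le> r s \<and> r s \<le> s + h) \<Longrightarrow>
      \<exists>l\<in>time_changes. (\<forall>s\<in>S. l s = r s) \<and> (\<forall>s\<ge>0. \<bar>l s - s\<bar> \<le> real (card S) * h)"
proof -
  define D where "D = (\<lambda>(s, s'). \<bar>s - s'\<bar>) ` {(s, s'). s \<in> insert 0 S \<and> s' \<in> insert 0 S \<and> s \<noteq> s'}"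
  \<comment> \<open>the half-width of the tents; \<open>0\<close> is among the points so that it stays fixed\<close>
  define \<eta> where "\<eta> = Min (insert 1 D)"
  have "{(s, s'). s \<in> insert 0 S \<and> s' \<in> insert 0 S \<and> s \<noteq> s'} \<subseteq> insert 0 S \<times> insert 0 S" by auto
  then have finD: "finite (insert 1 D)" using S(1) finite_subset unfolding D_def by blast
  have \<eta>0: "\<eta> > 0" unfolding \<eta>_def using finD by (auto simp: D_def)
  have \<eta>: "\<eta> \<le> \<bar>s - s'\<bar>" if "s \<in> insert 0 S" "s' \<in> insert 0 S" "s \<noteq> s'" for s s'
    unfolding \<eta>_def by (rule Min_le[OF finD]) (use that in \<open>auto simp: D_def\<close>)
  define \<delta> where "\<delta> = \<eta> / (2 * (real (card S) + 1))"
  have \<delta>: "\<delta> > 0" using \<eta>0 by (simp add: \<delta>_def)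
  show thesis
  proof (rule that[OF \<delta>])
    fix h :: real and r assume h: "0 < h" "h \<le> \<delta>" and r: "\<And>s. s \<in> S \<Longrightarrow> s \<le> r s \<and> r s \<le> s + h"
    define tent where "tent s x = max 0 (1 - \<bar>x - s\<bar> / \<eta>)" for s x :: real
    define \<phi> where "\<phi> x = (\<Sum>s\<in>S. (r s - s) * tent s x)" for x
    define l where "l x = x + \<phi> x" for x
    have tent01: "0 \<le> tent s x" "tent s x \<le> 1" for s x using \<eta>0 by (auto simp: tent_def)
    have tent_lip: "\<bar>tent s x - tent s y\<bar> \<le> \<bar>x - y\<bar> / \<eta>" for s x y
    proof -
      have "\<bar>\<bar>x - s\<bar> / \<eta> - \<bar>y - s\<bar> / \<eta>\<bar> = \<bar>\<bar>x - s\<bar> - \<bar>y - s\<bar>\<bar> / \<eta>"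
        using \<eta>0 by (simp add: diff_divide_distrib[symmetric])
      also have "\<dots> \<le> \<bar>x - y\<bar> / \<eta>" using \<eta>0 by (intro divide_right_mono) auto
      finally show ?thesis unfolding tent_def by (auto simp: max_def abs_if split: if_splits)
    qed
    have \<phi>0: "0 \<le> \<phi> x" for x unfolding \<phi>_def using r tent01 by (intro sum_nonneg mult_nonneg_nonneg) auto
    have \<phi>1: "\<phi> x \<le> real (card S) * h" for x
    proof -
      have "\<phi> x \<le> (\<Sum>s\<in>S. h * 1)" unfolding \<phi>_def
        using r tent01 h by (intro sum_mono mult_mono) fastforce+
      then show ?thesis by simp
    qed
    have \<phi>_lip: "\<bar>\<phi> x - \<phi> y\<bar> \<le> \<bar>x - y\<bar> / 2" for x y
    proof -
      have "\<bar>\<phi> x - \<phi> y\<bar> = \<bar>\<Sum>s\<in>S. (r s - s) * (tent s x - tent s y)\<bar>"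
        by (simp add: \<phi>_def sum_subtractf right_diff_distrib)
      also have "\<dots> \<le> (\<Sum>s\<in>S. h * (\<bar>x - y\<bar> / \<eta>))"
      proof (rule order_trans[OF sum_abs sum_mono])
        fix s assume "s \<in> S"
        then have "\<bar>r s - s\<bar> \<le> h" using r[of s] by linarith
        then show "\<bar>(r s - s) * (tent s x - tent s y)\<bar> \<le> h * (\<bar>x - y\<bar> / \<eta>)"
          unfolding abs_mult using tent_lip h by (intro mult_mono) auto
      qed
      also have "\<dots> = (real (card S) * h) * (\<bar>x - y\<bar> / \<eta>)" by simp
      also have "\<dots> \<le> (\<eta> / 2) * (\<bar>x - y\<bar> / \<eta>)"
      proof (rule mult_right_mono)
        have "real (card S) * h \<le> (real (card S) + 1) * \<delta>" using h by (intro mult_mono) auto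
        also have "\<dots> = \<eta> / 2"
        proof -
          define c where "c = real (card S) + 1"
          have "c > 0" by (simp add: c_def add_nonneg_pos)
          then show ?thesis unfolding \<delta>_def c_def[symmetric] by simp
        qed
        finally show "real (card S) * h \<le> \<eta> / 2" .
      qed (use \<eta>0 in auto)
      also have "\<dots> = \<bar>x - y\<bar> / 2" using \<eta>0 by simp
      finally show ?thesis .
    qed
    have tent_S: "tent s s' = (if s = s' then 1 else 0)" if "s \<in> S" "s' \<in> insert 0 S" for s s'
    proof (cases "s = s'")
      case False
      then have "\<eta> \<le> \<bar>s' - s\<bar>" using \<eta>[of s' s] that by blast
      then have "1 \<le> \<bar>s' - s\<bar> / \<eta>" using \<eta>0 by (simp add: pos_le_divide_eq)
      then show ?thesis using False by (simp add: tent_def)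
    qed (simp add: tent_def)
    have lS: "l s = r s" if "s \<in> S" for s
    proof -
      have "\<phi> s = (\<Sum>s'\<in>S. if s' = s then r s - s else 0)"
        unfolding \<phi>_def by (intro sum.cong refl) (use tent_S that in auto)
      then show ?thesis using that S(1) by (simp add: l_def)
    qed
    have l0: "l 0 = 0"
    proof -
      have "\<phi> 0 = (\<Sum>s'\<in>S. 0)"
        unfolding \<phi>_def by (intro sum.cong refl) (use tent_S S(2) in fastforce)
      then show ?thesis by (simp add: l_def)
    qed
    have mono: "l x < l y" if "x < y" for x y
    proof -
      have "\<phi> x - \<phi> y \<le> \<bar>\<phi> y - \<phi> x\<bar>" "\<bar>y - x\<bar> = y - x" using that by auto
      then show ?thesis using \<phi>_lip[of y x] that unfolding l_def by simp
    qed
    have cont: "continuous_on UNIV l"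
      unfolding l_def \<phi>_def tent_def using \<eta>0 by (intro continuous_intros) auto
    have "l ` {0..} = {0..}"
    proof (intro equalityI subsetI)
      fix v assume "v \<in> l ` {0..}"
      then show "v \<in> {0..}" using \<phi>0 by (auto simp: l_def intro: add_nonneg_nonneg)
    next
      fix v :: real assume "v \<in> {0..}"
      then obtain x where "0 \<le> x" "l x = v"
        using IVT'[of l 0 v v] l0 \<phi>0[of v] continuous_on_subset[OF cont] by (auto simp: l_def)
      then show "v \<in> l ` {0..}" by auto
    qed
    then have "l \<in> time_changes" using mono by (auto simp: time_changes_def strict_mono_on_def)
    moreover have "\<forall>s\<ge>0. \<bar>l s - s\<bar> \<le> real (card S) * h" using \<phi>0 \<phi>1 by (simp add: l_def)
    ultimately show "\<exists>l\<in>time_changes. (\<forall>s\<in>S. l s = r s) \<and> (\<forall>s\<ge>0. \<bar>l s - s\<bar> \<le> real (card S) * h)"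
      using lS by (intro bexI[of _ l]) auto
  qed
qed

text \<open>Up to a small error \<open>f\<close> oscillates only at a finite set \<open>S\<close> of points. Delaying each of them to the next
  grid point gives a time change \<open>l\<close> such that \<open>x\<close> and the last grid point before \<open>l x\<close> always lie on the
  same side of every point of \<open>S\<close>.\<close>

lemma grid_path_converges:
  assumes f: "f \<in> skorokhod_space"
  shows "limitin skorokhod_J1 (\<lambda>m. grid_path m (\<lambda>k. f (real k / real (Suc m)))) f sequentially"
    (is "limitin _ ?F _ _")
  unfolding limitin_def
proof (intro conjI allI impI, simp add: f, elim conjE)
  fix U assume "openin skorokhod_J1 U" "f \<in> U"
  then obtain T e where e: "e > 0" "J1_nbhd f T e \<subseteq> U" by (auto simp: openin_skorokhod_J1)
  have "cadlag_on_nonneg f" using f by (simp add: skorokhod_space_def)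
  moreover have "e / 4 > 0" using e(1) by simp
  ultimately obtain \<phi> where \<phi>: "\<phi> \<in> steps" "\<And>x. x \<in> {0..T + 1} \<Longrightarrow> \<bar>f x - \<phi> x\<bar> \<le> e / 4"
    using cadlag_step_approx[of f "e / 4" "T + 1"] by metis
  obtain S0 where S0: "finite S0" "\<And>x y. x \<le> y \<Longrightarrow> S0 \<inter> {x<..y} = {} \<Longrightarrow> \<phi> x = \<phi> y"
    using steps_locally_constant[OF \<phi>(1)] by metis
  define S where "S = S0 \<inter> {0<..}"
  have S: "finite S" "\<And>s. s \<in> S \<Longrightarrow> 0 < s" using S0(1) by (auto simp: S_def)
  have osc: "\<bar>f x - f y\<bar> \<le> e / 2" if "0 \<le> x" "x \<le> y" "y \<le> T + 1" "\<And>s. s \<in> S \<Longrightarrow> \<not> (x < s \<and> s \<le> y)" for x y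
  proof -
    have "S0 \<inter> {x<..y} = {}" using that by (auto simp: S_def)
    then have "\<phi> x = \<phi> y" by (rule S0(2)[OF that(2)])
    moreover have "x \<in> {0..T + 1}" "y \<in> {0..T + 1}" using that by auto
    note \<phi>(2)[OF this(1)] \<phi>(2)[OF this(2)]
    ultimately show ?thesis by linarith
  qed
  obtain \<delta> where \<delta>: "\<delta> > 0"
    "\<And>h r. 0 < h \<Longrightarrow> h \<le> \<delta> \<Longrightarrow> (\<And>s. s \<in> S \<Longrightarrow> s \<le> r s \<and> r s \<le> s + h) \<Longrightarrow>
      \<exists>l\<in>time_changes. (\<forall>s\<in>S. l s = r s) \<and> (\<forall>s\<ge>0. \<bar>l s - s\<bar> \<le> real (card S) * h)"
    using time_change_interpolation[OF S] by metis
  define K where "K = real (card S) + 1"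
  have K: "K > 0" by (simp add: K_def add_nonneg_pos)
  define \<epsilon> where "\<epsilon> = min \<delta> (min (e / 2) 1 / K)"
  have \<epsilon>: "\<epsilon> > 0" using \<delta>(1) e(1) K by (simp add: \<epsilon>_def)
  have "\<forall>\<^sub>F m in sequentially. inverse (real (Suc m)) < \<epsilon>"
    by (rule order_tendstoD(2)[OF LIMSEQ_inverse_real_of_nat \<epsilon>])
  then have "\<forall>\<^sub>F m in sequentially. ?F m \<in> J1_nbhd f T e"
  proof eventually_elim
    case (elim m)
    define c where "c = real (Suc m)"
    have c: "c > 0" by (simp add: c_def)
    define h where "h = inverse c"
    have h: "0 < h" "h \<le> \<delta>" "h * c = 1" using elim c by (auto simp: h_def c_def \<epsilon>_def)
    have "h \<le> min (e / 2) 1 / K" using elim by (simp add: h_def c_def \<epsilon>_def)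
    then have "K * h \<le> min (e / 2) 1" using K by (simp add: pos_le_divide_eq mult.commute)
    moreover have "real (card S) * h \<le> K * h" using h by (intro mult_right_mono) (auto simp: K_def)
    ultimately have small: "real (card S) * h \<le> e / 2" "real (card S) * h \<le> 1" by auto
    \<comment> \<open>the first grid point at or after \<open>s\<close>\<close>
    define r where "r s = of_int \<lceil>s * c\<rceil> * h" for s
    have rc: "r s * c = of_int \<lceil>s * c\<rceil>" for s using h(3) by (simp add: r_def mult.assoc)
    have r: "s \<le> r s \<and> r s \<le> s + h" for s
    proof -
      have "s * c \<le> r s * c" "r s * c \<le> (s + h) * c"
        using ceiling_correct[of "s * c"] h(3) unfolding rc distrib_right by linarith+
      then show ?thesis using c by simp
    qed
    from \<delta>(2)[OF h(1,2) r] obtain l where l: "l \<in> time_changes" "\<And>s. s \<in> S \<Longrightarrow> l s = r s"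
      "\<And>s. 0 \<le> s \<Longrightarrow> \<bar>l s - s\<bar> \<le> real (card S) * h" by metis
    have lmono: "l x < l y" if "0 \<le> x" "x < y" for x y
      using l(1) that by (auto simp: time_changes_def strict_mono_on_def)
    have l0: "0 \<le> l x" if "0 \<le> x" for x using l(1) that by (auto simp: time_changes_def)
    show ?case
    proof (rule J1_nbhdI[OF grid_path_skorokhod l(1), where d = "e / 2"])
      show "e / 2 < e" using e(1) by simp
      fix x :: real assume x: "0 \<le> x"
      show "\<bar>l x - x\<bar> \<le> e / 2" using l(3)[OF x] small by linarith
      assume xT: "x \<le> T"
      \<comment> \<open>the grid point whose value the grid path takes at \<open>l x\<close>\<close>
      define y where "y = of_int \<lfloor>l x * c\<rfloor> / c"
      have yc: "y * c = of_int \<lfloor>l x * c\<rfloor>" using c by (simp add: y_def)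
      have fl0: "0 \<le> \<lfloor>l x * c\<rfloor>" using l0[OF x] c by simp
      have y0: "0 \<le> y" using fl0 c by (simp add: y_def)
      have "y * c \<le> l x * c" unfolding yc by (rule of_int_floor_le)
      then have yl: "y \<le> l x" using c by simp
      then have yT: "y \<le> T + 1" using l(3)[OF x] small xT by linarith
      have "\<bar>f y - f x\<bar> \<le> e / 2"
      proof (cases "y \<le> x")
        case True
        have "\<not> (y < s \<and> s \<le> x)" if s: "s \<in> S" for s
        proof
          assume ys: "y < s \<and> s \<le> x"
          have "l s \<le> l x" using lmono[of s x] ys S(2)[OF s] by (cases "s = x") auto
          then have "of_int \<lceil>s * c\<rceil> \<le> l x * c" using l(2)[OF s] rc[of s] c mult_right_mono[of "l s" "l x" c] by simp
          then have "\<lceil>s * c\<rceil> \<le> \<lfloor>l x * c\<rfloor>" by (simp add: le_floor_iff)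
          then have "r s * c \<le> y * c" unfolding rc yc by simp
          then show False using c r[of s] ys by simp
        qed
        with osc[OF y0 True] xT show ?thesis by simp
      next
        case False
        have "\<not> (x < s \<and> s \<le> y)" if s: "s \<in> S" for s
        proof
          assume xs: "x < s \<and> s \<le> y"
          have "l x < l s" using lmono[of x s] xs x by simp
          then have "l x * c < of_int \<lceil>s * c\<rceil>" using l(2)[OF s] rc[of s] c mult_strict_right_mono[of "l x" "l s" c] by simp
          then have "\<lfloor>l x * c\<rfloor> < \<lceil>s * c\<rceil>" by (simp add: floor_less_iff)
          then have "of_int \<lfloor>l x * c\<rfloor> < s * c" by (simp add: less_ceiling_iff)
          then have "y * c < s * c" unfolding yc .
          then show False using c xs by simp
        qed
        with osc[OF x _ yT] False show ?thesis by (simp add: abs_minus_commute)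
      qed
      moreover have "?F m (l x) = f y"
        using l0[OF x] fl0 by (simp add: grid_path_def y_def c_def)
      ultimately show "\<bar>?F m (l x) - f x\<bar> \<le> e / 2" by simp
    qed
  qed
  then show "\<forall>\<^sub>F m in sequentially. ?F m \<in> U"
    by eventually_elim (use e(2) in blast)
qed

section \<open>Borel measurability of path-valued maps\<close>

lemma borel_of_measurableI:
  assumes "\<And>\<omega>. \<omega> \<in> space M \<Longrightarrow> f \<omega> \<in> topspace T"
    and "\<And>U. openin T U \<Longrightarrow> f -` U \<inter> space M \<in> sets M"
  shows "f \<in> M \<rightarrow>\<^sub>M borel_of T"
proof -
  have "{U. openin T U} \<subseteq> Pow (topspace T)" using openin_subset by auto
  then show ?thesis unfolding borel_of_def by (rule measurable_measure_of) (use assms in auto)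
qed

lemma borel_of_measurableD:
  assumes "f \<in> M \<rightarrow>\<^sub>M borel_of T"
  shows "\<omega> \<in> space M \<Longrightarrow> f \<omega> \<in> topspace T" and "openin T U \<Longrightarrow> f -` U \<inter> space M \<in> sets M"
proof -
  have sub: "{U. openin T U} \<subseteq> Pow (topspace T)" using openin_subset by auto
  show "f \<omega> \<in> topspace T" if "\<omega> \<in> space M"
    using measurable_space[OF assms that] space_measure_of[OF sub] by (simp add: borel_of_def)
  show "f -` U \<inter> space M \<in> sets M" if "openin T U"
    using measurable_sets[OF assms, of U] sets_measure_of[OF sub] that by (simp add: borel_of_def sigma_sets.Basic)
qed

lemma borel_of_real_measurable:
  assumes "f \<in> M \<rightarrow>\<^sub>M borel_of T" "continuous_map T euclideanreal h"
  shows "(\<lambda>\<omega>. h (f \<omega>)) \<in> borel_measurable M"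
proof (rule borel_measurableI)
  fix S :: "real set" assume "open S"
  then have "openin T {x \<in> topspace T. h x \<in> S}" using assms(2) by (auto simp: continuous_map_def)
  from borel_of_measurableD(2)[OF assms(1) this]
  have "f -` {x \<in> topspace T. h x \<in> S} \<inter> space M \<in> sets M" .
  also have "f -` {x \<in> topspace T. h x \<in> S} \<inter> space M = (\<lambda>\<omega>. h (f \<omega>)) -` S \<inter> space M"
    using borel_of_measurableD(1)[OF assms(1)] by auto
  finally show "(\<lambda>\<omega>. h (f \<omega>)) -` S \<inter> space M \<in> sets M" .
qed

text \<open>An open set \<open>U\<close> is exhausted by open sets \<open>V k\<close> with positive distance from its complement. The limit
  lies in \<open>U\<close> iff, for some \<open>k\<close>, eventually all members of the sequence lie in \<open>V k\<close>.\<close>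

lemma borel_of_measurable_LIMSEQ:
  assumes T: "metrizable_space T" and F: "\<And>m. F m \<in> M \<rightarrow>\<^sub>M borel_of T"
    and lim: "\<And>\<omega>. \<omega> \<in> space M \<Longrightarrow> limitin T (\<lambda>m. F m \<omega>) (f \<omega>) sequentially"
  shows "f \<in> M \<rightarrow>\<^sub>M borel_of T"
proof (rule borel_of_measurableI)
  show "f \<omega> \<in> topspace T" if "\<omega> \<in> space M" for \<omega> using lim[OF that] by (simp add: limitin_def)
  fix U assume U: "openin T U"
  obtain X d where X: "Metric_space X d" "T = Metric_space.mtopology X d"
    using T unfolding metrizable_space_def by metis
  interpret Metric_space X d by (rule X(1))
  define V where "V k = {x \<in> X. \<exists>r>inverse (real (Suc k)). mball x r \<subseteq> U}" for k
  have V: "openin T (V k)" for k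
    unfolding X(2) openin_mtopology
  proof (intro conjI allI impI)
    show "V k \<subseteq> X" by (auto simp: V_def)
    fix x assume "x \<in> V k"
    then obtain r where r: "x \<in> X" "r > inverse (real (Suc k))" "mball x r \<subseteq> U" by (auto simp: V_def)
    define c where "c = inverse (real (Suc k))"
    define \<epsilon> where "\<epsilon> = (r - c) / 2"
    have "r > c" using r(2) by (simp add: c_def)
    then have \<epsilon>: "\<epsilon> > 0" "r - \<epsilon> > inverse (real (Suc k))"
      unfolding c_def[symmetric] by (auto simp: \<epsilon>_def field_simps)
    have "mball x \<epsilon> \<subseteq> V k"
    proof
      fix y assume y: "y \<in> mball x \<epsilon>"
      have "mball y (r - \<epsilon>) \<subseteq> mball x r"
      proof
        fix z assume "z \<in> mball y (r - \<epsilon>)"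
        then show "z \<in> mball x r" using y triangle[of x y z] by auto
      qed
      with r(3) \<epsilon>(2) y show "y \<in> V k" by (auto simp: V_def intro!: exI[of _ "r - \<epsilon>"])
    qed
    with \<epsilon>(1) show "\<exists>r>0. mball x r \<subseteq> V k" by blast
  qed
  have "f -` U \<inter> space M = (\<Union>k. \<Union>N. \<Inter>m\<in>{N..}. F m -` V k \<inter> space M)"
  proof (intro equalityI subsetI)
    fix \<omega> assume \<omega>: "\<omega> \<in> f -` U \<inter> space M"
    then have "f \<omega> \<in> U" by simp
    then obtain r where r: "r > 0" "mball (f \<omega>) r \<subseteq> U" using U unfolding X(2) openin_mtopology by blast
    obtain k where k: "inverse (real (Suc k)) < r" using reals_Archimedean[OF r(1)] by blast
    have "f \<omega> \<in> X" using lim[of \<omega>] \<omega> X(2) by (simp add: limitin_def)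
    then have "f \<omega> \<in> V k" using r(2) k by (auto simp: V_def)
    then have "\<forall>\<^sub>F m in sequentially. F m \<omega> \<in> V k" using lim[of \<omega>] V[of k] \<omega> by (simp add: limitin_def)
    then obtain N where "\<And>m. m \<ge> N \<Longrightarrow> F m \<omega> \<in> V k" by (auto simp: eventually_sequentially)
    then show "\<omega> \<in> (\<Union>k. \<Union>N. \<Inter>m\<in>{N..}. F m -` V k \<inter> space M)" using \<omega> by auto
  next
    fix \<omega> assume "\<omega> \<in> (\<Union>k. \<Union>N. \<Inter>m\<in>{N..}. F m -` V k \<inter> space M)"
    then obtain k N where N: "\<And>m. m \<ge> N \<Longrightarrow> F m \<omega> \<in> V k" "\<omega> \<in> space M" by auto
    have l: "limitin mtopology (\<lambda>m. F m \<omega>) (f \<omega>) sequentially" using lim[OF N(2)] X(2) by simp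
    then have "\<forall>\<^sub>F m in sequentially. F m \<omega> \<in> X \<and> d (F m \<omega>) (f \<omega>) < inverse (real (Suc k))"
      unfolding limitin_metric by simp
    then have "\<forall>\<^sub>F m in sequentially. f \<omega> \<in> U"
      using eventually_ge_at_top[of N]
    proof eventually_elim
      case (elim m)
      obtain r where "r > inverse (real (Suc k))" "mball (F m \<omega>) r \<subseteq> U" using N(1)[OF elim(2)] by (auto simp: V_def)
      moreover have "f \<omega> \<in> X" using l by (simp add: limitin_metric)
      ultimately show ?case using elim(1) by (auto simp: subset_iff)
    qed
    then show "\<omega> \<in> f -` U \<inter> space M" using N(2) by simp
  qed
  moreover have "F m -` V k \<inter> space M \<in> sets M" for m k by (rule borel_of_measurableD(2)[OF F V])
  then have "(\<Inter>m\<in>{N..}. F m -` V k \<inter> space M) \<in> sets M" for k N by (intro sets.countable_INT') auto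
  then have "(\<Union>k. \<Union>N. \<Inter>m\<in>{N..}. F m -` V k \<inter> space M) \<in> sets M"
    by (intro sets.countable_UN image_subsetI)
  ultimately show "f -` U \<inter> space M \<in> sets M" by simp
qed

text \<open>Only finitely many coordinates matter on a bounded time interval.\<close>

lemma grid_path_continuous:
  "continuous_map euclidean skorokhod_J1 (\<lambda>r::nat \<times> nat \<Rightarrow> real. grid_path m (\<lambda>k. r (j, k)))"
  unfolding continuous_map_def
proof (intro conjI allI impI)
  show "(\<lambda>r::nat \<times> nat \<Rightarrow> real. grid_path m (\<lambda>k. r (j, k))) \<in> topspace euclidean \<rightarrow> topspace skorokhod_J1"
    using grid_path_skorokhod by simp
  fix U assume U: "openin skorokhod_J1 U"
  have "open {r. grid_path m (\<lambda>k. r (j, k)) \<in> U}"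
    unfolding open_subopen[of "{r. grid_path m (\<lambda>k. r (j, k)) \<in> U}"]
  proof
    fix r assume "r \<in> {r. grid_path m (\<lambda>k. r (j, k)) \<in> U}"
    then obtain T e where e: "e > 0" "J1_nbhd (grid_path m (\<lambda>k. r (j, k))) T e \<subseteq> U"
      using U by (auto simp: openin_skorokhod_J1)
    define N where "N = nat \<lfloor>T * real (Suc m)\<rfloor>"
    define B where "B = (\<Inter>k\<in>{..N}. {r'::nat \<times> nat \<Rightarrow> real. \<bar>r' (j, k) - r (j, k)\<bar> < e / 2})"
    have "open {r'::nat \<times> nat \<Rightarrow> real. \<bar>r' (j, k) - r (j, k)\<bar> < e / 2}" for k
      by (intro open_Collect_less continuous_intros continuous_on_product_coordinates)
    then have "open B" unfolding B_def by (intro open_INT) auto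
    moreover have "r \<in> B" using e(1) by (simp add: B_def)
    moreover have "B \<subseteq> {r. grid_path m (\<lambda>k. r (j, k)) \<in> U}"
    proof
      fix r' assume r': "r' \<in> B"
      have "grid_path m (\<lambda>k. r' (j, k)) \<in> J1_nbhd (grid_path m (\<lambda>k. r (j, k))) T e"
      proof (rule J1_nbhdI[OF grid_path_skorokhod id_time_changes, where d = "e / 2"])
        show "e / 2 < e" using e(1) by simp
        fix s :: real assume s: "0 \<le> s"
        show "\<bar>s - s\<bar> \<le> e / 2" using e(1) by simp
        assume "s \<le> T"
        then have "nat \<lfloor>s * real (Suc m)\<rfloor> \<le> N"
          unfolding N_def by (intro nat_mono floor_mono mult_right_mono) auto
        then have "\<bar>r' (j, nat \<lfloor>s * real (Suc m)\<rfloor>) - r (j, nat \<lfloor>s * real (Suc m)\<rfloor>)\<bar> < e / 2"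
          using r' unfolding B_def by blast
        then show "\<bar>grid_path m (\<lambda>k. r' (j, k)) s - grid_path m (\<lambda>k. r (j, k)) s\<bar> \<le> e / 2"
          using s by (simp add: grid_path_def del: of_nat_Suc)
      qed
      with e(2) show "r' \<in> {r. grid_path m (\<lambda>k. r (j, k)) \<in> U}" by blast
    qed
    ultimately show "\<exists>T. open T \<and> r \<in> T \<and> T \<subseteq> {r. grid_path m (\<lambda>k. r (j, k)) \<in> U}" by blast
  qed
  then show "openin euclidean {r \<in> topspace euclidean. grid_path m (\<lambda>k. r (j, k)) \<in> U}" by simp
qed

lemma metrizable_product_J1: "metrizable_space (product_topology (\<lambda>j. skorokhod_J1) (I :: nat set))"
  using metrizable_skorokhod_J1 by (simp add: metrizable_space_product_topology countable_subset[of _ "UNIV :: nat set"])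

text \<open>\<open>Y\<close> is the limit of its grid approximations, and these factor through the countable product
  \<open>nat \<times> nat \<Rightarrow> real\<close>, whose Borel sets are generated by the coordinates.\<close>

lemma measurable_product_J1:
  fixes Y :: "'w \<Rightarrow> nat \<Rightarrow> real \<Rightarrow> real"
  assumes top: "\<And>\<omega>. \<omega> \<in> space M \<Longrightarrow> Y \<omega> \<in> topspace (product_topology (\<lambda>j. skorokhod_J1) I)"
    and meas: "\<And>j u. j \<in> I \<Longrightarrow> 0 \<le> u \<Longrightarrow> (\<lambda>\<omega>. Y \<omega> j u) \<in> borel_measurable M"
  shows "Y \<in> M \<rightarrow>\<^sub>M borel_of (product_topology (\<lambda>j. skorokhod_J1) I)"
proof -
  define R where "R m \<omega> = (\<lambda>(j, k). if j \<in> I then Y \<omega> j (real k / real (Suc m)) else 0)" for m \<omega>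
  define G where "G m r = (\<lambda>j\<in>I. grid_path m (\<lambda>k. r (j, k)))" for m and r :: "nat \<times> nat \<Rightarrow> real"
  have R: "R m \<in> borel_measurable M" for m
  proof (rule measurable_coordinatewise_then_product)
    show "(\<lambda>\<omega>. R m \<omega> p) \<in> borel_measurable M" for p
      using meas[of "fst p" "real (snd p) / real (Suc m)"]
      by (cases "fst p \<in> I") (simp_all add: R_def case_prod_beta del: of_nat_Suc)
  qed
  have G: "continuous_map euclidean (product_topology (\<lambda>j. skorokhod_J1) I) (G m)" for m
    unfolding continuous_map_componentwise
  proof (intro conjI ballI)
    show "G m ` topspace euclidean \<subseteq> extensional I" by (auto simp: G_def)
    show "continuous_map euclidean skorokhod_J1 (\<lambda>x. G m x j)" if "j \<in> I" for j
      using grid_path_continuous[of m j] that by (simp add: G_def)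
  qed
  have "(\<lambda>\<omega>. G m (R m \<omega>)) \<in> M \<rightarrow>\<^sub>M borel_of (product_topology (\<lambda>j. skorokhod_J1) I)" for m
  proof (rule borel_of_measurableI)
    show "G m (R m \<omega>) \<in> topspace (product_topology (\<lambda>j. skorokhod_J1) I)" for \<omega>
      using G[of m] by (auto simp: continuous_map_def)
    fix U assume "openin (product_topology (\<lambda>j. skorokhod_J1) I) U"
    then have "openin euclidean {r \<in> topspace euclidean. G m r \<in> U}" using G[of m] by (simp only: continuous_map_def)
    then have "open {r. G m r \<in> U}" by simp
    then have "R m -` {r. G m r \<in> U} \<inter> space M \<in> sets M" by (intro measurable_sets[OF R] borel_open)
    also have "R m -` {r. G m r \<in> U} \<inter> space M = (\<lambda>\<omega>. G m (R m \<omega>)) -` U \<inter> space M" by auto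
    finally show "(\<lambda>\<omega>. G m (R m \<omega>)) -` U \<inter> space M \<in> sets M" .
  qed
  moreover have "limitin (product_topology (\<lambda>j. skorokhod_J1) I) (\<lambda>m. G m (R m \<omega>)) (Y \<omega>) sequentially"
    if \<omega>: "\<omega> \<in> space M" for \<omega>
  proof -
  have Y: "Y \<omega> \<in> extensional I" "\<And>j. j \<in> I \<Longrightarrow> Y \<omega> j \<in> skorokhod_space" using top[OF \<omega>] by (auto simp: PiE_iff)
    show ?thesis
      unfolding limitin_componentwise
    proof (intro conjI ballI Y(1) always_eventually allI)
      show "G m (R m \<omega>) \<in> topspace (product_topology (\<lambda>j. skorokhod_J1) I)" for m
        by (auto simp: G_def grid_path_skorokhod)
      show "limitin skorokhod_J1 (\<lambda>m. G m (R m \<omega>) j) (Y \<omega> j) sequentially" if j: "j \<in> I" for j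
        using grid_path_converges[OF Y(2)[OF j]] j by (simp add: G_def R_def del: of_nat_Suc)
    qed
  qed
  ultimately show ?thesis by (rule borel_of_measurable_LIMSEQ[OF metrizable_product_J1])
qed

section \<open>An extended continuous mapping theorem\<close>

context
  fixes Y :: "real \<Rightarrow> 'w \<Rightarrow> 'x" and Z :: "'v \<Rightarrow> 'x" and T M N G
  assumes T: "metrizable_space T" and M: "prob_space M" and N: "prob_space N"
    and Y: "\<forall>\<^sub>F t in at_top. Y t \<in> M \<rightarrow>\<^sub>M borel_of T" and Z: "Z \<in> N \<rightarrow>\<^sub>M borel_of T"
    and conv: "\<And>h. continuous_map T euclideanreal h \<Longrightarrow> bounded (h ` topspace T) \<Longrightarrow>
        ((\<lambda>t. \<integral>\<omega>. h (Y t \<omega>) \<partial>M) \<longlongrightarrow> (\<integral>\<omega>. h (Z \<omega>) \<partial>N)) at_top"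
    and G: "\<And>t. G t \<subseteq> space M" "\<And>t \<omega>. \<omega> \<in> G t \<Longrightarrow> Y t \<omega> \<in> topspace T"
      "\<forall>\<^sub>F t in at_top. AE \<omega> in M. \<omega> \<in> G t"
begin

text \<open>For each \<open>m\<close> the function \<open>g m\<close> below is \<open>m\<close>-Lipschitz and dominates \<open>\<phi> t\<close> along \<open>Y t\<close> on \<open>G t\<close> for
  all \<open>t \<ge> m\<close>, so the upper limit of the integrals of \<open>\<phi> t\<close> is at most the integral of \<open>g m\<close> along \<open>Z\<close>. As \<open>m\<close> grows, a value
  of \<open>g m\<close> at \<open>Z \<omega>'\<close> that stays above \<open>\<psi> \<omega>'\<close> would have to come from points \<open>Y (t n) (\<omega> n)\<close> that
  converge to \<open>Z \<omega>'\<close>, which hypothesis \<open>seq\<close> rules out.\<close>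

lemma extended_mapping_upper:
  fixes \<phi> :: "real \<Rightarrow> 'w \<Rightarrow> real"
  assumes \<phi>: "\<forall>\<^sub>F t in at_top. \<phi> t \<in> borel_measurable M" and \<psi>: "\<psi> \<in> borel_measurable N"
    and B: "\<And>t \<omega>. \<omega> \<in> space M \<Longrightarrow> \<bar>\<phi> t \<omega>\<bar> \<le> B" "\<And>\<omega>. \<omega> \<in> space N \<Longrightarrow> \<bar>\<psi> \<omega>\<bar> \<le> B"
    and seq: "AE \<omega>' in N. \<forall>t \<omega>. filterlim t at_top sequentially \<longrightarrow> (\<forall>n. \<omega> n \<in> G (t n)) \<longrightarrow>
        limitin T (\<lambda>n::nat. Y (t n) (\<omega> n)) (Z \<omega>') sequentially \<longrightarrow> (\<lambda>n. \<phi> (t n) (\<omega> n)) \<longlonglongrightarrow> \<psi> \<omega>'"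
    and e: "e > 0"
  shows "\<forall>\<^sub>F t in at_top. (\<integral>\<omega>. \<phi> t \<omega> \<partial>M) < (\<integral>\<omega>. \<psi> \<omega> \<partial>N) + e"
proof -
  interpret M: prob_space M by (rule M)
  interpret N: prob_space N by (rule N)
  obtain X d where X: "Metric_space X d" "T = Metric_space.mtopology X d"
    using T unfolding metrizable_space_def by metis
  interpret Metric_space X d by (rule X(1))
  have top: "topspace T = X" using X(2) by simp
  have B0: "B \<ge> 0"
  proof -
    obtain \<omega> where "\<omega> \<in> space N" using N.not_empty by blast
    from B(2)[OF this] show ?thesis by simp
  qed
  \<comment> \<open>the lower bound \<open>- B\<close> keeps the set nonempty and does not affect continuity of its supremum\<close>
  define E where "E m y = insert (- B) {\<phi> t \<omega> - real m * d y (Y t \<omega>) | t \<omega>. real m \<le> t \<and> \<omega> \<in> G t}"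
    for m :: nat and y
  define g where "g m y = Sup (E m y)" for m y
  have E_le: "x \<le> B" if "x \<in> E m y" for x m y
  proof -
    have "\<phi> t \<omega> - real m * d y (Y t \<omega>) \<le> B" if "\<omega> \<in> G t" for t \<omega>
    proof -
      have "\<bar>\<phi> t \<omega>\<bar> \<le> B" using B(1) G(1) that by blast
      moreover have "0 \<le> real m * d y (Y t \<omega>)" by simp
      ultimately show ?thesis by linarith
    qed
    then show ?thesis using that B0 unfolding E_def by auto
  qed
  have bdd: "bdd_above (E m y)" for m y using E_le by (intro bdd_aboveI)
  have ne: "E m y \<noteq> {}" for m y by (simp add: E_def)
  have g_le: "g m y \<le> B" for m y unfolding g_def by (rule cSup_least[OF ne E_le])
  have g_ge: "- B \<le> g m y" for m y unfolding g_def by (rule cSup_upper[OF _ bdd]) (simp add: E_def)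
  have g_ge': "\<phi> t \<omega> - real m * d y (Y t \<omega>) \<le> g m y" if "real m \<le> t" "\<omega> \<in> G t" for m y t \<omega>
    unfolding g_def by (rule cSup_upper[OF _ bdd]) (use that in \<open>auto simp: E_def\<close>)
  have lip: "g m y \<le> g m y' + real m * d y y'" if y: "y \<in> X" "y' \<in> X" for m y y'
    unfolding g_def[of m y]
  proof (rule cSup_least[OF ne])
    fix x assume "x \<in> E m y"
    then consider "x = - B" | t \<omega> where "x = \<phi> t \<omega> - real m * d y (Y t \<omega>)" "real m \<le> t" "\<omega> \<in> G t"
      unfolding E_def by blast
    then show "x \<le> g m y' + real m * d y y'"
    proof cases
      case 1
      have "0 \<le> real m * d y y'" by simp
      then show ?thesis using 1 g_ge[of m y'] by linarith
    next
      case 2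
      have "Y t \<omega> \<in> X" using G(2)[OF 2(3)] top by simp
      then have "d y' (Y t \<omega>) \<le> d y y' + d y (Y t \<omega>)" using triangle[of y' y "Y t \<omega>"] y commute[of y y'] by simp
      then have "real m * d y' (Y t \<omega>) \<le> real m * (d y y' + d y (Y t \<omega>))" by (intro mult_left_mono) auto
      then show ?thesis using g_ge'[OF 2(2,3), of y'] 2(1) by (simp add: distrib_left)
    qed
  qed
  have g_cont: "continuous_map T euclideanreal (g m)" for m
    unfolding continuous_map_def
  proof (intro conjI allI impI)
    show "g m \<in> topspace T \<rightarrow> topspace euclideanreal" by simp
    fix S :: "real set" assume "openin euclideanreal S"
    then have S: "open S" by simp
    show "openin T {x \<in> topspace T. g m x \<in> S}"
      unfolding X(2) openin_mtopology
    proof (intro conjI allI impI)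
      show "{x \<in> topspace mtopology. g m x \<in> S} \<subseteq> X" by auto
      fix x assume x: "x \<in> {x \<in> topspace mtopology. g m x \<in> S}"
      then obtain \<epsilon> where \<epsilon>: "\<epsilon> > 0" "\<And>v. dist v (g m x) < \<epsilon> \<Longrightarrow> v \<in> S"
        using S unfolding open_dist by blast
      define r where "r = \<epsilon> / (real m + 1)"
      have r: "r > 0" using \<epsilon>(1) by (simp add: r_def add_nonneg_pos)
      have "mball x r \<subseteq> {x \<in> topspace mtopology. g m x \<in> S}"
      proof
        fix y assume "y \<in> mball x r"
        then have y: "x \<in> X" "y \<in> X" "d x y < r" by auto
        have "real m * d x y \<le> (real m + 1) * d x y" by (intro mult_right_mono) auto
        also have "\<dots> < (real m + 1) * r" using y(3) by (intro mult_strict_left_mono) auto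
        also have "\<dots> = \<epsilon>" by (simp add: r_def add_nonneg_eq_0_iff)
        finally have "\<bar>g m y - g m x\<bar> < \<epsilon>"
          using lip[OF y(1,2), of m] lip[OF y(2,1), of m] commute[of x y] by (simp add: abs_less_iff)
        then have "g m y \<in> S" by (intro \<epsilon>(2)) (simp add: dist_real_def)
        then show "y \<in> {x \<in> topspace mtopology. g m x \<in> S}" using y(2) by simp
      qed
      with r show "\<exists>r>0. mball x r \<subseteq> {x \<in> topspace mtopology. g m x \<in> S}" by blast
    qed
  qed
  have g_bd: "\<bar>g m y\<bar> \<le> B" for m y using g_le[of m y] g_ge[of m y] by (simp add: abs_le_iff)
  have gZ: "(\<lambda>\<omega>. g m (Z \<omega>)) \<in> borel_measurable N" for m by (rule borel_of_real_measurable[OF Z g_cont])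
  have iZ: "integrable N (\<lambda>\<omega>. g m (Z \<omega>))" for m
    by (rule N.integrable_const_bound[of _ B]) (use g_bd gZ in auto)
  have i\<psi>: "integrable N \<psi>" by (rule N.integrable_const_bound[of _ B]) (use B(2) \<psi> in \<open>auto intro!: AE_I2\<close>)
  have imax: "integrable N (\<lambda>\<omega>. max (g m (Z \<omega>)) (\<psi> \<omega>))" for m by (intro integrable_max iZ i\<psi>)
  have anti: "g m' y \<le> g m y" if "m \<le> m'" for m m' y
    unfolding g_def[of m']
  proof (rule cSup_least[OF ne])
    fix x assume "x \<in> E m' y"
    then consider "x = - B" | t \<omega> where "x = \<phi> t \<omega> - real m' * d y (Y t \<omega>)" "real m' \<le> t" "\<omega> \<in> G t"
      unfolding E_def by blast
    then show "x \<le> g m y"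
    proof cases
      case 2
      have "real m * d y (Y t \<omega>) \<le> real m' * d y (Y t \<omega>)" using that by (intro mult_right_mono) auto
      moreover have "\<phi> t \<omega> - real m * d y (Y t \<omega>) \<le> g m y" using 2 that by (intro g_ge') auto
      ultimately show ?thesis using 2(1) by linarith
    qed (use g_ge in simp)
  qed
  have lim: "AE \<omega>' in N. (\<lambda>m. max (g m (Z \<omega>')) (\<psi> \<omega>')) \<longlonglongrightarrow> \<psi> \<omega>'"
    using seq
  proof (rule AE_mp, intro AE_I2 impI)
    fix \<omega>' assume \<omega>': "\<omega>' \<in> space N" and seq: "\<forall>t \<omega>. filterlim t at_top sequentially \<longrightarrow> (\<forall>n. \<omega> n \<in> G (t n)) \<longrightarrow>
        limitin T (\<lambda>n::nat. Y (t n) (\<omega> n)) (Z \<omega>') sequentially \<longrightarrow> (\<lambda>n. \<phi> (t n) (\<omega> n)) \<longlonglongrightarrow> \<psi> \<omega>'"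
    have z: "Z \<omega>' \<in> X" using borel_of_measurableD(1)[OF Z \<omega>'] top by simp
    have ex: "\<exists>m. g m (Z \<omega>') \<le> \<psi> \<omega>' + \<epsilon>" if \<epsilon>: "\<epsilon> > 0" for \<epsilon>
    proof (rule ccontr)
      assume "\<not> (\<exists>m. g m (Z \<omega>') \<le> \<psi> \<omega>' + \<epsilon>)"
      then have gt: "\<psi> \<omega>' + \<epsilon> < g m (Z \<omega>')" for m by (simp add: not_le)
      have "\<exists>t \<omega>. real m \<le> t \<and> \<omega> \<in> G t \<and> \<psi> \<omega>' + \<epsilon> < \<phi> t \<omega> - real m * d (Z \<omega>') (Y t \<omega>)" for m
      proof -
        obtain x where x: "x \<in> E m (Z \<omega>')" "\<psi> \<omega>' + \<epsilon> < x"
          using less_cSupD[OF ne gt[of m, unfolded g_def]] by blast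
        have "x \<noteq> - B" using x(2) B(2)[OF \<omega>'] \<epsilon> by linarith
        then show ?thesis using x unfolding E_def by blast
      qed
      then obtain t \<omega> where t: "\<And>m. real m \<le> t m" "\<And>m. \<omega> m \<in> G (t m)"
        "\<And>m. \<psi> \<omega>' + \<epsilon> < \<phi> (t m) (\<omega> m) - real m * d (Z \<omega>') (Y (t m) (\<omega> m))" by metis
      have YX: "Y (t m) (\<omega> m) \<in> X" for m using G(2)[OF t(2)[of m]] top by simp
      have "filterlim t at_top sequentially"
        by (rule filterlim_at_top_mono[OF filterlim_real_sequentially]) (use t(1) in simp)
      moreover have "limitin T (\<lambda>m. Y (t m) (\<omega> m)) (Z \<omega>') sequentially"
        unfolding X(2) limitin_metric_dist_null
      proof (intro conjI z always_eventually allI YX)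
        show "(\<lambda>m. d (Y (t m) (\<omega> m)) (Z \<omega>')) \<longlonglongrightarrow> 0"
        proof (rule Lim_null_comparison)
          show "\<forall>\<^sub>F m in sequentially. norm (d (Y (t m) (\<omega> m)) (Z \<omega>')) \<le> 2 * B / real m"
            using eventually_gt_at_top[of 0]
          proof eventually_elim
            case (elim m)
            have "\<omega> m \<in> space M" using t(2)[of m] G(1) by blast
            then have "real m * d (Z \<omega>') (Y (t m) (\<omega> m)) \<le> 2 * B"
              using t(3)[of m] \<epsilon> B(1)[of "\<omega> m" "t m"] B(2)[OF \<omega>'] by linarith
            then show ?case using elim commute[of "Z \<omega>'"] by (simp add: pos_le_divide_eq mult.commute)
          qed
          show "(\<lambda>m. 2 * B / real m) \<longlonglongrightarrow> 0" by (rule lim_const_over_n)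
        qed
      qed
      ultimately have "(\<lambda>m. \<phi> (t m) (\<omega> m)) \<longlonglongrightarrow> \<psi> \<omega>'" using seq t(2) by blast
      from order_tendstoD(2)[OF this, of "\<psi> \<omega>' + \<epsilon>"] \<epsilon>
      have "\<forall>\<^sub>F m in sequentially. \<phi> (t m) (\<omega> m) < \<psi> \<omega>' + \<epsilon>" by simp
      then obtain m where "\<phi> (t m) (\<omega> m) < \<psi> \<omega>' + \<epsilon>" using eventually_happens'[OF sequentially_bot] by blast
      moreover have "0 \<le> real m * d (Z \<omega>') (Y (t m) (\<omega> m))" by simp
      ultimately show False using t(3)[of m] by linarith
    qed
    show "(\<lambda>m. max (g m (Z \<omega>')) (\<psi> \<omega>')) \<longlonglongrightarrow> \<psi> \<omega>'"
    proof (rule tendstoI)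
      fix \<epsilon> :: real assume \<epsilon>: "\<epsilon> > 0"
      then obtain m where m: "g m (Z \<omega>') \<le> \<psi> \<omega>' + \<epsilon> / 2" using ex[of "\<epsilon> / 2"] by auto
      show "\<forall>\<^sub>F m in sequentially. dist (max (g m (Z \<omega>')) (\<psi> \<omega>')) (\<psi> \<omega>') < \<epsilon>"
        using eventually_ge_at_top[of m]
      proof eventually_elim
        case (elim k)
        then show ?case using anti[OF elim, of "Z \<omega>'"] m \<epsilon> by (auto simp: dist_real_def max_def)
      qed
    qed
  qed
  have "(\<lambda>m. \<integral>\<omega>. max (g m (Z \<omega>)) (\<psi> \<omega>) \<partial>N) \<longlonglongrightarrow> (\<integral>\<omega>. \<psi> \<omega> \<partial>N)"
  proof (rule integral_dominated_convergence[where w = "\<lambda>_. B"])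
    show "AE \<omega> in N. norm (max (g m (Z \<omega>)) (\<psi> \<omega>)) \<le> B" for m
      using g_bd B(2) by (intro AE_I2) (auto simp: max_def)
  qed (use lim \<psi> gZ in auto)
  from order_tendstoD(2)[OF this, of "(\<integral>\<omega>. \<psi> \<omega> \<partial>N) + e / 2"] e
  have "\<forall>\<^sub>F m in sequentially. (\<integral>\<omega>. max (g m (Z \<omega>)) (\<psi> \<omega>) \<partial>N) < (\<integral>\<omega>. \<psi> \<omega> \<partial>N) + e / 2" by simp
  then obtain m where m: "(\<integral>\<omega>. max (g m (Z \<omega>)) (\<psi> \<omega>) \<partial>N) < (\<integral>\<omega>. \<psi> \<omega> \<partial>N) + e / 2"
    using eventually_happens'[OF sequentially_bot] by blast
  have "(\<integral>\<omega>. g m (Z \<omega>) \<partial>N) \<le> (\<integral>\<omega>. max (g m (Z \<omega>)) (\<psi> \<omega>) \<partial>N)" by (rule integral_mono[OF iZ imax]) simp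
  with m have m': "(\<integral>\<omega>. g m (Z \<omega>) \<partial>N) < (\<integral>\<omega>. \<psi> \<omega> \<partial>N) + e / 2" by linarith
  have "((\<lambda>t. \<integral>\<omega>. g m (Y t \<omega>) \<partial>M) \<longlongrightarrow> (\<integral>\<omega>. g m (Z \<omega>) \<partial>N)) at_top"
    by (rule conv[OF g_cont]) (use g_bd in \<open>auto intro!: boundedI[of _ B]\<close>)
  from order_tendstoD(2)[OF this m'] Y \<phi> G(3) eventually_ge_at_top[of "real m"]
  have "\<forall>\<^sub>F t in at_top. (\<integral>\<omega>. g m (Y t \<omega>) \<partial>M) < (\<integral>\<omega>. \<psi> \<omega> \<partial>N) + e / 2 \<and> (\<integral>\<omega>. \<phi> t \<omega> \<partial>M) \<le> (\<integral>\<omega>. g m (Y t \<omega>) \<partial>M)"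
  proof eventually_elim
    case (elim t)
    have "(\<integral>\<omega>. \<phi> t \<omega> \<partial>M) \<le> (\<integral>\<omega>. g m (Y t \<omega>) \<partial>M)"
    proof (rule integral_mono_AE)
      show "integrable M (\<phi> t)" by (rule M.integrable_const_bound[of _ B]) (use B(1) elim(3) in \<open>auto intro!: AE_I2\<close>)
      show "integrable M (\<lambda>\<omega>. g m (Y t \<omega>))"
        by (rule M.integrable_const_bound[of _ B]) (use g_bd borel_of_real_measurable[OF elim(2) g_cont] in auto)
      show "AE \<omega> in M. \<phi> t \<omega> \<le> g m (Y t \<omega>)"
        using elim(4)
      proof (rule AE_mp, intro AE_I2 impI)
        fix \<omega> assume "\<omega> \<in> G t"
        then show "\<phi> t \<omega> \<le> g m (Y t \<omega>)"
          using g_ge'[OF elim(5), of \<omega> "Y t \<omega>"] G(2) top by simp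
      qed
    qed
    with elim(1) show ?case by simp
  qed
  then show ?thesis by eventually_elim (use e in linarith)
qed

text \<open>Convergence in distribution is transported by functions that vary with \<open>t\<close>, provided they converge along
  sequences that converge to a typical point of the limit. The functions \<open>\<phi> t\<close> are given on the
  probability space, not on \<open>T\<close>: \<open>G t\<close> may exclude a null set on which they are unrelated to \<open>Y t\<close>,
  for instance one on which \<open>Y t\<close> differs from the process that it represents.\<close>

theorem extended_continuous_mapping:
  fixes \<phi> :: "real \<Rightarrow> 'w \<Rightarrow> real"
  assumes \<phi>: "\<forall>\<^sub>F t in at_top. \<phi> t \<in> borel_measurable M" and \<psi>: "\<psi> \<in> borel_measurable N"
    and B: "\<And>t \<omega>. \<omega> \<in> space M \<Longrightarrow> \<bar>\<phi> t \<omega>\<bar> \<le> B" "\<And>\<omega>. \<omega> \<in> space N \<Longrightarrow> \<bar>\<psi> \<omega>\<bar> \<le> B"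
    and seq: "AE \<omega>' in N. \<forall>t \<omega>. filterlim t at_top sequentially \<longrightarrow> (\<forall>n. \<omega> n \<in> G (t n)) \<longrightarrow>
        limitin T (\<lambda>n::nat. Y (t n) (\<omega> n)) (Z \<omega>') sequentially \<longrightarrow> (\<lambda>n. \<phi> (t n) (\<omega> n)) \<longlonglongrightarrow> \<psi> \<omega>'"
  shows "((\<lambda>t. \<integral>\<omega>. \<phi> t \<omega> \<partial>M) \<longlongrightarrow> (\<integral>\<omega>. \<psi> \<omega> \<partial>N)) at_top"
proof (rule tendstoI)
  fix e :: real assume e: "e > 0"
  have "\<forall>\<^sub>F t in at_top. (\<integral>\<omega>. \<phi> t \<omega> \<partial>M) < (\<integral>\<omega>. \<psi> \<omega> \<partial>N) + e"
    by (rule extended_mapping_upper[OF assms e])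
  moreover have "\<forall>\<^sub>F t in at_top. (\<integral>\<omega>. - \<phi> t \<omega> \<partial>M) < (\<integral>\<omega>. - \<psi> \<omega> \<partial>N) + e"
  proof (rule extended_mapping_upper[OF _ _ _ _ _ e])
    show "\<forall>\<^sub>F t in at_top. (\<lambda>\<omega>. - \<phi> t \<omega>) \<in> borel_measurable M"
      using \<phi> by eventually_elim (rule borel_measurable_uminus)
    show "(\<lambda>\<omega>. - \<psi> \<omega>) \<in> borel_measurable N" using \<psi> by (rule borel_measurable_uminus)
    show "AE \<omega>' in N. \<forall>t \<omega>. filterlim t at_top sequentially \<longrightarrow> (\<forall>n. \<omega> n \<in> G (t n)) \<longrightarrow>
        limitin T (\<lambda>n::nat. Y (t n) (\<omega> n)) (Z \<omega>') sequentially \<longrightarrow> (\<lambda>n. - \<phi> (t n) (\<omega> n)) \<longlonglongrightarrow> - \<psi> \<omega>'"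
      using seq by (rule AE_mp) (intro AE_I2 impI allI tendsto_minus, blast)
  qed (use B in simp_all)
  ultimately show "\<forall>\<^sub>F t in at_top. dist (\<integral>\<omega>. \<phi> t \<omega> \<partial>M) (\<integral>\<omega>. \<psi> \<omega> \<partial>N) < e"
    by eventually_elim (simp add: dist_real_def abs_less_iff)
qed

end

section \<open>Measurable versions of the processes\<close>

text \<open>Riemann sums use only finitely many values of the two functions.\<close>

lemma ls_conv_measurable:
  assumes f: "\<And>\<omega>. \<omega> \<in> space M \<Longrightarrow> cadlag_on_nonneg (f \<omega>)" "\<And>s. 0 \<le> s \<Longrightarrow> (\<lambda>\<omega>. f \<omega> s) \<in> borel_measurable M"
    and g: "\<And>\<omega>. \<omega> \<in> space M \<Longrightarrow> stieltjes (g \<omega>)" "\<And>s. 0 \<le> s \<Longrightarrow> (\<lambda>\<omega>. g \<omega> s) \<in> borel_measurable M"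
    and u: "0 \<le> u"
  shows "(\<lambda>\<omega>. ls_conv (f \<omega>) (g \<omega>) u) \<in> borel_measurable M"
proof (rule borel_measurable_LIMSEQ_real)
  show "(\<lambda>n. riemann_conv (f \<omega>) (g \<omega>) u n) \<longlonglongrightarrow> ls_conv (f \<omega>) (g \<omega>) u" if "\<omega> \<in> space M" for \<omega>
    by (rule riemann_conv_tendsto[OF f(1)[OF that] g(1)[OF that] u])
  show "(\<lambda>\<omega>. riemann_conv (f \<omega>) (g \<omega>) u n) \<in> borel_measurable M" for n
    unfolding riemann_conv_def
  proof (intro borel_measurable_add borel_measurable_times borel_measurable_sum borel_measurable_diff f g u order_refl)
    fix k assume "k \<in> {..<n}"
    then show "0 \<le> u - u * real k / real n" using riemann_grid_le[OF u, of k n] by simp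
  qed (rule riemann_grid_mono(1)[OF u])+
qed

lemma conv_power_measurable:
  assumes g: "\<And>\<omega>. \<omega> \<in> space M \<Longrightarrow> stieltjes (g \<omega>)" "\<And>s. 0 \<le> s \<Longrightarrow> (\<lambda>\<omega>. g \<omega> s) \<in> borel_measurable M"
    and u: "0 \<le> u"
  shows "(\<lambda>\<omega>. conv_power (g \<omega>) j u) \<in> borel_measurable M"
  using u
proof (induction j arbitrary: u)
  case (Suc j)
  have "(\<lambda>\<omega>. ls_conv (conv_power (g \<omega>) j) (g \<omega>) u) \<in> borel_measurable M"
    by (intro ls_conv_measurable conv_power_cadlag g Suc)
  then show ?case
    by (subst measurable_cong[OF conv_power_Suc[OF g(1) Suc.prems]])
qed simp

lemma limit_path_eq_ls_conv:
  assumes "cadlag_on_nonneg w" "0 < \<alpha>" "2 \<le> j" "0 \<le> u"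
  shows "limit_path \<alpha> w j u = real j * ls_conv w (\<lambda>y. y powr (\<alpha> * (real j - 1))) u"
  using ls_conv_powr[OF assms(1) _ assms(4), of "\<alpha> * (real j - 1)"] assms
  by (simp add: limit_path_def Let_def)

lemma limit_path_cadlag:
  assumes w: "cadlag_on_nonneg w" and \<alpha>: "0 < \<alpha>" and j: "1 \<le> j"
  shows "cadlag_on_nonneg (limit_path \<alpha> w j)"
proof (cases "j = 1")
  case True
  then have "limit_path \<alpha> w j = w" by (simp add: limit_path_def fun_eq_iff)
  then show ?thesis using w by simp
next
  case False
  then have j: "2 \<le> j" using j by simp
  then have "stieltjes (\<lambda>y. y powr (\<alpha> * (real j - 1)))" using \<alpha> by (intro stieltjes_powr) simp
  then have "cadlag_on_nonneg (\<lambda>u. real j * ls_conv w (\<lambda>y. y powr (\<alpha> * (real j - 1))) u)"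
    by (intro cadlag_cmult ls_conv_cadlag w)
  then show ?thesis
    using cadlag_cong[OF limit_path_eq_ls_conv[OF w \<alpha> j]] by (rule iffD2[rotated])
qed

lemma limit_path_measurable:
  assumes w: "\<And>\<omega>. \<omega> \<in> space M \<Longrightarrow> cadlag_on_nonneg (w \<omega>)" "\<And>s. 0 \<le> s \<Longrightarrow> (\<lambda>\<omega>. w \<omega> s) \<in> borel_measurable M"
    and \<alpha>: "0 < \<alpha>" and j: "1 \<le> j" and u: "0 \<le> u"
  shows "(\<lambda>\<omega>. limit_path \<alpha> (w \<omega>) j u) \<in> borel_measurable M"
proof (cases "j = 1")
  case True
  then show ?thesis using w(2)[OF u] by (simp add: limit_path_def)
next
  case False
  then have j: "2 \<le> j" using j by simp
  have "(\<lambda>\<omega>. real j * ls_conv (w \<omega>) (\<lambda>y. y powr (\<alpha> * (real j - 1))) u) \<in> borel_measurable M"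
    using \<alpha> j by (intro borel_measurable_times borel_measurable_const ls_conv_measurable w stieltjes_powr u) auto
  then show ?thesis
    by (subst measurable_cong[OF limit_path_eq_ls_conv[OF w(1) \<alpha> j u]])
qed

lemma continuous_on_nonneg_if_Hoelder:
  fixes w :: "real \<Rightarrow> real"
  assumes \<gamma>: "0 < \<gamma>" and V: "\<And>n x y. x \<in> {0..real (Suc n)} \<Longrightarrow> y \<in> {0..real (Suc n)} \<Longrightarrow> \<bar>w x - w y\<bar> \<le> V n * \<bar>x - y\<bar> powr \<gamma>"
  shows "continuous_on {0..} w"
  unfolding continuous_on_def
proof
  fix x :: real assume x: "x \<in> {0..}"
  obtain n where n: "x < real n" using reals_Archimedean2 by blast
  have "((\<lambda>y. w y - w x) \<longlongrightarrow> 0) (at x within {0..})"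
  proof (rule Lim_null_comparison)
    have "norm (w y - w x) \<le> V n * \<bar>y - x\<bar> powr \<gamma>" if "y \<in> {0..}" "dist y x < real n - x" for y
      using V[of y n x] that x n by (simp add: dist_real_def)
    then show "\<forall>\<^sub>F y in at x within {0..}. norm (w y - w x) \<le> V n * \<bar>y - x\<bar> powr \<gamma>"
      unfolding eventually_at using n by (intro exI[of _ "real n - x"]) simp
    have "((\<lambda>y. \<bar>y - x\<bar>) \<longlongrightarrow> 0) (at x within {0..})" by (intro tendsto_eq_intros) auto
    then have "((\<lambda>y. \<bar>y - x\<bar> powr \<gamma>) \<longlongrightarrow> 0) (at x within {0..})"
      using \<gamma> by (intro tendsto_zero_powrI[where b = \<gamma>]) auto
    then show "((\<lambda>y. V n * \<bar>y - x\<bar> powr \<gamma>) \<longlongrightarrow> 0) (at x within {0..})" by (rule tendsto_mult_right_zero)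
  qed
  then show "(w \<longlongrightarrow> w x) (at x within {0..})" by (rule LIM_zero_cancel)
qed

section \<open>Weak convergence of convolution powers\<close>

text \<open>Outcomes in a null set with bad paths get the zero path, so that path properties hold everywhere. The
  set where nothing changes is measurable, which preserves measurability of the coordinates.\<close>

lemma AE_modification:
  assumes P: "AE \<omega> in M. P (\<lambda>s::real. Y s \<omega>)" and "P (\<lambda>s. 0)"
    and Y: "\<And>s. 0 \<le> s \<Longrightarrow> Y s \<in> borel_measurable M"
  obtains A Y' where "A \<in> sets M" "AE \<omega> in M. \<omega> \<in> A"
    "\<And>\<omega>. P (Y' \<omega>)" "\<And>s. 0 \<le> s \<Longrightarrow> (\<lambda>\<omega>. Y' \<omega> s) \<in> borel_measurable M"
    "\<And>\<omega>. \<omega> \<in> A \<Longrightarrow> Y' \<omega> = (\<lambda>s. Y s \<omega> :: real)"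
proof -
  obtain N where N: "N \<in> null_sets M" "{\<omega> \<in> space M. \<not> P (\<lambda>s. Y s \<omega>)} \<subseteq> N"
    using P by (auto simp: eventually_ae_filter)
  define A where "A = space M - N"
  have A: "A \<in> sets M" using N(1) by (auto simp: A_def)
  show thesis
  proof (rule that[OF A, of "\<lambda>\<omega>. if \<omega> \<in> A then (\<lambda>s. Y s \<omega>) else (\<lambda>s. 0)"])
    show "AE \<omega> in M. \<omega> \<in> A"
      using AE_not_in[OF N(1)] by (rule AE_mp) (auto simp: A_def intro!: AE_I2)
    show "P (if \<omega> \<in> A then (\<lambda>s. Y s \<omega>) else (\<lambda>s. 0))" for \<omega>
      using N(2) assms(2) by (cases "\<omega> \<in> A") (auto simp: A_def)
    show "(\<lambda>\<omega>. (if \<omega> \<in> A then (\<lambda>s. Y s \<omega>) else (\<lambda>s. 0)) s) \<in> borel_measurable M" if "0 \<le> s" for s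
    proof -
      have "(\<lambda>\<omega>. if \<omega> \<in> A then Y s \<omega> else 0) \<in> borel_measurable M"
        using Y[OF that] A by (intro measurable_If_set) auto
      also have "(\<lambda>\<omega>. if \<omega> \<in> A then Y s \<omega> else 0) = (\<lambda>\<omega>. (if \<omega> \<in> A then (\<lambda>s. Y s \<omega>) else (\<lambda>s. 0)) s)"
        by auto
      finally show ?thesis .
    qed
  qed simp
qed

lemma restrict_cadlag_skorokhod:
  assumes "cadlag_on_nonneg f"
  shows "(\<lambda>u\<in>{0..}. f u) \<in> skorokhod_space"
proof -
  have "cadlag_on_nonneg (\<lambda>u\<in>{0..}. f u) \<longleftrightarrow> cadlag_on_nonneg f" by (rule cadlag_cong) simp
  then show ?thesis using assms by (simp add: skorokhod_space_def)
qed

theorem theorem2p1: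
  fixes M :: "'w measure" and N :: "'v measure"
    and X :: "real \<Rightarrow> 'w \<Rightarrow> real" and W :: "real \<Rightarrow> 'v \<Rightarrow> real"
    and a b :: "real \<Rightarrow> real" and \<alpha> :: real
  assumes "prob_space M" and "prob_space N"
    and X_process: "\<And>t. t \<ge> 0 \<Longrightarrow> X t \<in> borel_measurable M"
    and X_paths: "AE \<omega> in M. mono_on {0..} (\<lambda>t. X t \<omega>) \<and>
                    (\<forall>t\<ge>0. ((\<lambda>s. X s \<omega>) \<longlongrightarrow> X t \<omega>) (at_right t))"
    and a_pos: "\<And>t. t > 0 \<Longrightarrow> a t > 0"
    and a_lim: "filterlim a at_top at_top"
    and b_pos: "\<And>t. t > 0 \<Longrightarrow> b t > 0"
    and b_mono: "mono_on {0..} b"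
    and b_rcont: "\<And>t. t \<ge> 0 \<Longrightarrow> (b \<longlongrightarrow> b t) (at_right t)"
    and b_rv: "regularly_varying b \<alpha>" and alpha_pos: "\<alpha> > 0"
    and b_over_a: "filterlim (\<lambda>t. b t / a t) at_top at_top"
    and W_process: "\<And>u. u \<ge> 0 \<Longrightarrow> W u \<in> borel_measurable N"
    and W_Hoelder: "\<exists>\<gamma>. 0 < \<gamma> \<and> \<gamma> \<le> 1 \<and>
          (\<forall>T>0. \<exists>V\<in>borel_measurable N. (AE \<omega> in N. V \<omega> > 0) \<and>
             (AE \<omega> in N. \<forall>x\<in>{0..T}. \<forall>y\<in>{0..T}. \<bar>W x \<omega> - W y \<omega>\<bar> \<le> V \<omega> * \<bar>x - y\<bar> powr \<gamma>))"
    and conv: "weakly_converges skorokhod_J1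
          M (\<lambda>t \<omega>. \<lambda>u\<in>{0..}. (X (u * t) \<omega> - b (u * t)) / a t)
          N (\<lambda>\<omega>. \<lambda>u\<in>{0..}. W u \<omega>) at_top"
  shows "weakly_converges (product_topology (\<lambda>j. skorokhod_J1) {1::nat..})
          M (\<lambda>t \<omega>. \<lambda>j\<in>{1..}. \<lambda>u\<in>{0..}.
               (conv_power (\<lambda>s. X s \<omega>) j (u * t) - conv_power b j (u * t))
                 / (a t * conv_power b (j - 1) t))
          N (\<lambda>\<omega>. \<lambda>j\<in>{1..}. \<lambda>u\<in>{0..}. limit_path \<alpha> (\<lambda>s. W s \<omega>) j u) at_top"
proof -
  let ?D = "product_topology (\<lambda>j. skorokhod_J1) {1::nat..}"
  have b: "stieltjes b" using b_mono b_rcont by (simp add: stieltjes_def)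
  have X_stieltjes: "AE \<omega> in M. stieltjes (\<lambda>s. X s \<omega>)" using X_paths by (simp add: stieltjes_def)
  obtain X' A where A: "A \<in> sets M" "AE \<omega> in M. \<omega> \<in> A"
    and X': "\<And>\<omega>. stieltjes (X' \<omega>)" "\<And>s. 0 \<le> s \<Longrightarrow> (\<lambda>\<omega>. X' \<omega> s) \<in> borel_measurable M"
      "\<And>\<omega>. \<omega> \<in> A \<Longrightarrow> X' \<omega> = (\<lambda>s. X s \<omega>)"
  proof (rule AE_modification[where M = M and P = stieltjes and Y = X, OF X_stieltjes stieltjes_const X_process])
    fix A X'
    assume "A \<in> sets M" "AE \<omega> in M. \<omega> \<in> A" "\<And>\<omega>. stieltjes (X' \<omega>)"
      "\<And>s. 0 \<le> s \<Longrightarrow> (\<lambda>\<omega>. X' \<omega> s) \<in> borel_measurable M" "\<And>\<omega>. \<omega> \<in> A \<Longrightarrow> X' \<omega> = (\<lambda>s. X s \<omega>)"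
    then show thesis by (rule that)
  qed
  have W_cont: "AE \<omega> in N. continuous_on {0..} (\<lambda>s. W s \<omega>)"
  proof -
    let ?H = "\<lambda>\<gamma> T V \<omega>. \<forall>x\<in>{0..T}. \<forall>y\<in>{0..T}. \<bar>W x \<omega> - W y \<omega>\<bar> \<le> V * \<bar>x - y\<bar> powr \<gamma>"
    obtain \<gamma> where \<gamma>: "0 < \<gamma>"
      "\<forall>T>0. \<exists>V\<in>borel_measurable N. (AE \<omega> in N. V \<omega> > 0) \<and> (AE \<omega> in N. ?H \<gamma> T (V \<omega>) \<omega>)"
      using W_Hoelder by (elim exE conjE) (rule that)
    have "\<forall>n. \<exists>V. AE \<omega> in N. ?H \<gamma> (real (Suc n)) (V \<omega>) \<omega>"
    proof
      fix n
      have "0 < real (Suc n)" by simp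
      with \<gamma>(2) have "\<exists>V\<in>borel_measurable N. (AE \<omega> in N. V \<omega> > 0) \<and> (AE \<omega> in N. ?H \<gamma> (real (Suc n)) (V \<omega>) \<omega>)"
        by (elim allE impE)
      then show "\<exists>V. AE \<omega> in N. ?H \<gamma> (real (Suc n)) (V \<omega>) \<omega>" by (elim bexE conjE exI)
    qed
    from choice[OF this] obtain V where "\<forall>n. AE \<omega> in N. ?H \<gamma> (real (Suc n)) (V n \<omega>) \<omega>" ..
    then have "AE \<omega> in N. \<forall>n. ?H \<gamma> (real (Suc n)) (V n \<omega>) \<omega>"
      unfolding AE_all_countable .
    then show ?thesis
    proof (rule AE_mp, intro AE_I2 impI)
      fix \<omega> assume "\<forall>n. ?H \<gamma> (real (Suc n)) (V n \<omega>) \<omega>"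
      then show "continuous_on {0..} (\<lambda>s. W s \<omega>)"
        by (intro continuous_on_nonneg_if_Hoelder[OF \<gamma>(1), where V = "\<lambda>n. V n \<omega>"]) blast
    qed
  qed
  obtain W' C where C: "C \<in> sets N" "AE \<omega> in N. \<omega> \<in> C"
    and W': "\<And>\<omega>. continuous_on {0..} (W' \<omega>)" "\<And>s. 0 \<le> s \<Longrightarrow> (\<lambda>\<omega>. W' \<omega> s) \<in> borel_measurable N"
      "\<And>\<omega>. \<omega> \<in> C \<Longrightarrow> W' \<omega> = (\<lambda>s. W s \<omega>)"
  proof (rule AE_modification[where M = N and P = "continuous_on {0..}" and Y = W, OF W_cont continuous_on_const W_process])
    fix C W'
    assume "C \<in> sets N" "AE \<omega> in N. \<omega> \<in> C" "\<And>\<omega>. continuous_on {0..} (W' \<omega>)"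
      "\<And>s. 0 \<le> s \<Longrightarrow> (\<lambda>\<omega>. W' \<omega> s) \<in> borel_measurable N" "\<And>\<omega>. \<omega> \<in> C \<Longrightarrow> W' \<omega> = (\<lambda>s. W s \<omega>)"
    then show thesis by (rule that)
  qed
  have W'_cadlag: "cadlag_on_nonneg (W' \<omega>)" for \<omega> by (rule cadlag_continuous[OF W'(1)])

  \<comment> \<open>the normalized convolution powers and the limit processes, with regular paths for every outcome\<close>
  define U where "U t \<omega> = (\<lambda>j\<in>{1::nat..}. \<lambda>u\<in>{0..}.
      (conv_power (X' \<omega>) j (u * t) - conv_power b j (u * t)) / (a t * conv_power b (j - 1) t))" for t \<omega>
  define L where "L \<omega> = (\<lambda>j\<in>{1::nat..}. \<lambda>u\<in>{0..}. limit_path \<alpha> (W' \<omega>) j u)" for \<omega>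

  have U_top: "U t \<omega> \<in> topspace ?D" if t: "t > 0" for t \<omega>
  proof -
    have "cadlag_on_nonneg (\<lambda>u. inverse (a t * conv_power b (j - 1) t) * (conv_power (X' \<omega>) j (u * t) - conv_power b j (u * t)))" for j
      by (intro cadlag_cmult cadlag_diff cadlag_time_scale[OF _ t] conv_power_cadlag b X'(1))
    then show ?thesis by (simp add: U_def divide_inverse mult.commute restrict_cadlag_skorokhod)
  qed
  have U_meas: "U t \<in> M \<rightarrow>\<^sub>M borel_of ?D" if t: "t > 0" for t
  proof (rule measurable_product_J1[OF U_top[OF t]])
    fix j :: nat and u :: real assume ju: "j \<in> {1..}" "0 \<le> u"
    have "(\<lambda>\<omega>. (conv_power (X' \<omega>) j (u * t) - conv_power b j (u * t)) / (a t * conv_power b (j - 1) t)) \<in> borel_measurable M"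
      using ju t by (intro borel_measurable_divide borel_measurable_diff borel_measurable_const conv_power_measurable X') auto
    then show "(\<lambda>\<omega>. U t \<omega> j u) \<in> borel_measurable M" using ju by (simp add: U_def)
  qed
  have L_top: "L \<omega> \<in> topspace ?D" for \<omega>
    using limit_path_cadlag[OF W'_cadlag alpha_pos] by (simp add: L_def restrict_cadlag_skorokhod)
  have L_meas: "L \<in> N \<rightarrow>\<^sub>M borel_of ?D"
  proof (rule measurable_product_J1[OF L_top])
    fix j :: nat and u :: real assume ju: "j \<in> {1..}" "0 \<le> u"
    then show "(\<lambda>\<omega>. L \<omega> j u) \<in> borel_measurable N"
      using limit_path_measurable[of N W' \<alpha> j u] W'_cadlag W'(2) alpha_pos by (simp add: L_def)
  qed

  have path_limit: "limitin ?D (\<lambda>n. U (t n) (\<omega> n)) (L \<omega>') sequentially"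
    if t: "filterlim t at_top sequentially" "\<And>n. t n > 0" and \<omega>: "\<And>n. \<omega> n \<in> A" "\<omega>' \<in> C"
      and lim: "limitin skorokhod_J1 (\<lambda>n. \<lambda>u\<in>{0..}. (X (u * t n) (\<omega> n) - b (u * t n)) / a (t n)) (\<lambda>u\<in>{0..}. W u \<omega>') sequentially"
    for t :: "nat \<Rightarrow> real" and \<omega> \<omega>'
  proof -
    have "loc_uniform (\<lambda>n. \<lambda>u\<in>{0..}. (X (u * t n) (\<omega> n) - b (u * t n)) / a (t n)) (\<lambda>u\<in>{0..}. W u \<omega>')"
    proof (rule loc_uniform_if_limitin_J1[OF lim])
      show "continuous_on {0..} (\<lambda>u\<in>{0..}. W u \<omega>')"
        using W'(1)[of \<omega>'] unfolding W'(3)[OF \<omega>(2)] by (rule continuous_on_eq) simp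
    qed
    then have "loc_uniform (\<lambda>n u. (X' (\<omega> n) (u * t n) - b (u * t n)) / a (t n)) (W' \<omega>')"
      by (rule loc_uniform_cong[THEN iffD1, rotated 2]) (simp_all add: X'(3)[OF \<omega>(1)] W'(3)[OF \<omega>(2)])
    note main = scaled_conv_power_loc_uniform[OF t b a_pos a_lim b_rv alpha_pos b_over_a X'(1) W'_cadlag this]
    show ?thesis
      unfolding limitin_componentwise
    proof (intro conjI ballI always_eventually allI U_top t(2))
      show "L \<omega>' \<in> extensional {1..}" by (simp add: L_def)
      fix j :: nat assume j: "j \<in> {1..}"
      show "limitin skorokhod_J1 (\<lambda>n. U (t n) (\<omega> n) j) (L \<omega>' j) sequentially"
      proof (rule limitin_J1_if_loc_uniform)
        show "loc_uniform (\<lambda>n. U (t n) (\<omega> n) j) (L \<omega>' j)"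
          by (rule loc_uniform_cong[THEN iffD1, OF _ _ main[of j]]) (use j in \<open>simp_all add: U_def L_def\<close>)
        show "L \<omega>' j \<in> skorokhod_space" using L_top[of \<omega>'] j by (auto simp: PiE_iff)
        show "U (t n) (\<omega> n) j \<in> skorokhod_space" for n using U_top[OF t(2), of n "\<omega> n"] j by (auto simp: PiE_iff)
      qed
    qed
  qed

  obtain Y Z where Y: "\<forall>\<^sub>F t in at_top. Y t \<in> M \<rightarrow>\<^sub>M borel_of skorokhod_J1 \<and>
        (AE \<omega> in M. Y t \<omega> = (\<lambda>u\<in>{0..}. (X (u * t) \<omega> - b (u * t)) / a t))"
    and Z: "Z \<in> N \<rightarrow>\<^sub>M borel_of skorokhod_J1" "AE \<omega> in N. Z \<omega> = (\<lambda>u\<in>{0..}. W u \<omega>)"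
    and YZ: "\<And>h. continuous_map skorokhod_J1 euclideanreal h \<Longrightarrow> bounded (h ` topspace skorokhod_J1) \<Longrightarrow>
           ((\<lambda>t. \<integral>\<omega>. h (Y t \<omega>) \<partial>M) \<longlongrightarrow> (\<integral>\<omega>. h (Z \<omega>) \<partial>N)) at_top"
    using conv unfolding weakly_converges_def by blast
  define G where "G t = {\<omega> \<in> space M. t > 0 \<and> \<omega> \<in> A \<and> Y t \<omega> \<in> topspace skorokhod_J1 \<and>
      Y t \<omega> = (\<lambda>u\<in>{0..}. (X (u * t) \<omega> - b (u * t)) / a t)}" for t
  have G_AE: "\<forall>\<^sub>F t in at_top. AE \<omega> in M. \<omega> \<in> G t"
    using Y eventually_gt_at_top[of "0::real"]
  proof eventually_elim
    case (elim t)
    then have m: "Y t \<in> M \<rightarrow>\<^sub>M borel_of skorokhod_J1" and t: "t > 0"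
      and eq: "AE \<omega> in M. Y t \<omega> = (\<lambda>u\<in>{0..}. (X (u * t) \<omega> - b (u * t)) / a t)" by blast+
    from A(2) eq AE_space show ?case
    proof eventually_elim
      case (elim \<omega>)
      then show ?case using borel_of_measurableD(1)[OF m elim(3)] t unfolding G_def by blast
    qed
  qed

  have "((\<lambda>t. \<integral>\<omega>. H (U t \<omega>) \<partial>M) \<longlongrightarrow> (\<integral>\<omega>. H (L \<omega>) \<partial>N)) at_top"
    if H: "continuous_map ?D euclideanreal H" "bounded (H ` topspace ?D)" for H
  proof -
    obtain B where B: "\<And>y. y \<in> topspace ?D \<Longrightarrow> \<bar>H y\<bar> \<le> B" using H(2) unfolding bounded_iff by auto
    \<comment> \<open>for \<open>t \<le> 0\<close> the paths of \<open>U t\<close> need not be cadlag, and \<open>H\<close> need not be bounded on them\<close>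
    define \<phi> where "\<phi> t \<omega> = (if t > 0 then H (U t \<omega>) else 0)" for t \<omega>
    have B0: "0 \<le> B" using B[OF L_top] abs_ge_zero order_trans by blast
    have "((\<lambda>t. \<integral>\<omega>. \<phi> t \<omega> \<partial>M) \<longlongrightarrow> (\<integral>\<omega>. H (L \<omega>) \<partial>N)) at_top"
    proof (rule extended_continuous_mapping[OF metrizable_skorokhod_J1 assms(1,2) _ Z(1) YZ, where B = B and G = G])
      show "\<forall>\<^sub>F t in at_top. Y t \<in> M \<rightarrow>\<^sub>M borel_of skorokhod_J1" using Y by eventually_elim blast
      show "\<forall>\<^sub>F t in at_top. \<phi> t \<in> borel_measurable M"
        using eventually_gt_at_top[of "0::real"]
      proof eventually_elim
        case (elim t)
        then show ?case using borel_of_real_measurable[OF U_meas[OF elim] H(1)] by (simp add: \<phi>_def[abs_def])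
      qed
      show "(\<lambda>\<omega>. H (L \<omega>)) \<in> borel_measurable N" by (rule borel_of_real_measurable[OF L_meas H(1)])
      show "\<bar>\<phi> t \<omega>\<bar> \<le> B" for t \<omega> using B[OF U_top] B0 by (simp add: \<phi>_def)
      show "\<bar>H (L \<omega>)\<bar> \<le> B" for \<omega> by (rule B[OF L_top])
      show "G t \<subseteq> space M" for t by (auto simp: G_def)
      show "Y t \<omega> \<in> topspace skorokhod_J1" if "\<omega> \<in> G t" for t \<omega>
        using that unfolding G_def by blast
      show "\<forall>\<^sub>F t in at_top. AE \<omega> in M. \<omega> \<in> G t" by (rule G_AE)
      show "AE \<omega>' in N. \<forall>t \<omega>. filterlim t at_top sequentially \<longrightarrow> (\<forall>n. \<omega> n \<in> G (t n)) \<longrightarrow>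
        limitin skorokhod_J1 (\<lambda>n::nat. Y (t n) (\<omega> n)) (Z \<omega>') sequentially \<longrightarrow> (\<lambda>n. \<phi> (t n) (\<omega> n)) \<longlonglongrightarrow> H (L \<omega>')"
        using Z(2) C(2)
      proof eventually_elim
        case (elim \<omega>')
        show ?case
        proof (intro allI impI)
          fix t :: "nat \<Rightarrow> real" and \<omega>
          assume t: "filterlim t at_top sequentially" and \<omega>: "\<forall>n. \<omega> n \<in> G (t n)"
            and lim: "limitin skorokhod_J1 (\<lambda>n::nat. Y (t n) (\<omega> n)) (Z \<omega>') sequentially"
          have g: "t n > 0" "\<omega> n \<in> A" "Y (t n) (\<omega> n) = (\<lambda>u\<in>{0..}. (X (u * t n) (\<omega> n) - b (u * t n)) / a (t n))" for n
            using \<omega> unfolding G_def by blast+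
          have "limitin ?D (\<lambda>n. U (t n) (\<omega> n)) (L \<omega>') sequentially"
            by (rule path_limit[OF t g(1,2) elim(2)]) (use lim in \<open>simp add: g(3) elim(1)\<close>)
          from continuous_map_limit[OF H(1) this]
          have "(\<lambda>n. H (U (t n) (\<omega> n))) \<longlonglongrightarrow> H (L \<omega>')" by (simp add: o_def)
          then show "(\<lambda>n. \<phi> (t n) (\<omega> n)) \<longlonglongrightarrow> H (L \<omega>')" using g(1) by (simp add: \<phi>_def)
        qed
      qed
    qed
    moreover have "\<forall>\<^sub>F t in at_top. (\<integral>\<omega>. \<phi> t \<omega> \<partial>M) = (\<integral>\<omega>. H (U t \<omega>) \<partial>M)"
      using eventually_gt_at_top[of "0::real"] by eventually_elim (simp add: \<phi>_def)
    ultimately show ?thesis by (rule Lim_transform_eventually)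
  qed
  moreover have "\<forall>\<^sub>F t in at_top. U t \<in> M \<rightarrow>\<^sub>M borel_of ?D \<and> (AE \<omega> in M. U t \<omega> =
      (\<lambda>j\<in>{1..}. \<lambda>u\<in>{0..}. (conv_power (\<lambda>s. X s \<omega>) j (u * t) - conv_power b j (u * t)) / (a t * conv_power b (j - 1) t)))"
    using eventually_gt_at_top[of "0::real"]
  proof eventually_elim
    case (elim t)
    show ?case
      using A(2) by (intro conjI U_meas[OF elim]) (rule AE_mp, auto simp: U_def X'(3) intro!: AE_I2)
  qed
  moreover have "AE \<omega> in N. L \<omega> = (\<lambda>j\<in>{1..}. \<lambda>u\<in>{0..}. limit_path \<alpha> (\<lambda>s. W s \<omega>) j u)"
    using C(2) by (rule AE_mp) (auto simp: L_def W'(3) intro!: AE_I2)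
  ultimately show ?thesis
    unfolding weakly_converges_def using L_meas by blast
qed

end
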